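(* Let $\ell,m,n\ge1$ and let $V_n^{(\ell,m)}\subseteq\mathbb{C}[x_1,\dots,x_{n+1}]$ be the span of the polynomials $p(G)$ for $G$ ranging over slim sub-multigraphs of $K^{(\ell,m)}_{n+1}$, with homogeneous degree-$k$ components $V_n^{(\ell,m)}(k)$. Let $S_n$ act by permuting $x_1,\dots,x_n$. Then for every $k\ge0$, \[ V_n^{(\ell,m)}(k)\cong_{S_n}\bigoplus_D M^{\lambda(D)}, \] the sum over all $(\ell,m)$-Dyck paths $D$ of size $n$ with $\mathrm{area}(D)=k$. Moreover, for $k<n$, $V_n^{(\ell,m)}(k)=\mathrm{Sym}^k(V_n^{(\ell,m)}(1))$, i.e. $V_n^{(\ell,m)}(k)$ equals the span of all products of $k$ elements of $V_n^{(\ell,m)}(1)$. In the case $\ell=m$ (when $V_n^{(\ell,\ell)}$ is stable under $S_{n+1}$ permuting all $n+1$ variables), $V_n^{(\ell,\ell)}(1)$ is the reflection representation of $S_{n+1}$, and the top degree nonzero component of $V_n^{(\ell,\ell)}$ is isomorphic as an $S_{n+1}$-module to $\mathrm{Lie}_n\otimes(\mathrm{sign})^{\otimes\ell}$.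
   Context: $K^{(\ell,m)}_{n+1}$ is the multigraph on $[n+1]$ with $m$ parallel edges between $i$ and $j$ for all $1\le i<j\le n$ and $\ell$ parallel edges between $i$ and $n+1$ for all $1\le i\le n$. A sub-multigraph $G$ is slim if the multiset difference $K^{(\ell,m)}_{n+1}-G$ is a connected multigraph on $[n+1]$. $p(G)=\prod_{e\in G}(x_i-x_j)$, the product over the edges $e=\{i<j\}$ of $G$ counted with multiplicity. An $(\ell,m)$-Dyck path of size $n$ is a lattice path with unit steps $(0,1)$ (vertical) and $(1,0)$ (horizontal) from $(-\ell+1,0)$ to $(mn,n)$ staying weakly above the line $y=x/m$. Its vertical run partition $\lambda(D)\vdash n$ lists the lengths of its maximal runs of vertical steps in weakly decreasing order. Its area partition $\mu(D)$ is the partition with $n$ parts whose Ferrers diagram is the set of unit boxes of the rectangle $[-\ell+1,mn]\times[0,n]$ lying to the upper left of $D$ (equivalently, $\mu_i$ is $\ell-1$ plus the $x$-coordinate of the vertical step of $D$ in the $i$-th row from the top), and $\mathrm{area}(D)=|\mu(D)|$. $M^\lambda=\mathrm{Ind}_{S_\lambda}^{S_n}(\mathbf{1})$ for the Young subgroup $S_\lambda=S_{\lambda_1}\times\cdots\times S_{\lambda_k}$. $C_{n+1}=\langle(1,2,\dots,n+1)\rangle\le S_{n+1}$, $\zeta$ sends $(1,2,\dots,n+1)$ to $e^{2\pi i/(n+1)}$, $\mathrm{Lie}_n=\mathrm{Ind}_{C_{n+1}}^{S_{n+1}}(\zeta)$, and $\mathrm{sign}$ is the sign representation of $S_{n+1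}$.
   Formalization: The clause that V(1) is the reflection representation of S_{n+1} is stated except for ℓ=m=n=1, where it fails: the only slim subgraph is empty, so V(1)=0 while the reflection representation of S_2 is one-dimensional. *)

theory Defs
  imports
    Complex_Main
    "HOL-Library.Multiset"
    "HOL-Library.Poly_Mapping"
    "HOL-Library.Function_Algebras"
    "HOL-Combinatorics.Permutations"
    "HOL-Combinatorics.Cycles"
    "HOL-Algebra.Sym_Groups"
begin

section \<open>Complex representations\<close>

text \<open>
  The underlying vector space of a representation is a subset of an abelian group type that is
  a complex vector space under the scaling stored in the record.
\<close>

record ('g, 'v) crep =
  rep_space :: "'v set"
  rep_scale :: "complex \<Rightarrow> 'v \<Rightarrow> 'v"
  rep_act :: "'g \<Rightarrow> 'v \<Rightarrow> 'v"

definition is_rep :: "('g, 'b) monoid_scheme \<Rightarrow> ('g, 'v::ab_group_add) crep \<Rightarrow> bool" where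
  "is_rep G R \<longleftrightarrow>
     vector_space (rep_scale R) \<and>
     module.subspace (rep_scale R) (rep_space R) \<and>
     (\<forall>g\<in>carrier G. \<forall>v\<in>rep_space R. rep_act R g v \<in> rep_space R) \<and>
     (\<forall>g\<in>carrier G. \<forall>v\<in>rep_space R. \<forall>w\<in>rep_space R.
        rep_act R g (v + w) = rep_act R g v + rep_act R g w) \<and>
     (\<forall>g\<in>carrier G. \<forall>c. \<forall>v\<in>rep_space R.
        rep_act R g (rep_scale R c v) = rep_scale R c (rep_act R g v)) \<and>
     (\<forall>v\<in>rep_space R. rep_act R \<one>\<^bsub>G\<^esub> v = v) \<and>
     (\<forall>g\<in>carrier G. \<forall>h\<in>carrier G. \<forall>v\<in>rep_space R.
        rep_act R (g \<otimes>\<^bsub>G\<^esub> h) v = rep_act R g (rep_act R h v))"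

definition rep_iso ::
  "('g, 'b) monoid_scheme \<Rightarrow> ('g, 'v::ab_group_add) crep \<Rightarrow> ('g, 'w::ab_group_add) crep \<Rightarrow> bool"
where
  "rep_iso G R S \<longleftrightarrow>
     is_rep G R \<and> is_rep G S \<and>
     (\<exists>\<phi>. bij_betw \<phi> (rep_space R) (rep_space S) \<and>
        (\<forall>v\<in>rep_space R. \<forall>w\<in>rep_space R. \<phi> (v + w) = \<phi> v + \<phi> w) \<and>
        (\<forall>c. \<forall>v\<in>rep_space R. \<phi> (rep_scale R c v) = rep_scale S c (\<phi> v)) \<and>
        (\<forall>g\<in>carrier G. \<forall>v\<in>rep_space R. \<phi> (rep_act R g v) = rep_act S g (\<phi> v)))"

definition char_rep :: "('g \<Rightarrow> complex) \<Rightarrow> ('g, complex) crep" where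
  "char_rep \<chi> = \<lparr>rep_space = UNIV, rep_scale = (*), rep_act = (\<lambda>g z. \<chi> g * z)\<rparr>"

text \<open>
  The tensor product of a representation with a one-dimensional one, given by its character
  \<open>\<chi>\<close>: the space \<open>R \<otimes> \<complex>\<close> is identified with \<open>R\<close>.
\<close>

definition tensor_char :: "('g, 'v) crep \<Rightarrow> ('g \<Rightarrow> complex) \<Rightarrow> ('g, 'v) crep" where
  "tensor_char R \<chi> =
     \<lparr>rep_space = rep_space R, rep_scale = rep_scale R,
      rep_act = (\<lambda>g v. rep_scale R (\<chi> g) (rep_act R g v))\<rparr>"

text \<open>
  Induction from a subgroup \<open>H\<close> of a finite group \<open>G\<close>, as the space of functions
  \<open>f : G \<rightarrow> W\<close> with \<open>f (h g) = h (f g)\<close>, on which \<open>G\<close> acts by right translation.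
  Functions are extended by \<open>0\<close> outside \<open>G\<close>.
\<close>

definition induced_rep ::
  "('g, 'b) monoid_scheme \<Rightarrow> 'g set \<Rightarrow> ('g, 'v::ab_group_add) crep \<Rightarrow> ('g, 'g \<Rightarrow> 'v) crep"
where
  "induced_rep G H W =
     \<lparr>rep_space = {f. (\<forall>g. g \<notin> carrier G \<longrightarrow> f g = 0) \<and>
                      (\<forall>g\<in>carrier G. f g \<in> rep_space W) \<and>
                      (\<forall>h\<in>H. \<forall>g\<in>carrier G. f (h \<otimes>\<^bsub>G\<^esub> g) = rep_act W h (f g))},
      rep_scale = (\<lambda>c f g. rep_scale W c (f g)),
      rep_act = (\<lambda>x f g. if g \<in> carrier G then f (g \<otimes>\<^bsub>G\<^esub> x) else 0)\<rparr>"

definition direct_sum_rep ::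
  "'d set \<Rightarrow> ('d \<Rightarrow> ('g, 'v::ab_group_add) crep) \<Rightarrow> ('g, 'd \<Rightarrow> 'v) crep"
where
  "direct_sum_rep I R =
     \<lparr>rep_space = {f. (\<forall>d\<in>I. f d \<in> rep_space (R d)) \<and> (\<forall>d. d \<notin> I \<longrightarrow> f d = 0) \<and>
                      finite {d. f d \<noteq> 0}},
      rep_scale = (\<lambda>c f d. rep_scale (R d) c (f d)),
      rep_act = (\<lambda>g f d. if d \<in> I then rep_act (R d) g (f d) else 0)\<rparr>"


section \<open>Representations of symmetric groups\<close>

text \<open>The blocks are \<open>{1..\<lambda>\<^sub>1}\<close>, \<open>{\<lambda>\<^sub>1+1..\<lambda>\<^sub>1+\<lambda>\<^sub>2}\<close>, and so on.\<close>

definition young_subgroup :: "nat list \<Rightarrow> (nat \<Rightarrow> nat) set" where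
  "young_subgroup lam =
     {\<sigma>. \<sigma> permutes {1..sum_list lam} \<and>
         (\<forall>j<length lam. \<sigma> ` {sum_list (take j lam)<..sum_list (take (Suc j) lam)} =
                         {sum_list (take j lam)<..sum_list (take (Suc j) lam)})}"

definition young_module :: "nat \<Rightarrow> nat list \<Rightarrow> (nat \<Rightarrow> nat, (nat \<Rightarrow> nat) \<Rightarrow> complex) crep" where
  "young_module n lam = induced_rep (sym_group n) (young_subgroup lam) (char_rep (\<lambda>_. 1))"

definition long_cycle :: "nat \<Rightarrow> nat \<Rightarrow> nat" where
  "long_cycle n = cycle_of_list [1..<n + 2]"

definition cyclic_subgroup :: "nat \<Rightarrow> (nat \<Rightarrow> nat) set" where
  "cyclic_subgroup n = generate (sym_group (n + 1)) {long_cycle n}"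

definition zeta :: "nat \<Rightarrow> (nat \<Rightarrow> nat) \<Rightarrow> complex" where
  "zeta n g = exp (2 * of_real pi * \<i> / of_nat (n + 1)) ^ (LEAST k. (long_cycle n ^^ k) = g)"

text \<open>\<open>lie_rep n\<close> is a representation of the symmetric group on \<open>n + 1\<close> letters.\<close>

definition lie_rep :: "nat \<Rightarrow> (nat \<Rightarrow> nat, (nat \<Rightarrow> nat) \<Rightarrow> complex) crep" where
  "lie_rep n = induced_rep (sym_group (n + 1)) (cyclic_subgroup n) (char_rep (zeta n))"

definition sign_char :: "(nat \<Rightarrow> nat) \<Rightarrow> complex" where
  "sign_char \<sigma> = of_int (sign \<sigma>)"

definition reflection_rep :: "nat \<Rightarrow> (nat \<Rightarrow> nat, nat \<Rightarrow> complex) crep" where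
  "reflection_rep N =
     \<lparr>rep_space = {v. (\<forall>i. i \<notin> {1..N} \<longrightarrow> v i = 0) \<and> (\<Sum>i\<in>{1..N}. v i) = 0},
      rep_scale = (\<lambda>c v i. c * v i),
      rep_act = (\<lambda>\<sigma> v i. v (inv_into UNIV \<sigma> i))\<rparr>"


section \<open>Polynomials\<close>

text \<open>Exponent vectors are finitely supported; the variable \<open>x\<^sub>i\<close> is \<open>pvar i\<close>.\<close>

type_synonym cpoly = "(nat \<Rightarrow>\<^sub>0 nat) \<Rightarrow>\<^sub>0 complex"

definition pvar :: "nat \<Rightarrow> cpoly" where
  "pvar i = Poly_Mapping.single (Poly_Mapping.single i 1) 1"

definition pscale :: "complex \<Rightarrow> cpoly \<Rightarrow> cpoly" where
  "pscale c p = Poly_Mapping.single 0 c * p"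

interpretation cpoly: vector_space pscale
  by unfold_locales
     (simp_all add: pscale_def algebra_simps single_add mult_single flip: mult.assoc)

definition homogeneous :: "nat \<Rightarrow> cpoly \<Rightarrow> bool" where
  "homogeneous k p \<longleftrightarrow>
     (\<forall>t\<in>Poly_Mapping.keys p. (\<Sum>i\<in>Poly_Mapping.keys t. Poly_Mapping.lookup t i) = k)"

text \<open>The substitution \<open>x\<^sub>i \<mapsto> x\<^bsub>\<sigma> i\<^esub>\<close>.\<close>

definition permute_vars :: "(nat \<Rightarrow> nat) \<Rightarrow> cpoly \<Rightarrow> cpoly" where
  "permute_vars \<sigma> p =
     (\<Sum>t\<in>Poly_Mapping.keys p.
        pscale (Poly_Mapping.lookup p t)
          (\<Prod>i\<in>Poly_Mapping.keys t. pvar (\<sigma> i) ^ Poly_Mapping.lookup t i))"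


section \<open>Slim multigraphs\<close>

text \<open>An edge \<open>{i < j}\<close> is the pair \<open>(i, j)\<close>; a multigraph is its multiset of edges.\<close>

definition complete_multigraph :: "nat \<Rightarrow> nat \<Rightarrow> nat \<Rightarrow> (nat \<times> nat) multiset" where
  "complete_multigraph l m n =
     (\<Sum>i\<in>{1..n}. \<Sum>j\<in>{i<..n}. replicate_mset m (i, j)) +
     (\<Sum>i\<in>{1..n}. replicate_mset l (i, n + 1))"

definition connected_multigraph :: "nat set \<Rightarrow> (nat \<times> nat) multiset \<Rightarrow> bool" where
  "connected_multigraph U E \<longleftrightarrow> (\<forall>u\<in>U. \<forall>v\<in>U. (u, v) \<in> (set_mset E \<union> (set_mset E)\<inverse>)\<^sup>*)"

definition slim :: "nat \<Rightarrow> nat \<Rightarrow> nat \<Rightarrow> (nat \<times> nat) multiset \<Rightarrow> bool" where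
  "slim l m n G \<longleftrightarrow>
     G \<subseteq># complete_multigraph l m n \<and>
     connected_multigraph {1..n + 1} (complete_multigraph l m n - G)"

definition graph_poly :: "(nat \<times> nat) multiset \<Rightarrow> cpoly" where
  "graph_poly G = (\<Prod>(i, j)\<in>#G. pvar i - pvar j)"

definition slim_space :: "nat \<Rightarrow> nat \<Rightarrow> nat \<Rightarrow> cpoly set" where
  "slim_space l m n = cpoly.span {graph_poly G | G. slim l m n G}"

definition slim_component :: "nat \<Rightarrow> nat \<Rightarrow> nat \<Rightarrow> nat \<Rightarrow> cpoly set" where
  "slim_component l m n k = {p \<in> slim_space l m n. homogeneous k p}"

text \<open>
  The action is meaningful for permutations of \<open>{1..n}\<close>, and for those of \<open>{1..n + 1}\<close>
  if \<open>l = m\<close>.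
\<close>

definition slim_rep :: "nat \<Rightarrow> nat \<Rightarrow> nat \<Rightarrow> nat \<Rightarrow> (nat \<Rightarrow> nat, cpoly) crep" where
  "slim_rep l m n k =
     \<lparr>rep_space = slim_component l m n k, rep_scale = pscale, rep_act = permute_vars\<rparr>"


section \<open>Dyck paths\<close>

datatype step = Vert | Horiz

text \<open>The lattice point reached after the first \<open>i\<close> steps of a path starting at \<open>(-l+1, 0)\<close>.\<close>

definition path_point :: "nat \<Rightarrow> step list \<Rightarrow> nat \<Rightarrow> int \<times> int" where
  "path_point l D i =
     (- int l + 1 + int (count_list (take i D) Horiz), int (count_list (take i D) Vert))"

definition dyck_path :: "nat \<Rightarrow> nat \<Rightarrow> nat \<Rightarrow> step list \<Rightarrow> bool" where
  "dyck_path l m n D \<longleftrightarrow>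
     path_point l D (length D) = (int (m * n), int n) \<and>
     (\<forall>i\<le>length D. real_of_int (snd (path_point l D i)) \<ge>
                   real_of_int (fst (path_point l D i)) / real m)"

function vertical_runs :: "step list \<Rightarrow> nat list" where
  "vertical_runs [] = []"
| "vertical_runs (Horiz # D) = vertical_runs D"
| "vertical_runs (Vert # D) =
     Suc (length (takeWhile (\<lambda>s. s = Vert) D)) # vertical_runs (dropWhile (\<lambda>s. s = Vert) D)"
  by pat_completeness auto
termination
  by (relation "measure length") (auto simp: less_Suc_eq_le length_dropWhile_le)

definition vertical_run_partition :: "step list \<Rightarrow> nat list" where
  "vertical_run_partition D = rev (sort (vertical_runs D))"

text \<open>The rows are listed from top to bottom, hence in the reverse order of the path.\<close>

definition area_partition :: "nat \<Rightarrow> step list \<Rightarrow> nat list" where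
  "area_partition l D =
     rev (map (\<lambda>i. nat (int l - 1 + fst (path_point l D i)))
           (filter (\<lambda>i. D ! i = Vert) [0..<length D]))"

definition area :: "nat \<Rightarrow> step list \<Rightarrow> nat" where
  "area l D = sum_list (area_partition l D)"

end

theory Submission
  imports
    Defs
    "HOL-Algebra.Multiplicative_Group"
    "HOL-Combinatorics.Multiset_Permutations"
    "Subresultants.More_Homomorphisms"
begin

text \<open>
  Setting the last variable to zero identifies the slim space with a space attached to a
  multigraph \<open>E\<close> rooted at the last vertex. Restricted to this space, the map that reads off the
  coefficients at the monomials \<open>x\<^sup>f\<close>, \<open>f\<close> a parking function of \<open>E\<close>, is bijective. Both halves
  are proved by deleting and contracting an edge \<open>e\<close> between the root and a vertex \<open>i\<close>: the
  parking functions with \<open>f i = 0\<close> are those of the contraction and the others are those of the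
  deletion shifted by one, while a polynomial either survives setting \<open>x\<^sub>i = 0\<close> or is \<open>x\<^sub>i\<close>
  times one of the deletion. For injectivity the space is enlarged to all polynomials \<open>p\<close> such
  that \<open>p (x + t 1\<^sub>I)\<close> has degree in \<open>t\<close> below the size of the cut of every vertex set \<open>I\<close>; a
  posteriori the two spaces agree, so that every polynomial in the differences of degree below
  all cut sizes is in the slim space.

  For the complete multigraph the parking functions are the rearrangements of the row vectors of
  the Dyck paths, and the symmetric group permutes them, which gives the sum of permutation
  modules.

  In the top degree and for \<open>l = m\<close>, division by the \<open>l\<close>-th power of the Vandermonde product
  turns the generators into \<open>\<Prod> 1 / (x\<^sub>i - x\<^sub>j)\<close> over the edges of spanning trees. These are
  combinations of the products \<open>P\<^sub>w\<close> over paths \<open>w\<close>, and the \<open>P\<^sub>w\<close> sum to zero over the shuffles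
  of two nonempty words. Hence \<open>\<Sum>\<^sub>w q^maj(w\<^sup>-\<^sup>1) P\<^sub>w\<close> is \<open>\<Prod>\<^sub>i (1 - q^i)\<close> times \<open>P\<^sub>1\<^sub>2\<^sub>\<dots>\<close>. For
  the inverse \<open>q\<close> of a primitive root of unity this shows that the equivariant map from the
  induced representation is onto, and both sides have dimension \<open>n!\<close>.
\<close>

abbreviation "lookup \<equiv> Poly_Mapping.lookup"
abbreviation "keys \<equiv> Poly_Mapping.keys"
abbreviation "single \<equiv> Poly_Mapping.single"
abbreviation "map_key \<equiv> Poly_Mapping.map_key"

hide_const (open) Poly_Mapping.degree

declare One_nat_def [simp del]


section \<open>Substitution homomorphisms\<close>

lemma poly_mapping_add_induct [case_names add single]:
  fixes p :: "'k \<Rightarrow>\<^sub>0 'b::monoid_add"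
  assumes "\<And>p q. P p \<Longrightarrow> P q \<Longrightarrow> P (p + q)" "\<And>t c. P (single t c)"
  shows "P p"
proof (induction p rule: Poly_Mapping.update_induct)
  case const
  then show ?case using assms(2)[of undefined 0] by simp
next
  case (update f a b)
  have "Poly_Mapping.update a b f = f + single a b"
    using update by (intro poly_mapping_eqI)
      (auto simp: lookup_update lookup_add lookup_single in_keys_iff when_def)
  then show ?case using update assms by metis
qed

lemma sum_single_lookup: "(\<Sum>t\<in>keys p. single t (lookup p t)) = p"
  by (rule poly_mapping_eqI) (auto simp: lookup_sum lookup_single when_def in_keys_iff)

definition monom_eval :: "('v \<Rightarrow> 'a::comm_semiring_1) \<Rightarrow> ('v \<Rightarrow>\<^sub>0 nat) \<Rightarrow> 'a" where
  "monom_eval \<theta> t = (\<Prod>i\<in>keys t. \<theta> i ^ lookup t i)"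

lemma monom_eval_superset:
  assumes "finite A" "keys t \<subseteq> A"
  shows "monom_eval \<theta> t = (\<Prod>i\<in>A. \<theta> i ^ lookup t i)"
  unfolding monom_eval_def using assms
  by (intro prod.mono_neutral_left) (auto simp: in_keys_iff)

lemma monom_eval_add: "monom_eval \<theta> (s + t) = monom_eval \<theta> s * monom_eval \<theta> t"
  using Poly_Mapping.keys_add[of s t]
  by (simp add: monom_eval_superset[where A = "keys s \<union> keys t"] lookup_add power_add prod.distrib)

lemma monom_eval_0 [simp]: "monom_eval \<theta> 0 = 1"
  by (simp add: monom_eval_def)

lemma monom_eval_single [simp]: "monom_eval \<theta> (single i k) = \<theta> i ^ k"
  by (cases "k = 0") (auto simp: monom_eval_def)

lemma monom_eval_cong:
  "(\<And>i. i \<in> keys t \<Longrightarrow> \<theta> i = \<theta>' i) \<Longrightarrow> monom_eval \<theta> t = monom_eval \<theta>' t"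
  by (simp add: monom_eval_def)

lemma monom_eval_pvar: "monom_eval pvar t = single t 1"
proof -
  have pow: "pvar i ^ k = single (single i k) 1" for i k
    by (induction k) (auto simp: pvar_def mult_single plus_1_eq_Suc simp flip: single_add)
  have "(\<Prod>i\<in>A. single (f i) (1::complex)) = single (\<Sum>i\<in>A. f i) 1"
    if "finite A" for A :: "nat set" and f :: "nat \<Rightarrow> nat \<Rightarrow>\<^sub>0 nat"
    using that by (induction A) (auto simp: mult_single)
  then show ?thesis
    unfolding monom_eval_def pow by (simp add: sum_single_lookup)
qed

definition psubst ::
  "('c::zero \<Rightarrow> 'a::comm_semiring_1) \<Rightarrow> ('v \<Rightarrow> 'a) \<Rightarrow> (('v \<Rightarrow>\<^sub>0 nat) \<Rightarrow>\<^sub>0 'c) \<Rightarrow> 'a"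
where
  "psubst h \<theta> p = (\<Sum>t\<in>keys p. h (lookup p t) * monom_eval \<theta> t)"

context comm_ring_hom
begin

lemma hom_monom_eval: "hom (monom_eval \<theta> t) = monom_eval (\<lambda>i. hom (\<theta> i)) t"
  by (simp add: monom_eval_def hom_distribs)

lemma hom_psubst: "hom (psubst h \<theta> p) = psubst (\<lambda>c. hom (h c)) (\<lambda>i. hom (\<theta> i)) p"
  by (simp add: psubst_def hom_distribs hom_monom_eval)

lemma psubst_superset:
  assumes "finite A" "keys p \<subseteq> A"
  shows "psubst hom \<theta> p = (\<Sum>t\<in>A. hom (lookup p t) * monom_eval \<theta> t)"
  unfolding psubst_def using assms
  by (intro sum.mono_neutral_left) (auto simp: in_keys_iff)

lemma psubst_add: "psubst hom \<theta> (p + q) = psubst hom \<theta> p + psubst hom \<theta> q"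
  using Poly_Mapping.keys_add[of p q]
  by (simp add: psubst_superset[where A = "keys p \<union> keys q"] lookup_add hom_add
      distrib_right sum.distrib)

lemma psubst_single: "psubst hom \<theta> (single t c) = hom c * monom_eval \<theta> t"
  by (cases "c = 0") (auto simp: psubst_def)

lemma psubst_mult: "psubst hom \<theta> (p * q) = psubst hom \<theta> p * psubst hom \<theta> q"
proof (induction p rule: poly_mapping_add_induct)
  case (single t c)
  show ?case
    by (induction q rule: poly_mapping_add_induct)
      (simp_all add: algebra_simps psubst_add mult_single psubst_single hom_mult monom_eval_add)
qed (simp_all add: algebra_simps psubst_add)

lemma comm_ring_hom_psubst: "comm_ring_hom (psubst hom \<theta>)"
  using psubst_single[of \<theta> 0 1]
  by unfold_locales (auto simp: psubst_add psubst_mult psubst_def[of _ _ 0])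

end

abbreviation pconst :: "'c::zero \<Rightarrow> ('v \<Rightarrow>\<^sub>0 nat) \<Rightarrow>\<^sub>0 'c" where
  "pconst \<equiv> single 0"

interpretation pconst: comm_ring_hom pconst
  by unfold_locales (auto simp: single_add mult_single)

context comm_ring_hom
begin

lemma psubst_pconst: "psubst hom \<theta> (pconst c) = hom c"
  by (simp add: psubst_single)

lemma psubst_psubst:
  "psubst hom \<theta> (psubst pconst \<theta>' p) = psubst hom (\<lambda>i. psubst hom \<theta> (\<theta>' i)) p"
  by (simp add: comm_ring_hom.hom_psubst[OF comm_ring_hom_psubst] psubst_pconst)

end

lemma psubst_pvar: "comm_ring_hom h \<Longrightarrow> psubst h \<theta> (pvar i) = \<theta> i"
  by (simp add: pvar_def comm_ring_hom.psubst_single one_hom.hom_one comm_ring_hom_def ring_hom_def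
      semiring_hom_def monoid_mult_hom_def)

abbreviation csubst :: "(nat \<Rightarrow> cpoly) \<Rightarrow> cpoly \<Rightarrow> cpoly" where
  "csubst \<equiv> psubst pconst"

interpretation csubst: comm_ring_hom "csubst \<theta>" for \<theta>
  by (rule pconst.comm_ring_hom_psubst)

lemma csubst_pvar: "csubst \<theta> (pvar i) = \<theta> i"
  by (rule psubst_pvar) unfold_locales

lemma csubst_id: "csubst pvar p = p"
  by (induction p rule: poly_mapping_add_induct)
    (simp_all add: csubst.hom_add pconst.psubst_single monom_eval_pvar mult_single)

lemma pscale_mult_right: "pscale c (p * q) = p * pscale c q"
  by (simp add: pscale_def mult.left_commute)

interpretation pmult: module_hom pscale pscale "(*) p" for p
  by unfold_locales (simp_all add: distrib_left pscale_mult_right)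

lemma module_hom_csubst: "module_hom pscale pscale (csubst \<theta>)"
  by unfold_locales (simp_all add: csubst.hom_add pscale_def csubst.hom_mult pconst.psubst_pconst)

lemma (in module_hom) image_span_subset:
  assumes "f ` S \<subseteq> m2.span T"
  shows "f ` m1.span S \<subseteq> m2.span T"
  using m2.span_minimal[OF assms m2.subspace_span] by (simp add: span_image)

lemma lookup_pscale: "lookup (pscale c p) t = c * lookup p t"
  by (simp add: pscale_def map.rep_eq when_def flip: mult_map_scale_conv_mult)


subsection \<open>Permuting and killing variables\<close>

lemma permute_vars_csubst: "permute_vars \<sigma> = csubst (\<lambda>i. pvar (\<sigma> i))"
  by (simp add: fun_eq_iff permute_vars_def psubst_def pscale_def monom_eval_def)

interpretation permute_vars: comm_ring_hom "permute_vars \<sigma>" for \<sigma>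
  unfolding permute_vars_csubst by unfold_locales

interpretation permute_vars: module_hom pscale pscale "permute_vars \<sigma>" for \<sigma>
  unfolding permute_vars_csubst by (rule module_hom_csubst)

lemma permute_vars_pvar: "permute_vars \<sigma> (pvar i) = pvar (\<sigma> i)"
  by (simp add: permute_vars_csubst csubst_pvar)

lemma permute_vars_id: "permute_vars id p = p"
  by (simp add: permute_vars_csubst csubst_id)

lemma permute_vars_compose: "permute_vars (\<sigma> \<circ> \<tau>) p = permute_vars \<sigma> (permute_vars \<tau> p)"
  by (simp add: permute_vars_csubst pconst.psubst_psubst csubst_pvar)

lemma monom_eval_permuted_pvar:
  assumes "bij \<sigma>"
  shows "monom_eval (\<lambda>i. pvar (\<sigma> i)) t = single (map_key (inv' \<sigma>) t) 1"
proof -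
  have inj: "inj \<sigma>" "inj (inv' \<sigma>)" using assms by (auto simp: bij_is_inj bij_imp_bij_inv)
  have "keys (map_key (inv' \<sigma>) t) = \<sigma> ` keys t"
    using assms inj by (simp add: keys_map_key bij_vimage_eq_inv_image bij_imp_bij_inv inv_inv_eq)
  then have "monom_eval (\<lambda>i. pvar (\<sigma> i)) t = monom_eval pvar (map_key (inv' \<sigma>) t)"
    using inj by (simp add: monom_eval_def prod.reindex inj_on_subset[OF inj(1)] map_key.rep_eq)
  then show ?thesis by (simp add: monom_eval_pvar)
qed

lemma lookup_permute_vars:
  assumes "bij \<sigma>"
  shows "lookup (permute_vars \<sigma> p) t = lookup p (map_key \<sigma> t)"
proof (induction p rule: poly_mapping_add_induct)
  case (add p q)
  then show ?case by (simp add: permute_vars.hom_add lookup_add)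
next
  case (single s c)
  have "inj \<sigma>" "inj (inv' \<sigma>)" using assms by (auto simp: bij_is_inj bij_imp_bij_inv)
  then have "map_key (inv' \<sigma>) s = t \<longleftrightarrow> s = map_key \<sigma> t"
    using assms
    by (auto simp: poly_mapping_eq_iff map_key.rep_eq fun_eq_iff bij_is_surj surj_f_inv_f)
      (metis bij_inv_eq_iff)+
  then show ?case
    by (auto simp: permute_vars_csubst pconst.psubst_single monom_eval_permuted_pvar[OF assms]
        mult_single lookup_single when_def)
qed

definition kill_vars :: "nat set \<Rightarrow> cpoly \<Rightarrow> cpoly" where
  "kill_vars R = csubst (\<lambda>i. if i \<in> R then 0 else pvar i)"

interpretation kill_vars: comm_ring_hom "kill_vars R" for R
  unfolding kill_vars_def by unfold_locales

interpretation kill_vars: module_hom pscale pscale "kill_vars R" for R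
  unfolding kill_vars_def by (rule module_hom_csubst)

lemma kill_vars_pvar: "kill_vars R (pvar i) = (if i \<in> R then 0 else pvar i)"
  by (simp add: kill_vars_def csubst_pvar)

lemma kill_vars_kill_vars: "kill_vars R (kill_vars S p) = kill_vars (R \<union> S) p"
  unfolding kill_vars_def pconst.psubst_psubst
  by (rule arg_cong2[of _ _ _ _ csubst]) (auto simp: fun_eq_iff csubst_pvar)

lemma lookup_kill_vars:
  "lookup (kill_vars R p) t = (if keys t \<inter> R = {} then lookup p t else 0)"
proof (induction p rule: poly_mapping_add_induct)
  case (add p q)
  then show ?case by (simp add: kill_vars.hom_add lookup_add)
next
  case (single s c)
  have "monom_eval (\<lambda>i. if i \<in> R then 0 else pvar i) s =
    (if keys s \<inter> R = {} then monom_eval pvar s else 0)"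
  proof (cases "keys s \<inter> R = {}")
    case True
    then show ?thesis by (auto intro!: monom_eval_cong)
  next
    case False
    then obtain i where "i \<in> keys s" "i \<in> R" by auto
    then show ?thesis using False
      by (auto simp: monom_eval_def in_keys_iff intro!: bexI[of _ i])
  qed
  then show ?case
    by (auto simp: kill_vars_def pconst.psubst_single monom_eval_pvar mult_single lookup_single
        when_def)
qed

lemma in_keys_kill_vars: "t \<in> keys (kill_vars R p) \<longleftrightarrow> t \<in> keys p \<and> keys t \<inter> R = {}"
  unfolding in_keys_iff[of t] lookup_kill_vars by simp

lemma single_1_eq_iff: "single i (1 :: 'a::zero_neq_one) = single j 1 \<longleftrightarrow> i = j"
  by (metis lookup_single_eq lookup_single_not_eq zero_neq_one)

lemma pvar_eq_iff: "pvar i = pvar j \<longleftrightarrow> i = j"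
  by (simp add: pvar_def single_1_eq_iff)

lemma pvar_neq_0: "pvar i \<noteq> 0"
  by (metis keys_single keys_zero pvar_def insert_not_empty zero_neq_one)

lemma lookup_pvar_mult: "lookup (pvar i * p) (t + single i 1) = lookup p t"
  by (induction p rule: poly_mapping_add_induct)
    (simp_all add: algebra_simps lookup_add pvar_def mult_single lookup_single when_def)

lemma lookup_pvar_mult_0:
  assumes "lookup t i = 0"
  shows "lookup (pvar i * p) t = 0"
proof (induction p rule: poly_mapping_add_induct)
  case (single s c)
  have "single i 1 + s \<noteq> t" using assms by (auto simp: lookup_add)
  then show ?case by (simp add: pvar_def mult_single lookup_single when_def)
qed (simp add: algebra_simps lookup_add)

lemma diff_single_add_single:
  "lookup t i \<noteq> 0 \<Longrightarrow> t - single i 1 + single i 1 = (t :: 'v \<Rightarrow>\<^sub>0 nat)"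
  by (rule poly_mapping_eqI) (auto simp: lookup_add lookup_minus lookup_single when_def)

lemma pvar_dvd_if_kill_vars_eq_0:
  assumes "kill_vars {i} p = 0"
  shows "pvar i dvd p"
proof
  have "lookup t i \<noteq> 0" if "t \<in> keys p" for t
    using that in_keys_kill_vars[of t "{i}" p] assms by (auto simp: in_keys_iff)
  then have "pvar i * single (t - single i 1) (lookup p t) = single t (lookup p t)"
    if "t \<in> keys p" for t
    using that diff_single_add_single[of t i] by (simp add: pvar_def mult_single add.commute)
  then have "pvar i * (\<Sum>t\<in>keys p. single (t - single i 1) (lookup p t)) =
      (\<Sum>t\<in>keys p. single t (lookup p t))"
    unfolding sum_distrib_left by (rule sum.cong[OF refl])
  then show "p = pvar i * (\<Sum>t\<in>keys p. single (t - single i 1) (lookup p t))"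
    by (simp add: sum_single_lookup)
qed


section \<open>Forms\<close>

definition vars_in :: "nat set \<Rightarrow> cpoly \<Rightarrow> bool" where
  "vars_in A p \<longleftrightarrow> (\<forall>t\<in>keys p. keys t \<subseteq> A)"

lemma vars_in_0: "vars_in A 0"
  and vars_in_1: "vars_in A 1"
  by (simp_all add: vars_in_def)

lemma vars_in_pvar: "i \<in> A \<Longrightarrow> vars_in A (pvar i)"
  by (simp add: vars_in_def pvar_def)

lemma vars_in_add: "vars_in A p \<Longrightarrow> vars_in A q \<Longrightarrow> vars_in A (p + q)"
  using Poly_Mapping.keys_add[of p q] by (auto simp: vars_in_def)

lemma vars_in_pscale: "vars_in A p \<Longrightarrow> vars_in A (pscale c p)"
  by (force simp: vars_in_def in_keys_iff lookup_pscale)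

lemma vars_in_mult: "vars_in A p \<Longrightarrow> vars_in A q \<Longrightarrow> vars_in A (p * q)"
  unfolding vars_in_def
proof
  fix t assume vars: "\<forall>t\<in>keys p. keys t \<subseteq> A" "\<forall>t\<in>keys q. keys t \<subseteq> A"
    and "t \<in> keys (p * q)"
  then obtain a b where "t = a + b" "a \<in> keys p" "b \<in> keys q"
    using Poly_Mapping.keys_mult[of p q] by blast
  then show "keys t \<subseteq> A"
    using vars Poly_Mapping.keys_add[of a b] by blast
qed

lemma vars_in_kill_vars: "vars_in A p \<Longrightarrow> vars_in (A - R) (kill_vars R p)"
  unfolding vars_in_def by (auto simp only: in_keys_kill_vars)

lemma vars_in_kill_vars_Compl: "vars_in A (kill_vars (- A) p)"
  unfolding vars_in_def by (auto simp only: in_keys_kill_vars)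

lemma vars_in_pvar_multD:
  assumes "vars_in A (pvar i * q)"
  shows "vars_in A q"
  unfolding vars_in_def
proof
  fix t assume "t \<in> keys q"
  then have "t + single i 1 \<in> keys (pvar i * q)"
    using lookup_pvar_mult[of i q t] by (simp add: in_keys_iff)
  then have "keys (t + single i 1) \<subseteq> A" using assms unfolding vars_in_def by blast
  then show "keys t \<subseteq> A" by (auto simp: in_keys_iff lookup_add)
qed

lemma psubst_cong:
  "vars_in A p \<Longrightarrow> (\<And>i. i \<in> A \<Longrightarrow> \<theta> i = \<theta>' i) \<Longrightarrow> psubst h \<theta> p = psubst h \<theta>' p"
  unfolding psubst_def vars_in_def
  by (intro sum.cong refl arg_cong2[of _ _ _ _ "(*)"] monom_eval_cong) auto

definition monom_degree :: "('v \<Rightarrow>\<^sub>0 nat) \<Rightarrow> nat" where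
  "monom_degree t = (\<Sum>i\<in>keys t. lookup t i)"

lemma monom_degree_superset:
  "finite A \<Longrightarrow> keys t \<subseteq> A \<Longrightarrow> monom_degree t = (\<Sum>i\<in>A. lookup t i)"
  unfolding monom_degree_def by (intro sum.mono_neutral_left) (auto simp: in_keys_iff)

lemma monom_degree_add: "monom_degree (s + t) = monom_degree s + monom_degree t"
  using Poly_Mapping.keys_add[of s t]
  by (simp add: monom_degree_superset[where A = "keys s \<union> keys t"] lookup_add sum.distrib)

lemma monom_degree_eq_1_iff: "monom_degree t = 1 \<longleftrightarrow> (\<exists>i. t = single i 1)"
proof
  assume "monom_degree t = 1"
  then obtain i where "lookup t i = 1" "\<And>j. j \<noteq> i \<Longrightarrow> lookup t j = 0"
    using sum_eq_1_iff[OF finite_keys[of t], of "lookup t"]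
    unfolding monom_degree_def by (metis in_keys_iff)
  then have "t = single i 1" by (intro poly_mapping_eqI) (auto simp: lookup_single when_def)
  then show "\<exists>i. t = single i 1" ..
qed (auto simp: monom_degree_def)

lemma homogeneous_iff: "homogeneous k p \<longleftrightarrow> (\<forall>t. lookup p t \<noteq> 0 \<longrightarrow> monom_degree t = k)"
  unfolding homogeneous_def monom_degree_def[symmetric] by (auto simp: in_keys_iff)

lemma homogeneous_0 [simp]: "homogeneous k 0"
  by (simp add: homogeneous_iff)

lemma homogeneous_1: "homogeneous 0 1"
  by (auto simp: homogeneous_def)

lemma homogeneous_pvar: "homogeneous 1 (pvar i)"
  by (simp add: homogeneous_def pvar_def)

lemma homogeneous_add: "homogeneous k p \<Longrightarrow> homogeneous k q \<Longrightarrow> homogeneous k (p + q)"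
  unfolding homogeneous_iff lookup_add by (metis add.right_neutral)

lemma homogeneous_diff: "homogeneous k p \<Longrightarrow> homogeneous k q \<Longrightarrow> homogeneous k (p - q)"
  unfolding homogeneous_iff lookup_minus by (metis diff_zero)

lemma homogeneous_pscale: "homogeneous k p \<Longrightarrow> homogeneous k (pscale c p)"
  by (auto simp: homogeneous_iff lookup_pscale)

lemma homogeneous_sum: "(\<And>a. a \<in> A \<Longrightarrow> homogeneous k (f a)) \<Longrightarrow> homogeneous k (sum f A)"
  by (induction A rule: infinite_finite_induct) (auto intro: homogeneous_add)

lemma homogeneous_mult: "homogeneous j p \<Longrightarrow> homogeneous k q \<Longrightarrow> homogeneous (j + k) (p * q)"
  unfolding homogeneous_def monom_degree_def[symmetric]
  using Poly_Mapping.keys_mult[of p q] by (fastforce simp: monom_degree_add)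

lemma homogeneous_power: "homogeneous j p \<Longrightarrow> homogeneous (j * k) (p ^ k)"
  by (induction k) (auto simp: homogeneous_1 intro: homogeneous_mult)

lemma homogeneous_prod:
  "(\<And>a. a \<in> A \<Longrightarrow> homogeneous (d a) (f a)) \<Longrightarrow> homogeneous (sum d A) (prod f A)"
  by (induction A rule: infinite_finite_induct) (auto intro: homogeneous_mult homogeneous_1)

lemma homogeneous_monom_eval:
  "(\<And>i. homogeneous 1 (\<theta> i)) \<Longrightarrow> homogeneous (monom_degree t) (monom_eval \<theta> t)"
  unfolding monom_eval_def monom_degree_def
  by (intro homogeneous_prod) (use homogeneous_power[of 1] in auto)

lemma homogeneous_csubst:
  assumes "\<And>i. homogeneous 1 (\<theta> i)" "homogeneous k p"
  shows "homogeneous k (csubst \<theta> p)"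
  unfolding psubst_def pscale_def[symmetric]
proof (intro homogeneous_sum homogeneous_pscale)
  fix t assume "t \<in> keys p"
  then have "monom_degree t = k" using assms(2) by (simp add: homogeneous_def monom_degree_def)
  then show "homogeneous k (monom_eval \<theta> t)" using homogeneous_monom_eval assms(1) by metis
qed

lemma homogeneous_permute_vars: "homogeneous k p \<Longrightarrow> homogeneous k (permute_vars \<sigma> p)"
  unfolding permute_vars_csubst by (intro homogeneous_csubst homogeneous_pvar)

lemma homogeneous_kill_vars: "homogeneous k p \<Longrightarrow> homogeneous k (kill_vars R p)"
  unfolding kill_vars_def using homogeneous_pvar by (intro homogeneous_csubst) auto

definition hom_part :: "nat \<Rightarrow> cpoly \<Rightarrow> cpoly" where
  "hom_part k p = (\<Sum>t\<in>{t \<in> keys p. monom_degree t = k}. single t (lookup p t))"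

lemma lookup_hom_part: "lookup (hom_part k p) t = (if monom_degree t = k then lookup p t else 0)"
  by (auto simp: hom_part_def lookup_sum lookup_single when_def in_keys_iff)

interpretation hom_part: module_hom pscale pscale "hom_part k" for k
  by unfold_locales
    (auto intro!: poly_mapping_eqI simp: lookup_hom_part lookup_add lookup_pscale)

lemma hom_part_homogeneous: "homogeneous j p \<Longrightarrow> hom_part k p = (if j = k then p else 0)"
  by (rule poly_mapping_eqI) (auto simp: lookup_hom_part homogeneous_iff)

definition forms :: "nat set \<Rightarrow> nat \<Rightarrow> cpoly set" where
  "forms A k = {p. vars_in A p \<and> homogeneous k p}"

lemma subspace_forms: "cpoly.subspace (forms A k)"
  by (rule cpoly.subspaceI)
    (auto simp: forms_def intro: vars_in_0 vars_in_add vars_in_pscale homogeneous_add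
      homogeneous_pscale)

lemma pvar_in_forms: "i \<in> A \<Longrightarrow> pvar i \<in> forms A 1"
  by (simp add: forms_def vars_in_pvar homogeneous_pvar)

lemma prod_list_in_forms: "set fs \<subseteq> forms A 1 \<Longrightarrow> prod_list fs \<in> forms A (length fs)"
proof (induction fs)
  case (Cons f fs)
  then show ?case
    using homogeneous_mult[of 1 f "length fs" "prod_list fs"]
    by (auto simp: forms_def plus_1_eq_Suc intro: vars_in_mult)
qed (simp add: forms_def vars_in_1 homogeneous_1)

lemma prod_power_eq_prod_list:
  fixes f :: "'v \<Rightarrow> 'a::comm_monoid_mult"
  assumes "finite A"
  obtains fs where "(\<Prod>i\<in>A. f i ^ e i) = prod_list fs" "length fs = sum e A" "set fs \<subseteq> f ` A"
proof -
  have "\<exists>fs. (\<Prod>i\<in>A. f i ^ e i) = prod_list fs \<and> length fs = sum e A \<and> set fs \<subseteq> f ` A"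
    using assms
  proof (induction A)
    case empty
    then show ?case by (intro exI[of _ "[]"]) auto
  next
    case (insert i A)
    then obtain fs where "(\<Prod>i\<in>A. f i ^ e i) = prod_list fs" "length fs = sum e A" "set fs \<subseteq> f ` A"
      by auto
    then show ?case using insert
      by (intro exI[of _ "replicate (e i) (f i) @ fs"])
        (auto simp: prod_list_replicate set_replicate_conv_if)
  qed
  then show ?thesis using that by blast
qed

lemma forms_eq_span_products:
  "forms A k = cpoly.span {prod_list fs | fs. length fs = k \<and> set fs \<subseteq> forms A 1}"
  (is "_ = cpoly.span ?G")
proof (rule subset_antisym)
  show "cpoly.span ?G \<subseteq> forms A k"
    by (rule cpoly.span_minimal[OF _ subspace_forms]) (use prod_list_in_forms in blast)
  show "forms A k \<subseteq> cpoly.span ?G"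
  proof
    fix p assume p: "p \<in> forms A k"
    have "single t 1 \<in> ?G" if t: "t \<in> keys p" for t
    proof -
      have "keys t \<subseteq> A" and deg: "monom_degree t = k"
        using p t by (auto simp: forms_def vars_in_def homogeneous_def monom_degree_def)
      then have "pvar ` keys t \<subseteq> forms A 1" using pvar_in_forms by blast
      moreover obtain fs :: "cpoly list" where
        "monom_eval pvar t = prod_list fs" "length fs = monom_degree t" "set fs \<subseteq> pvar ` keys t"
        unfolding monom_eval_def monom_degree_def by (rule prod_power_eq_prod_list[OF finite_keys])
      ultimately have "single t 1 = prod_list fs \<and> length fs = k \<and> set fs \<subseteq> forms A 1"
        using deg by (simp add: monom_eval_pvar subset_trans)
      then show ?thesis by blast
    qed
    then have "(\<Sum>t\<in>keys p. pscale (lookup p t) (single t 1)) \<in> cpoly.span ?G"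
      by (intro cpoly.span_sum cpoly.span_scale cpoly.span_base) blast
    then show "p \<in> cpoly.span ?G" by (simp add: pscale_def mult_single sum_single_lookup)
  qed
qed

definition linear_form :: "nat set \<Rightarrow> (nat \<Rightarrow> complex) \<Rightarrow> cpoly" where
  "linear_form A v = (\<Sum>i\<in>A. pscale (v i) (pvar i))"

lemma linear_form_in_forms: "linear_form A v \<in> forms A 1"
  unfolding linear_form_def
  by (intro cpoly.subspace_sum cpoly.subspace_scale subspace_forms pvar_in_forms)

lemma lookup_linear_form:
  assumes "finite A"
  shows "lookup (linear_form A v) (single i 1) = (if i \<in> A then v i else 0)"
  using assms
  by (simp add: linear_form_def lookup_sum lookup_pscale pvar_def lookup_single when_def
      single_1_eq_iff if_distrib[of "(*) _"] cong: if_cong)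

lemma forms_1_eq_linear_form:
  assumes "finite A" "p \<in> forms A 1"
  shows "p = linear_form A (\<lambda>i. lookup p (single i 1))"
proof (rule poly_mapping_eqI)
  fix t
  let ?L = "linear_form A (\<lambda>i. lookup p (single i 1))"
  show "lookup p t = lookup ?L t"
  proof (cases "\<exists>i\<in>A. t = single i 1")
    case True
    then show ?thesis using lookup_linear_form[OF assms(1)] by auto
  next
    case False
    have "lookup q t = 0" if "q \<in> forms A 1" for q
    proof (rule ccontr)
      assume "lookup q t \<noteq> 0"
      then have "keys t \<subseteq> A" "monom_degree t = 1"
        using that by (auto simp: forms_def vars_in_def homogeneous_iff in_keys_iff[of t])
      then show False using False by (auto simp: monom_degree_eq_1_iff)
    qed
    then show ?thesis using assms(2) linear_form_in_forms by simp
  qed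
qed


section \<open>Reachability in multigraphs\<close>

definition reachable :: "('v \<times> 'v) multiset \<Rightarrow> ('v \<times> 'v) set" where
  "reachable E = (set_mset E \<union> (set_mset E)\<inverse>)\<^sup>*"

definition crosses :: "'v set \<Rightarrow> 'v \<times> 'v \<Rightarrow> bool" where
  "crosses I e \<longleftrightarrow> (fst e \<in> I) \<noteq> (snd e \<in> I)"

lemma reachable_refl [simp]: "(u, u) \<in> reachable E"
  by (simp add: reachable_def)

lemma reachable_edge: "(u, v) \<in># E \<or> (v, u) \<in># E \<Longrightarrow> (u, v) \<in> reachable E"
  by (auto simp: reachable_def)

lemma reachable_sym: "(u, v) \<in> reachable E \<Longrightarrow> (v, u) \<in> reachable E"
  using sym_rtrancl[of "set_mset E \<union> (set_mset E)\<inverse>"] by (auto simp: reachable_def sym_def)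

lemma reachable_trans: "(u, v) \<in> reachable E \<Longrightarrow> (v, w) \<in> reachable E \<Longrightarrow> (u, w) \<in> reachable E"
  by (auto simp: reachable_def)

lemma reachable_map:
  assumes "\<And>u v. (u, v) \<in># E \<Longrightarrow> (f u, f v) \<in> reachable F" and "(u, v) \<in> reachable E"
  shows "(f u, f v) \<in> reachable F"
  using assms(2) unfolding reachable_def[of E]
proof induction
  case (step y z)
  then have "(y, z) \<in># E \<or> (z, y) \<in># E" by auto
  then have "(f y, f z) \<in> reachable F" using assms(1) reachable_sym by metis
  with step.IH show ?case by (rule reachable_trans)
qed simp

lemma reachable_mono: "E \<subseteq># F \<Longrightarrow> (u, v) \<in> reachable E \<Longrightarrow> (u, v) \<in> reachable F"
  using reachable_map[of E "\<lambda>v. v" F u v] by (meson reachable_edge mset_subset_eqD)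

lemma reachable_crossing_edge:
  assumes "(u, v) \<in> reachable E" "u \<in> S" "v \<notin> S"
  obtains e where "e \<in># E" "crosses S e"
proof -
  have "\<exists>e. e \<in># E \<and> crosses S e"
  proof (rule ccontr)
    assume no_edge: "\<not> ?thesis"
    from assms(1) have "v \<in> S"
      unfolding reachable_def by induction (use assms(2) no_edge in \<open>force simp: crosses_def\<close>)+
    then show False using assms(3) by blast
  qed
  then show ?thesis using that by blast
qed

lemma connected_multigraph_iff_reachable:
  "connected_multigraph U E \<longleftrightarrow> (\<forall>u\<in>U. \<forall>v\<in>U. (u, v) \<in> reachable E)"
  by (simp add: connected_multigraph_def reachable_def)

lemma connected_multigraph_if_all_reach:
  "(\<And>u. u \<in> U \<Longrightarrow> (u, r) \<in> reachable E) \<Longrightarrow> connected_multigraph U E"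
  unfolding connected_multigraph_iff_reachable using reachable_trans reachable_sym by meson

lemma graph_poly_empty [simp]: "graph_poly {#} = 1"
  and graph_poly_add_mset:
    "graph_poly (add_mset e H) = (pvar (fst e) - pvar (snd e)) * graph_poly H"
  and graph_poly_union: "graph_poly (G + H) = graph_poly G * graph_poly H"
  by (simp_all add: graph_poly_def case_prod_unfold)

lemma homogeneous_graph_poly: "homogeneous (size G) (graph_poly G)"
proof (induction G)
  case (add e G)
  then show ?case
    using homogeneous_mult[OF homogeneous_diff[OF homogeneous_pvar homogeneous_pvar] add]
    by (simp add: graph_poly_add_mset plus_1_eq_Suc)
qed (simp add: homogeneous_1)


section \<open>Parking functions of a rooted multigraph\<close>

text \<open>
  A multigraph is rooted by a set \<open>A\<close> of vertices: all the vertices outside \<open>A\<close> are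
  regarded as identified with the root.
\<close>

definition cut_size :: "('v \<times> 'v) multiset \<Rightarrow> 'v set \<Rightarrow> nat" where
  "cut_size E I = size {#e \<in># E. crosses I e#}"

definition out_degree :: "('v \<times> 'v) multiset \<Rightarrow> 'v set \<Rightarrow> 'v \<Rightarrow> nat" where
  "out_degree E I i = size {#e \<in># E. fst e = i \<and> snd e \<notin> I \<or> snd e = i \<and> fst e \<notin> I#}"

definition parking :: "('v \<times> 'v) multiset \<Rightarrow> 'v set \<Rightarrow> ('v \<Rightarrow>\<^sub>0 nat) \<Rightarrow> bool" where
  "parking E A f \<longleftrightarrow> keys f \<subseteq> A \<and>
     (\<forall>I\<subseteq>A. I \<noteq> {} \<longrightarrow> (\<exists>i\<in>I. lookup f i < out_degree E I i))"

definition linked :: "('v \<times> 'v) multiset \<Rightarrow> 'v set \<Rightarrow> bool" where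
  "linked E A \<longleftrightarrow> (\<forall>a\<in>A. \<exists>r. r \<notin> A \<and> (a, r) \<in> reachable E)"

definition root_edge :: "'v set \<Rightarrow> 'v \<Rightarrow> 'v \<times> 'v \<Rightarrow> bool" where
  "root_edge A i e \<longleftrightarrow> i \<in> A \<and> (\<exists>r. r \<notin> A \<and> (e = (i, r) \<or> e = (r, i)))"

lemma cut_size_union: "cut_size (E + F) I = cut_size E I + cut_size F I"
  by (simp add: cut_size_def)

lemma cut_size_eq_sum_out_degree: "finite I \<Longrightarrow> cut_size E I = (\<Sum>i\<in>I. out_degree E I i)"
proof (induction E)
  case empty
  then show ?case by (simp add: cut_size_def out_degree_def)
next
  case (add e E)
  obtain a b where e: "e = (a, b)" by (cases e)
  have "out_degree (add_mset e E) I i = out_degree E I i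
      + (if a = i then (if b \<in> I then 0 else 1) else 0)
      + (if b = i then (if a \<in> I then 0 else 1) else 0)" if "i \<in> I" for i
    using that by (auto simp: out_degree_def e)
  then have "(\<Sum>i\<in>I. out_degree (add_mset e E) I i) = (\<Sum>i\<in>I. out_degree E I i)
      + (\<Sum>i\<in>I. if a = i then (if b \<in> I then 0 else 1) else 0)
      + (\<Sum>i\<in>I. if b = i then (if a \<in> I then 0 else 1) else 0)"
    by (simp add: sum.distrib)
  then show ?case
    using add by (auto simp: cut_size_def crosses_def e)
qed

lemma linked_imp_cut_size_pos:
  assumes "linked E A" "I \<subseteq> A" "I \<noteq> {}"
  shows "cut_size E I > 0"
proof -
  obtain a where a: "a \<in> I" using assms(3) by blast
  then obtain r where "r \<notin> A" "(a, r) \<in> reachable E"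
    using assms(1,2) by (auto simp: linked_def)
  then obtain e where "e \<in># E" "crosses I e"
    using a assms(2) by (blast elim: reachable_crossing_edge)
  then have "e \<in># {#e \<in># E. crosses I e#}" by simp
  then show ?thesis
    unfolding cut_size_def nonempty_has_size[symmetric] by (metis empty_iff set_mset_empty)
qed

text \<open>Deletion-contraction: contracting a root edge removes its other end from the set \<open>A\<close>.\<close>

lemma rooted_multigraph_induct [case_names no_root_edge root_edge]:
  assumes "\<And>E A. (\<And>e i. e \<in># E \<Longrightarrow> \<not> root_edge A i e) \<Longrightarrow> P E A"
    and "\<And>e i E A. root_edge A i e \<Longrightarrow> P E (A - {i}) \<Longrightarrow> P E A \<Longrightarrow> P (add_mset e E) A"
  shows "P E A"
proof (induction "size E" arbitrary: E A rule: less_induct)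
  case (less E A)
  show ?case
  proof (cases "\<exists>e i. e \<in># E \<and> root_edge A i e")
    case True
    then obtain e i E' where e: "root_edge A i e" and E: "E = add_mset e E'" by (metis mset_add)
    have "P E' (A - {i})" "P E' A" by (simp_all add: less E)
    then show ?thesis unfolding E by (rule assms(2)[OF e])
  qed (blast intro: assms(1))
qed

context
  fixes E :: "('v \<times> 'v) multiset" and A :: "'v set"
  assumes no_root_edge: "\<And>e i. e \<in># E \<Longrightarrow> \<not> root_edge A i e"
begin

lemma not_crosses_if_no_root_edge: "e \<in># E \<Longrightarrow> \<not> crosses A e"
  using no_root_edge by (cases e) (auto simp: root_edge_def crosses_def)

lemma cut_size_if_no_root_edge: "cut_size E A = 0"
  using not_crosses_if_no_root_edge by (auto simp: cut_size_def)

lemma not_parking_if_no_root_edge: "A \<noteq> {} \<Longrightarrow> \<not> parking E A f"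
proof
  assume "A \<noteq> {}" "parking E A f"
  then obtain i where "i \<in> A" "lookup f i < out_degree E A i" by (auto simp: parking_def)
  moreover have "out_degree E A i = 0"
    using not_crosses_if_no_root_edge \<open>i \<in> A\<close> by (auto simp: out_degree_def crosses_def)
  ultimately show False by simp
qed

end

context
  fixes A :: "'v set" and i :: 'v and e :: "'v \<times> 'v"
  assumes root_edge: "root_edge A i e"
begin

lemma out_degree_root_edge:
  "I \<subseteq> A \<Longrightarrow> j \<in> I \<Longrightarrow>
    out_degree (add_mset e E) I j = out_degree E I j + (if j = i then 1 else 0)"
  using root_edge by (auto simp: root_edge_def out_degree_def)

lemma cut_size_root_edge:
  "I \<subseteq> A \<Longrightarrow> cut_size (add_mset e E) I = cut_size E I + (if i \<in> I then 1 else 0)"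
  using root_edge by (auto simp: root_edge_def cut_size_def crosses_def)

lemma parking_contract:
  "parking E (A - {i}) f \<longleftrightarrow> parking (add_mset e E) A f \<and> lookup f i = 0"
proof
  assume park: "parking (add_mset e E) A f \<and> lookup f i = 0"
  show "parking E (A - {i}) f"
    unfolding parking_def
  proof (intro conjI allI impI)
    show "keys f \<subseteq> A - {i}" using park by (auto simp: parking_def in_keys_iff)
    fix I assume I: "I \<subseteq> A - {i}" "I \<noteq> {}"
    then have "I \<subseteq> A" by auto
    then obtain j where "j \<in> I" "lookup f j < out_degree (add_mset e E) I j"
      using park I unfolding parking_def by blast
    then show "\<exists>j\<in>I. lookup f j < out_degree E I j"
      using I \<open>I \<subseteq> A\<close> out_degree_root_edge[of I j E]
      by (intro bexI[of _ j]) (auto split: if_splits)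
  qed
next
  assume park: "parking E (A - {i}) f"
  then have f0: "lookup f i = 0"
    using not_in_keys_iff_lookup_eq_zero[of i f] unfolding parking_def by blast
  have "\<exists>j\<in>I. lookup f j < out_degree (add_mset e E) I j" if I: "I \<subseteq> A" "I \<noteq> {}" for I
  proof (cases "i \<in> I")
    case True
    then show ?thesis using I f0 out_degree_root_edge[of I i E] by (intro bexI[of _ i]) auto
  next
    case False
    then have "I \<subseteq> A - {i}" using I by auto
    then obtain j where "j \<in> I" "lookup f j < out_degree E I j"
      using park I unfolding parking_def by blast
    then show ?thesis using I out_degree_root_edge[of I j E] by (intro bexI[of _ j]) auto
  qed
  then show "parking (add_mset e E) A f \<and> lookup f i = 0"
    using park f0 unfolding parking_def by blast
qed

lemma parking_delete: "parking E A f \<longleftrightarrow> parking (add_mset e E) A (f + single i 1)"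
proof -
  have "keys (f + single i 1) = insert i (keys f)"
    by (auto simp: in_keys_iff lookup_add lookup_single when_def split: if_splits)
  moreover have "i \<in> A" using root_edge by (simp add: root_edge_def)
  moreover have "lookup (f + single i 1) j < out_degree (add_mset e E) I j \<longleftrightarrow>
    lookup f j < out_degree E I j" if "I \<subseteq> A" "j \<in> I" for I j
    using out_degree_root_edge[OF that, of E] by (auto simp: lookup_add lookup_single when_def)
  ultimately show ?thesis unfolding parking_def by (metis insert_subset)
qed

lemma linked_contract:
  assumes "linked E (A - {i})"
  shows "linked (add_mset e E) A"
  unfolding linked_def
proof
  fix a assume a: "a \<in> A"
  obtain r0 where "r0 \<notin> A" "e = (i, r0) \<or> e = (r0, i)" using root_edge by (auto simp: root_edge_def)
  then have r0: "r0 \<notin> A" "(i, r0) \<in> reachable (add_mset e E)"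
    by (auto intro: reachable_edge)
  show "\<exists>r. r \<notin> A \<and> (a, r) \<in> reachable (add_mset e E)"
  proof (cases "a = i")
    case False
    then obtain r where "r \<notin> A - {i}" "(a, r) \<in> reachable E"
      using a assms by (auto simp: linked_def)
    then have "r \<notin> A - {i}" "(a, r) \<in> reachable (add_mset e E)"
      using reachable_mono[of E "add_mset e E"] by auto
    then show ?thesis using r0 by (cases "r = i") (auto intro: reachable_trans)
  qed (use r0 in auto)
qed

end

lemma kill_vars_root_edge:
  "root_edge A i e \<Longrightarrow> kill_vars (- A) (pvar (fst e) - pvar (snd e)) \<in> {pvar i, - pvar i}"
  by (auto simp: root_edge_def kill_vars.hom_minus kill_vars_pvar)


subsection \<open>Degree bounds along cuts\<close>

definition shift_vars :: "nat set \<Rightarrow> cpoly \<Rightarrow> cpoly poly" where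
  "shift_vars I = psubst (\<lambda>c. [:pconst c:]) (\<lambda>i. [:pvar i, if i \<in> I then 1 else 0:])"

interpretation pconst_poly: comm_ring_hom "\<lambda>c. [:pconst c:]"
  by unfold_locales (auto simp: single_add mult_single mult.commute)

interpretation shift_vars: comm_ring_hom "shift_vars I" for I
  unfolding shift_vars_def by (rule pconst_poly.comm_ring_hom_psubst)

lemma shift_vars_pvar: "shift_vars I (pvar i) = [:pvar i, if i \<in> I then 1 else 0:]"
  unfolding shift_vars_def by (rule psubst_pvar) unfold_locales

lemma shift_vars_pscale: "shift_vars I (pscale c p) = smult (pconst c) (shift_vars I p)"
  by (simp add: pscale_def shift_vars.hom_mult) (simp add: shift_vars_def pconst_poly.psubst_pconst)

lemma poly_shift_vars_0: "poly (shift_vars I p) 0 = p"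
  by (simp add: shift_vars_def poly_hom.hom_psubst csubst_id)

lemma shift_vars_eq_0_iff: "shift_vars I p = 0 \<longleftrightarrow> p = 0"
  using poly_shift_vars_0[of I p] by auto

lemma shift_vars_kill_vars:
  assumes "I \<inter> R = {}"
  shows "shift_vars I (kill_vars R p) = map_poly (kill_vars R) (shift_vars I p)"
proof -
  interpret map_poly: map_poly_comm_ring_hom "kill_vars R" ..
  have const: "map_poly (kill_vars R) [:pconst c:] = [:pconst c:]" for c
    by (simp add: kill_vars.map_poly_pCons_hom) (simp add: kill_vars_def pconst.psubst_pconst)
  have var: "map_poly (kill_vars R) [:pvar i, if i \<in> I then 1 else 0:] =
      shift_vars I (if i \<in> R then 0 else pvar i)" for i
    using assms by (auto simp: kill_vars.map_poly_pCons_hom kill_vars_pvar shift_vars_pvar)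
  have "shift_vars I (kill_vars R p) =
      psubst (\<lambda>c. [:pconst c:]) (\<lambda>i. shift_vars I (if i \<in> R then 0 else pvar i)) p"
    unfolding shift_vars_def kill_vars_def by (rule pconst_poly.psubst_psubst)
  also have "\<dots> = map_poly (kill_vars R) (shift_vars I p)"
    unfolding shift_vars_def[of I] map_poly.hom_psubst const var unfolding shift_vars_def ..
  finally show ?thesis .
qed

lemma degree_psubst_le:
  fixes \<theta> :: "'v \<Rightarrow> 'a::comm_ring_1 poly"
  assumes "\<And>i. degree (\<theta> i) \<le> 1" and "\<And>t. t \<in> keys p \<Longrightarrow> monom_degree t \<le> k"
  shows "degree (psubst (\<lambda>c. [:h c:]) \<theta> p) \<le> k"
  unfolding psubst_def
proof (intro degree_sum_le finite_keys)
  fix t assume t: "t \<in> keys p"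
  have "degree (monom_eval \<theta> t) \<le> (\<Sum>i\<in>keys t. degree (\<theta> i ^ lookup t i))"
    unfolding monom_eval_def by (rule degree_prod_sum_le[OF finite_keys, unfolded comp_def])
  also have "\<dots> \<le> (\<Sum>i\<in>keys t. lookup t i)"
  proof (rule sum_mono)
    fix i
    have "degree (\<theta> i ^ lookup t i) \<le> degree (\<theta> i) * lookup t i"
      by (rule degree_power_le)
    also have "\<dots> \<le> 1 * lookup t i" by (intro mult_le_mono1 assms)
    finally show "degree (\<theta> i ^ lookup t i) \<le> lookup t i" by simp
  qed
  also have "\<dots> \<le> k" using assms(2)[OF t] by (simp add: monom_degree_def)
  finally show "degree ([:h (lookup p t):] * monom_eval \<theta> t) \<le> k"
    using degree_mult_le[of "[:h (lookup p t):]" "monom_eval \<theta> t"] by simp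
qed

lemma degree_shift_vars_homogeneous: "homogeneous k p \<Longrightarrow> degree (shift_vars I p) \<le> k"
  unfolding shift_vars_def
  by (rule degree_psubst_le) (auto simp: homogeneous_def monom_degree_def)

definition cut_bounded :: "(nat \<times> nat) multiset \<Rightarrow> nat set \<Rightarrow> cpoly \<Rightarrow> bool" where
  "cut_bounded E A p \<longleftrightarrow> vars_in A p \<and>
     (\<forall>I\<subseteq>A. I \<noteq> {} \<longrightarrow> (\<forall>j\<ge>cut_size E I. coeff (shift_vars I p) j = 0))"

lemma cut_boundedI:
  assumes "vars_in A p"
    and "\<And>I. I \<subseteq> A \<Longrightarrow> I \<noteq> {} \<Longrightarrow> degree (shift_vars I p) < cut_size E I"
  shows "cut_bounded E A p"
  unfolding cut_bounded_def using assms by (meson coeff_eq_0 order_less_le_trans)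

lemma subspace_cut_bounded: "cpoly.subspace {p. cut_bounded E A p}"
  by (rule cpoly.subspaceI)
    (auto simp: cut_bounded_def shift_vars.hom_add shift_vars_pscale
      intro: vars_in_0 vars_in_add vars_in_pscale)

lemma cut_bounded_contract:
  assumes e: "root_edge A i e" and p: "cut_bounded (add_mset e E) A p"
  shows "cut_bounded E (A - {i}) (kill_vars {i} p)"
  unfolding cut_bounded_def
proof (intro conjI allI impI)
  show "vars_in (A - {i}) (kill_vars {i} p)"
    using p by (simp add: cut_bounded_def vars_in_kill_vars)
  fix I j assume I: "I \<subseteq> A - {i}" "I \<noteq> {}" "cut_size E I \<le> j"
  then have "I \<subseteq> A" "i \<notin> I" by auto
  then have "coeff (shift_vars I p) j = 0"
    using p I cut_size_root_edge[OF e, of I E] by (simp add: cut_bounded_def)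
  then show "coeff (shift_vars I (kill_vars {i} p)) j = 0"
    using \<open>i \<notin> I\<close> by (simp add: shift_vars_kill_vars)
qed

lemma cut_bounded_delete:
  assumes e: "root_edge A i e" and q: "cut_bounded (add_mset e E) A (pvar i * q)"
  shows "cut_bounded E A q"
  unfolding cut_bounded_def
proof (intro conjI allI impI)
  show "vars_in A q" using q vars_in_pvar_multD by (auto simp: cut_bounded_def)
  fix I j assume I: "I \<subseteq> A" "I \<noteq> {}" "cut_size E I \<le> j"
  show "coeff (shift_vars I q) j = 0"
  proof (cases "q = 0")
    case False
    let ?x = "shift_vars I (pvar i)" and ?q = "shift_vars I q"
    have x: "?x \<noteq> 0" "degree ?x = (if i \<in> I then 1 else 0)"
      by (simp_all add: shift_vars_pvar pvar_neq_0)
    have q0: "?q \<noteq> 0" using False by (simp add: shift_vars_eq_0_iff)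
    have "coeff (?x * ?q) k = 0" if "cut_size (add_mset e E) I \<le> k" for k
      using q I(1,2) that by (simp add: cut_bounded_def shift_vars.hom_mult)
    then have "degree (?x * ?q) < cut_size (add_mset e E) I"
      using x(1) q0 by (metis leI leading_coeff_0_iff mult_eq_0_iff)
    then have "degree ?q < cut_size E I"
      using x q0 cut_size_root_edge[OF e I(1), of E] by (auto simp: degree_mult_eq split: if_splits)
    then show ?thesis using I(3) by (intro coeff_eq_0) simp
  qed simp
qed

lemma cut_bounded_eq_0_if_no_root_edge:
  assumes "\<And>e i. e \<in># E \<Longrightarrow> \<not> root_edge A i e" and "A \<noteq> {}" and "cut_bounded E A p"
  shows "p = 0"
proof -
  have "coeff (shift_vars A p) j = 0" for j
    using assms(2,3) cut_size_if_no_root_edge[OF assms(1)] by (auto simp: cut_bounded_def)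
  then show ?thesis by (metis shift_vars_eq_0_iff poly_eqI coeff_0)
qed

theorem cut_bounded_eq_0I:
  assumes "cut_bounded E A p" and "\<And>f. parking E A f \<Longrightarrow> lookup p f = 0"
  shows "p = 0"
  using assms
proof (induction E A arbitrary: p rule: rooted_multigraph_induct)
  case (no_root_edge E A)
  show ?case
  proof (cases "A = {}")
    case True
    then have "lookup p 0 = 0" by (intro no_root_edge.prems(2)) (simp add: parking_def)
    moreover have "keys p \<subseteq> {0}"
      using no_root_edge.prems(1) True by (auto simp: cut_bounded_def vars_in_def)
    ultimately show ?thesis
      by (intro poly_mapping_eqI) (metis in_keys_iff lookup_zero singletonD subsetD)
  qed (use cut_bounded_eq_0_if_no_root_edge no_root_edge in blast)
next
  case (root_edge e i E A)
  have "kill_vars {i} p = 0"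
  proof (rule root_edge.IH(1))
    show "cut_bounded E (A - {i}) (kill_vars {i} p)"
      by (rule cut_bounded_contract[OF root_edge(1) root_edge.prems(1)])
    show "lookup (kill_vars {i} p) f = 0" if "parking E (A - {i}) f" for f
      using that root_edge.prems(2)[of f] parking_contract[OF root_edge(1), of E f]
      by (simp add: lookup_kill_vars)
  qed
  then obtain q where q: "p = pvar i * q" using pvar_dvd_if_kill_vars_eq_0 by (metis dvdE)
  have "q = 0"
  proof (rule root_edge.IH(2))
    show "cut_bounded E A q"
      using cut_bounded_delete[OF root_edge(1)] root_edge.prems(1) by (simp add: q)
    show "lookup q f = 0" if "parking E A f" for f
      using that root_edge.prems(2)[of "f + single i 1"] parking_delete[OF root_edge(1), of E f]
      by (simp add: q lookup_pvar_mult)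
  qed
  then show ?case by (simp add: q)
qed


subsection \<open>The space of a rooted multigraph\<close>

definition rooted_gens :: "(nat \<times> nat) multiset \<Rightarrow> nat set \<Rightarrow> cpoly set" where
  "rooted_gens E A = {kill_vars (- A) (graph_poly H) | H. H \<subseteq># E \<and> linked (E - H) A}"

lemma degree_shift_graph_poly:
  assumes "I \<subseteq> A"
  shows "degree (shift_vars I (kill_vars (- A) (graph_poly H))) \<le> cut_size H I"
proof (induction H)
  case (add e H)
  let ?\<psi> = "\<lambda>p. shift_vars I (kill_vars (- A) p)"
  have var: "?\<psi> (pvar i) = [:if i \<in> A then pvar i else 0, if i \<in> I then 1 else 0:]" for i
    using assms by (auto simp: kill_vars_pvar shift_vars_pvar)
  have "degree (?\<psi> (pvar (fst e) - pvar (snd e))) \<le> (if crosses I e then 1 else 0)"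
    by (simp add: shift_vars.hom_minus kill_vars.hom_minus var crosses_def)
  then show ?case
    using add degree_mult_le[of "?\<psi> (pvar (fst e) - pvar (snd e))" "?\<psi> (graph_poly H)"]
    by (simp add: graph_poly_add_mset shift_vars.hom_mult kill_vars.hom_mult cut_size_def
        split: if_splits)
qed simp

lemma rooted_gens_cut_bounded:
  assumes "p \<in> rooted_gens E A"
  shows "cut_bounded E A p"
proof -
  obtain H where H: "p = kill_vars (- A) (graph_poly H)" "H \<subseteq># E" "linked (E - H) A"
    using assms by (auto simp: rooted_gens_def)
  show ?thesis
  proof (rule cut_boundedI)
    show "vars_in A p" by (simp add: H(1) vars_in_kill_vars_Compl)
    fix I assume I: "I \<subseteq> A" "I \<noteq> {}"
    have "cut_size E I = cut_size H I + cut_size (E - H) I"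
      using H(2) by (simp flip: cut_size_union)
    then show "degree (shift_vars I p) < cut_size E I"
      using degree_shift_graph_poly[OF I(1), of H] linked_imp_cut_size_pos[OF H(3) I] H(1) by simp
  qed
qed

lemma span_rooted_gens_subset: "cpoly.span (rooted_gens E A) \<subseteq> {p. cut_bounded E A p}"
  by (rule cpoly.span_minimal[OF _ subspace_cut_bounded]) (use rooted_gens_cut_bounded in blast)

lemma rooted_gens_mult_root_edge:
  assumes "root_edge A i e"
  shows "(*) (pvar i) ` cpoly.span (rooted_gens E A) \<subseteq> cpoly.span (rooted_gens (add_mset e E) A)"
proof (rule pmult.image_span_subset, rule image_subsetI)
  fix p assume "p \<in> rooted_gens E A"
  then obtain H where H: "p = kill_vars (- A) (graph_poly H)" "H \<subseteq># E" "linked (E - H) A"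
    by (auto simp: rooted_gens_def)
  then have "kill_vars (- A) (graph_poly (add_mset e H)) \<in> rooted_gens (add_mset e E) A"
    unfolding rooted_gens_def by (intro CollectI exI[of _ "add_mset e H"]) auto
  then have "kill_vars (- A) (pvar (fst e) - pvar (snd e)) * p \<in>
      cpoly.span (rooted_gens (add_mset e E) A)"
    by (simp add: graph_poly_add_mset kill_vars.hom_mult H(1) cpoly.span_base)
  then show "pvar i * p \<in> cpoly.span (rooted_gens (add_mset e E) A)"
    using kill_vars_root_edge[OF assms] cpoly.span_neg by fastforce
qed

lemma rooted_gens_contract:
  assumes "root_edge A i e"
  shows "cpoly.span (rooted_gens E (A - {i})) \<subseteq>
    kill_vars {i} ` cpoly.span (rooted_gens (add_mset e E) A)"
  unfolding kill_vars.span_image[symmetric]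
proof (rule cpoly.span_mono, rule subsetI)
  fix p assume "p \<in> rooted_gens E (A - {i})"
  then obtain H where H: "p = kill_vars (- (A - {i})) (graph_poly H)" "H \<subseteq># E"
      "linked (E - H) (A - {i})"
    by (auto simp: rooted_gens_def)
  have "add_mset e (E - H) = add_mset e E - H"
    using subset_mset.add_diff_assoc2[OF H(2), of "{#e#}"] by simp
  then have "linked (add_mset e E - H) A" using linked_contract[OF assms H(3)] by simp
  moreover have "H \<subseteq># add_mset e E"
    using H(2) by (rule subset_mset.order_trans) simp
  ultimately have "kill_vars (- A) (graph_poly H) \<in> rooted_gens (add_mset e E) A"
    by (auto simp: rooted_gens_def)
  moreover have "{i} \<union> - A = - (A - {i})" by auto
  then have "p = kill_vars {i} (kill_vars (- A) (graph_poly H))"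
    by (simp add: kill_vars_kill_vars H(1))
  ultimately show "p \<in> kill_vars {i} ` rooted_gens (add_mset e E) A" by blast
qed

lemma lookup_add_pvar_mult_if_parking:
  assumes "root_edge A i e" "parking (add_mset e E) A f"
    and contraction: "\<And>g. parking E (A - {i}) g \<Longrightarrow> lookup (kill_vars {i} p) g = F g"
    and deletion: "\<And>g. parking E A g \<Longrightarrow>
      lookup q g = F (g + single i 1) - lookup p (g + single i 1)"
  shows "lookup (p + pvar i * q) f = F f"
proof (cases "lookup f i = 0")
  case True
  then have "lookup (kill_vars {i} p) f = F f"
    using contraction assms(2) parking_contract[OF assms(1), of E f] by simp
  then have "lookup p f = F f" using True by (simp add: lookup_kill_vars in_keys_iff)
  then show ?thesis by (simp add: lookup_add lookup_pvar_mult_0[OF True])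
next
  case False
  then obtain g where g: "f = g + single i 1" by (metis diff_single_add_single)
  then have "parking E A g" using assms(2) parking_delete[OF assms(1), of E g] by simp
  then show ?thesis using deletion[of g] by (simp add: g lookup_add lookup_pvar_mult)
qed

theorem rooted_gens_prescribed_coeffs:
  "\<exists>p\<in>cpoly.span (rooted_gens E A). \<forall>f. parking E A f \<longrightarrow> lookup p f = F f"
proof (induction E A arbitrary: F rule: rooted_multigraph_induct)
  case (no_root_edge E A)
  show ?case
  proof (cases "A = {}")
    case True
    then have "kill_vars (- A) (graph_poly {#}) \<in> rooted_gens E A"
      unfolding rooted_gens_def by (intro CollectI exI[of _ "{#}"]) (auto simp: linked_def)
    then have "pscale (F 0) 1 \<in> cpoly.span (rooted_gens E A)"
      by (intro cpoly.span_scale cpoly.span_base) simp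
    moreover have "lookup (pscale (F 0) 1) f = F f" if "parking E A f" for f
    proof -
      have "f = 0" using that True by (simp add: parking_def)
      then show ?thesis by (simp add: lookup_pscale)
    qed
    ultimately show ?thesis by blast
  qed (use not_parking_if_no_root_edge[OF no_root_edge] cpoly.span_zero in blast)
next
  case (root_edge e i E A)
  obtain p0 where p0: "p0 \<in> cpoly.span (rooted_gens E (A - {i}))"
    "\<And>f. parking E (A - {i}) f \<Longrightarrow> lookup p0 f = F f"
    using root_edge.IH(1)[of F] by blast
  obtain p1 where p1: "p1 \<in> cpoly.span (rooted_gens (add_mset e E) A)" "p0 = kill_vars {i} p1"
    using rooted_gens_contract[OF root_edge(1)] p0(1) by blast
  obtain p2 where p2: "p2 \<in> cpoly.span (rooted_gens E A)"
    "\<And>f. parking E A f \<Longrightarrow> lookup p2 f = F (f + single i 1) - lookup p1 (f + single i 1)"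
    using root_edge.IH(2)[of "\<lambda>f. F (f + single i 1) - lookup p1 (f + single i 1)"] by blast
  have "lookup (p1 + pvar i * p2) f = F f" if "parking (add_mset e E) A f" for f
    using lookup_add_pvar_mult_if_parking[OF root_edge(1) that] p0(2) p1(2) p2(2) by simp
  moreover have "p1 + pvar i * p2 \<in> cpoly.span (rooted_gens (add_mset e E) A)"
    using p1(1) p2(1) rooted_gens_mult_root_edge[OF root_edge(1)] by (blast intro: cpoly.span_add)
  ultimately show ?case by blast
qed

theorem span_rooted_gens_eq: "cpoly.span (rooted_gens E A) = {p. cut_bounded E A p}"
proof (intro subset_antisym span_rooted_gens_subset subsetI)
  fix p assume p: "p \<in> {p. cut_bounded E A p}"
  obtain q where q: "q \<in> cpoly.span (rooted_gens E A)"
    "\<And>f. parking E A f \<Longrightarrow> lookup q f = lookup p f"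
    using rooted_gens_prescribed_coeffs[of E A "lookup p"] by blast
  have "cut_bounded E A (p - q)"
    using cpoly.subspace_diff[OF subspace_cut_bounded p] span_rooted_gens_subset q(1) by blast
  then have "p - q = 0" by (rule cut_bounded_eq_0I) (simp add: q(2) lookup_minus)
  then show "p \<in> cpoly.span (rooted_gens E A)" using q(1) by simp
qed


section \<open>The complete multigraph\<close>

definition all_edges :: "nat \<Rightarrow> (nat \<times> nat) set" where
  "all_edges n = (SIGMA i:{1..n}. {i<..n + 1})"

definition edge_mult :: "nat \<Rightarrow> nat \<Rightarrow> nat \<Rightarrow> nat \<times> nat \<Rightarrow> nat" where
  "edge_mult l m n e = (if snd e = n + 1 then l else m)"

lemma finite_all_edges [simp]: "finite (all_edges n)"
  by (simp add: all_edges_def)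

lemma mem_all_edges: "(i, j) \<in> all_edges n \<longleftrightarrow> 1 \<le> i \<and> i < j \<and> j \<le> n + 1"
  by (auto simp: all_edges_def)

lemma sum_all_edges:
  fixes f :: "nat \<times> nat \<Rightarrow> 'a::comm_monoid_add"
  shows "(\<Sum>e\<in>all_edges n. f e) = (\<Sum>i\<in>{1..n}. (\<Sum>j\<in>{i<..n}. f (i, j)) + f (i, n + 1))"
proof -
  have "(\<Sum>e\<in>all_edges n. f e) = (\<Sum>i\<in>{1..n}. \<Sum>j\<in>{i<..n + 1}. f (i, j))"
    by (simp add: all_edges_def sum.Sigma)
  also have "\<dots> = (\<Sum>i\<in>{1..n}. (\<Sum>j\<in>{i<..n}. f (i, j)) + f (i, n + 1))"
  proof (rule sum.cong[OF refl])
    fix i assume "i \<in> {1..n}"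
    then have "{i<..n + 1} = insert (n + 1) {i<..n}" by auto
    then show "(\<Sum>j\<in>{i<..n + 1}. f (i, j)) = (\<Sum>j\<in>{i<..n}. f (i, j)) + f (i, n + 1)"
      by (simp add: add.commute)
  qed
  finally show ?thesis .
qed

lemma complete_multigraph_eq_sum_all_edges:
  "complete_multigraph l m n = (\<Sum>e\<in>all_edges n. replicate_mset (edge_mult l m n e) e)"
  by (simp add: complete_multigraph_def sum_all_edges sum.distrib edge_mult_def)

lemma count_complete_multigraph:
  "count (complete_multigraph l m n) e = (if e \<in> all_edges n then edge_mult l m n e else 0)"
  by (simp add: complete_multigraph_eq_sum_all_edges count_sum)

lemma complete_multigraph_edge: "e \<in># complete_multigraph l m n \<Longrightarrow> e \<in> all_edges n"
  using count_complete_multigraph[of l m n e]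
  by (auto simp flip: count_greater_zero_iff split: if_splits)

lemma size_filter_sum_replicate_mset:
  "finite A \<Longrightarrow> size (filter_mset P (\<Sum>x\<in>A. replicate_mset (w x) x)) = (\<Sum>x\<in>{x \<in> A. P x}. w x)"
proof (induction A rule: finite_induct)
  case (insert x A)
  have "filter_mset P (replicate_mset k x) = (if P x then replicate_mset k x else {#})" for k
    by (induction k) auto
  moreover have "{y \<in> insert x A. P y} = (if P x then insert x else id) {y \<in> A. P y}" by auto
  ultimately show ?case using insert by simp
qed simp

lemma size_filter_complete_multigraph:
  "size (filter_mset P (complete_multigraph l m n)) =
    (\<Sum>e\<in>{e \<in> all_edges n. P e}. edge_mult l m n e)"
  unfolding complete_multigraph_eq_sum_all_edges
  by (rule size_filter_sum_replicate_mset[OF finite_all_edges])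

lemma size_complete_multigraph: "size (complete_multigraph l m n) = (\<Sum>j<n. l + m * j)"
proof -
  have "size (complete_multigraph l m n) = (\<Sum>e\<in>all_edges n. edge_mult l m n e)"
    using size_filter_complete_multigraph[of "\<lambda>_. True" l m n] by simp
  also have "\<dots> = (\<Sum>i\<in>{1..n}. l + m * (n - i))"
    by (simp add: sum_all_edges edge_mult_def add.commute mult.commute)
  also have "\<dots> = (\<Sum>j<n. l + m * j)"
    by (rule sum.reindex_bij_witness[of _ "\<lambda>j. n - j" "\<lambda>i. n - i"]) auto
  finally show ?thesis .
qed

lemma all_edges_leaving:
  assumes "I \<subseteq> {1..n}" "i \<in> I"
  shows "{e \<in> all_edges n. fst e = i \<and> snd e \<notin> I \<or> snd e = i \<and> fst e \<notin> I} =
    (\<lambda>j. (min i j, max i j)) ` ({1..n + 1} - I)" (is "?L = ?f ` ?J")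
proof (rule subset_antisym; rule subsetI)
  fix e assume e: "e \<in> ?L"
  obtain a b where ab: "e = (a, b)" by (cases e)
  show "e \<in> ?f ` ?J"
  proof (cases "a = i")
    case True
    then show ?thesis
      using e assms by (intro image_eqI[of _ _ b]) (auto simp: ab mem_all_edges)
  next
    case False
    then show ?thesis
      using e assms by (intro image_eqI[of _ _ a]) (auto simp: ab mem_all_edges)
  qed
next
  fix e assume "e \<in> ?f ` ?J"
  then obtain j where j: "e = ?f j" "j \<in> {1..n + 1}" "j \<notin> I" by auto
  then have "i \<noteq> j" "i \<in> {1..n}" using assms by auto
  then show "e \<in> ?L" using j assms(2) by (auto simp: mem_all_edges min_def max_def)
qed

lemma out_degree_complete_multigraph:
  assumes I: "I \<subseteq> {1..n}" and i: "i \<in> I"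
  shows "out_degree (complete_multigraph l m n) I i = l + m * (n - card I)"
proof -
  let ?f = "\<lambda>j. (min i j, max i j)"
  have "inj_on ?f ({1..n + 1} - I)"
    by (auto simp: inj_on_def min_def max_def split: if_splits)
  then have "out_degree (complete_multigraph l m n) I i =
      (\<Sum>j\<in>{1..n + 1} - I. edge_mult l m n (?f j))"
    unfolding out_degree_def size_filter_complete_multigraph all_edges_leaving[OF assms]
    by (simp add: sum.reindex)
  also have "\<dots> = (\<Sum>j\<in>{1..n + 1} - I. if j = n + 1 then l else m)"
    using assms by (intro sum.cong) (auto simp: edge_mult_def max_def)
  also have "{1..n + 1} - I = insert (n + 1) ({1..n} - I)" using I by auto
  also have "(\<Sum>j\<in>\<dots>. if j = n + 1 then l else m) = l + m * (n - card I)"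
    using I by (simp add: card_Diff_subset finite_subset[OF I] mult.commute)
  finally show ?thesis .
qed

lemma cut_size_complete_multigraph:
  assumes "I \<subseteq> {1..n}"
  shows "cut_size (complete_multigraph l m n) I = card I * (l + m * (n - card I))"
  using assms
  by (simp add: cut_size_eq_sum_out_degree finite_subset[OF assms] out_degree_complete_multigraph)

lemma cut_size_complete_multigraph_ge:
  assumes I: "I \<subseteq> {1..n}" "I \<noteq> {}" and "l \<ge> 1" "m \<ge> 1"
  shows "cut_size (complete_multigraph l m n) I \<ge> n"
proof -
  have "1 \<le> card I" "card I \<le> n"
    using I card_mono[of "{1..n}" I] card_gt_0_iff[of I] finite_subset[OF I(1)] by auto
  then obtain a b where ab: "card I = Suc a" "n = Suc a + b"
    by (metis Suc_le_D le_Suc_ex One_nat_def)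
  have "n \<le> Suc a * (1 + 1 * b)" by (simp add: ab)
  also have "\<dots> \<le> Suc a * (l + m * b)" using assms(3,4) by (intro mult_le_mono add_le_mono) auto
  finally show ?thesis using cut_size_complete_multigraph[OF I(1), of l m] by (simp add: ab)
qed

lemma slim_iff_linked:
  "slim l m n G \<longleftrightarrow>
    G \<subseteq># complete_multigraph l m n \<and> linked (complete_multigraph l m n - G) {1..n}"
proof -
  let ?E = "complete_multigraph l m n - G"
  have stay: "v \<in> {1..n + 1}" if "(u, v) \<in> reachable ?E" "u \<in> {1..n + 1}" for u v
  proof (rule ccontr)
    assume "v \<notin> {1..n + 1}"
    with that obtain e where "e \<in># ?E" "crosses {1..n + 1} e" by (rule reachable_crossing_edge)
    then show False
      using complete_multigraph_edge[OF in_diffD]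
      by (cases e) (fastforce simp: crosses_def mem_all_edges)
  qed
  have "connected_multigraph {1..n + 1} ?E \<longleftrightarrow> linked ?E {1..n}"
  proof
    assume "connected_multigraph {1..n + 1} ?E"
    then have "n + 1 \<notin> {1..n} \<and> (a, n + 1) \<in> reachable ?E" if "a \<in> {1..n}" for a
      using that by (auto simp: connected_multigraph_iff_reachable)
    then show "linked ?E {1..n}" unfolding linked_def by blast
  next
    assume linked: "linked ?E {1..n}"
    show "connected_multigraph {1..n + 1} ?E"
    proof (rule connected_multigraph_if_all_reach)
      fix u assume u: "u \<in> {1..n + 1}"
      show "(u, n + 1) \<in> reachable ?E"
      proof (cases "u = n + 1")
        case False
        then have "u \<in> {1..n}" using u by auto
        then obtain r where "r \<notin> {1..n}" "(u, r) \<in> reachable ?E"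
          using linked unfolding linked_def by blast
        moreover from this have "r = n + 1" using stay u by fastforce
        ultimately show ?thesis by simp
      qed simp
    qed
  qed
  then show ?thesis by (simp add: slim_def)
qed


section \<open>The slim space\<close>

definition translate :: "nat \<Rightarrow> cpoly \<Rightarrow> cpoly" where
  "translate n = csubst (\<lambda>i. pvar i - pvar (n + 1))"

abbreviation at_root :: "nat \<Rightarrow> cpoly \<Rightarrow> cpoly" where
  "at_root n \<equiv> kill_vars (- {1..n})"

interpretation translate: comm_ring_hom "translate n" for n
  unfolding translate_def by unfold_locales

interpretation translate: module_hom pscale pscale "translate n" for n
  unfolding translate_def by (rule module_hom_csubst)

lemma translate_pvar: "translate n (pvar i) = pvar i - pvar (n + 1)"
  by (simp add: translate_def csubst_pvar)

lemma homogeneous_translate: "homogeneous k p \<Longrightarrow> homogeneous k (translate n p)"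
  unfolding translate_def by (intro homogeneous_csubst homogeneous_diff homogeneous_pvar)

lemma at_root_translate:
  assumes "vars_in {1..n} q"
  shows "at_root n (translate n q) = q"
proof -
  have "at_root n (translate n q) = csubst (\<lambda>i. at_root n (pvar i - pvar (n + 1))) q"
    unfolding translate_def kill_vars_def pconst.psubst_psubst ..
  also have "\<dots> = csubst pvar q"
    using assms by (rule psubst_cong) (auto simp: kill_vars.hom_minus kill_vars_pvar)
  finally show ?thesis by (simp add: csubst_id)
qed

lemma lookup_at_root: "keys f \<subseteq> {1..n} \<Longrightarrow> lookup (at_root n p) f = lookup p f"
  by (simp add: lookup_kill_vars disjoint_eq_subset_Compl)

lemma translate_at_root_graph_poly:
  assumes "\<And>e. e \<in># G \<Longrightarrow> e \<in> all_edges n"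
  shows "translate n (at_root n (graph_poly G)) = graph_poly G"
  using assms
proof (induction G)
  case (add e G)
  have var: "translate n (at_root n (pvar i)) = pvar i - pvar (n + 1)" if "i \<in> {1..n + 1}" for i
  proof -
    have "i \<in> {1..n} \<or> i = n + 1" using that by auto
    then show ?thesis by (auto simp: kill_vars_pvar translate_pvar)
  qed
  have "fst e \<in> {1..n + 1}" "snd e \<in> {1..n + 1}"
    using add.prems[of e] by (cases e; auto simp: mem_all_edges)+
  then show ?case
    using add by (simp add: graph_poly_add_mset translate.hom_mult kill_vars.hom_mult
        translate.hom_minus kill_vars.hom_minus var del: atLeastAtMost_iff)
qed simp

lemma subspace_slim_space: "cpoly.subspace (slim_space l m n)"
  by (simp add: slim_space_def)

lemma subspace_slim_component: "cpoly.subspace (slim_component l m n k)"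
  using subspace_slim_space unfolding slim_component_def cpoly.subspace_def
  by (auto intro: homogeneous_add homogeneous_pscale)

lemma translate_at_root:
  assumes "p \<in> slim_space l m n"
  shows "translate n (at_root n p) = p"
proof -
  interpret module_pair pscale pscale ..
  show ?thesis
  proof (rule module_hom_eq_on_span)
    show "module_hom pscale pscale (\<lambda>p. translate n (at_root n p))"
      by unfold_locales
        (simp_all add: translate.hom_add kill_vars.hom_add translate.scale kill_vars.scale)
    show "module_hom pscale pscale (\<lambda>p. p)" by unfold_locales simp_all
    show "p \<in> cpoly.span {graph_poly G | G. slim l m n G}"
      using assms by (simp add: slim_space_def)
    show "translate n (at_root n q) = q" if "q \<in> {graph_poly G | G. slim l m n G}" for q
      using that by (auto simp: slim_def intro!: translate_at_root_graph_poly
          dest: mset_subset_eqD complete_multigraph_edge)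
  qed
qed

lemma at_root_image_slim_space:
  "at_root n ` slim_space l m n = {q. cut_bounded (complete_multigraph l m n) {1..n} q}"
proof -
  have "at_root n ` {graph_poly G | G. slim l m n G} =
      rooted_gens (complete_multigraph l m n) {1..n}"
    unfolding slim_iff_linked rooted_gens_def by blast
  then show ?thesis
    by (simp add: slim_space_def span_rooted_gens_eq flip: kill_vars.span_image)
qed

lemma slim_space_eq_translate:
  "slim_space l m n = translate n ` {q. cut_bounded (complete_multigraph l m n) {1..n} q}"
  unfolding at_root_image_slim_space[symmetric] image_image
  using translate_at_root by (auto intro: image_eqI[OF sym])

lemma hom_part_slim_space:
  "hom_part k ` slim_space l m n \<subseteq> cpoly.span {graph_poly G | G. slim l m n G \<and> size G = k}"
  unfolding slim_space_def
proof (rule hom_part.image_span_subset, rule image_subsetI)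
  fix p assume "p \<in> {graph_poly G | G. slim l m n G}"
  then obtain G where G: "p = graph_poly G" "slim l m n G" by blast
  have "hom_part k p = (if size G = k then graph_poly G else 0)"
    by (simp add: G(1) hom_part_homogeneous[OF homogeneous_graph_poly])
  then show "hom_part k p \<in> cpoly.span {graph_poly G | G. slim l m n G \<and> size G = k}"
    using G(2) by (auto intro: cpoly.span_base cpoly.span_zero)
qed

lemma slim_component_eq_span:
  "slim_component l m n k = cpoly.span {graph_poly G | G. slim l m n G \<and> size G = k}"
  (is "_ = cpoly.span ?G")
proof (rule subset_antisym)
  show "slim_component l m n k \<subseteq> cpoly.span ?G"
  proof
    fix p assume p: "p \<in> slim_component l m n k"
    then have "hom_part k p = p" by (simp add: slim_component_def hom_part_homogeneous[of k])
    then show "p \<in> cpoly.span ?G"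
      using p hom_part_slim_space[of k l m n] by (auto simp: slim_component_def)
  qed
  have "?G \<subseteq> slim_component l m n k"
    using homogeneous_graph_poly
    by (auto simp: slim_component_def slim_space_def intro: cpoly.span_base)
  then show "cpoly.span ?G \<subseteq> slim_component l m n k"
    by (rule cpoly.span_minimal[OF _ subspace_slim_component])
qed

definition parking_degree :: "nat \<Rightarrow> nat \<Rightarrow> nat \<Rightarrow> nat \<Rightarrow> (nat \<Rightarrow>\<^sub>0 nat) set" where
  "parking_degree l m n k =
     {f. parking (complete_multigraph l m n) {1..n} f \<and> monom_degree f = k}"

theorem slim_component_eq_0I:
  assumes p: "p \<in> slim_component l m n k"
    and zero: "\<And>f. f \<in> parking_degree l m n k \<Longrightarrow> lookup p f = 0"
  shows "p = 0"
proof -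
  have "p \<in> slim_space l m n" "homogeneous k p" using p by (auto simp: slim_component_def)
  have "at_root n p = 0"
  proof (rule cut_bounded_eq_0I)
    show "cut_bounded (complete_multigraph l m n) {1..n} (at_root n p)"
      using at_root_image_slim_space \<open>p \<in> slim_space l m n\<close> by blast
    fix f assume f: "parking (complete_multigraph l m n) {1..n} f"
    then have "lookup (at_root n p) f = lookup p f" by (simp add: lookup_at_root parking_def)
    then show "lookup (at_root n p) f = 0"
      using zero[of f] f \<open>homogeneous k p\<close> by (auto simp: parking_degree_def homogeneous_iff)
  qed
  then show ?thesis using translate_at_root[OF \<open>p \<in> slim_space l m n\<close>] by simp
qed

theorem slim_component_prescribed_coeffs:
  obtains p where "p \<in> slim_component l m n k"
    "\<And>f. f \<in> parking_degree l m n k \<Longrightarrow> lookup p f = F f"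
proof -
  obtain q where q: "cut_bounded (complete_multigraph l m n) {1..n} q"
    "\<And>f. parking (complete_multigraph l m n) {1..n} f \<Longrightarrow> lookup q f = F f"
    using rooted_gens_prescribed_coeffs[of "complete_multigraph l m n" "{1..n}" F]
    unfolding span_rooted_gens_eq by blast
  define p where "p = hom_part k (translate n q)"
  have "translate n q \<in> slim_space l m n" using q(1) unfolding slim_space_eq_translate by blast
  then have "p \<in> slim_component l m n k"
    unfolding p_def slim_component_eq_span using hom_part_slim_space by blast
  moreover have "lookup p f = F f" if "f \<in> parking_degree l m n k" for f
  proof -
    have f: "parking (complete_multigraph l m n) {1..n} f" "monom_degree f = k"
      using that by (auto simp: parking_degree_def)
    then have "lookup (translate n q) f = lookup (at_root n (translate n q)) f"
      by (simp add: lookup_at_root parking_def)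
    also have "\<dots> = lookup q f" using q(1) by (simp add: at_root_translate cut_bounded_def)
    finally show ?thesis using q(2)[OF f(1)] f(2) by (simp add: p_def lookup_hom_part)
  qed
  ultimately show ?thesis using that by blast
qed


subsection \<open>Generation in degree one\<close>

lemma slim_component_eq_translate_forms:
  assumes "\<And>I. I \<subseteq> {1..n} \<Longrightarrow> I \<noteq> {} \<Longrightarrow> k < cut_size (complete_multigraph l m n) I"
  shows "slim_component l m n k = translate n ` forms {1..n} k"
proof (rule subset_antisym)
  show "slim_component l m n k \<subseteq> translate n ` forms {1..n} k"
  proof
    fix p assume "p \<in> slim_component l m n k"
    then have "p = translate n (at_root n p)" "at_root n p \<in> forms {1..n} k"
      by (auto simp: slim_component_def translate_at_root forms_def vars_in_kill_vars_Compl
          homogeneous_kill_vars)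
    then show "p \<in> translate n ` forms {1..n} k" by blast
  qed
  show "translate n ` forms {1..n} k \<subseteq> slim_component l m n k"
  proof (rule image_subsetI)
    fix q assume q: "q \<in> forms {1..n} k"
    have "cut_bounded (complete_multigraph l m n) {1..n} q"
    proof (rule cut_boundedI)
      show "vars_in {1..n} q" using q by (simp add: forms_def)
      have "degree (shift_vars I q) \<le> k" for I
        using q degree_shift_vars_homogeneous by (simp add: forms_def)
      then show "degree (shift_vars I q) < cut_size (complete_multigraph l m n) I"
        if "I \<subseteq> {1..n}" "I \<noteq> {}" for I
        using assms[OF that] order_le_less_trans by blast
    qed
    then show "translate n q \<in> slim_component l m n k"
      using q
      by (auto simp: slim_component_def slim_space_eq_translate forms_def homogeneous_translate)
  qed
qed

lemma (in monoid_mult_hom) image_products: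
  "hom ` {prod_list xs | xs. length xs = k \<and> set xs \<subseteq> S} =
    {prod_list ys | ys. length ys = k \<and> set ys \<subseteq> hom ` S}" (is "?L = ?R")
proof (rule subset_antisym)
  show "?L \<subseteq> ?R" by (force simp: hom_prod_list simp del: prod_list_map_hom)
  show "?R \<subseteq> ?L"
  proof
    fix y assume "y \<in> ?R"
    then obtain ys where ys: "y = prod_list ys" "length ys = k" "ys \<in> map hom ` lists S"
      unfolding lists_image[symmetric] by (auto simp: lists_eq_set)
    then obtain xs where "ys = map hom xs" "set xs \<subseteq> S" by (auto simp: lists_eq_set)
    then have "y = hom (prod_list xs)" "length xs = k" using ys by simp_all
    then show "y \<in> ?L" using \<open>set xs \<subseteq> S\<close> by blast
  qed
qed

theorem slim_component_eq_span_products: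
  assumes "l \<ge> 1" "m \<ge> 1" "k < n"
  shows "slim_component l m n k =
    cpoly.span {prod_list fs | fs. length fs = k \<and> set fs \<subseteq> slim_component l m n 1}"
proof -
  have translate_forms: "slim_component l m n j = translate n ` forms {1..n} j" if "j < n" for j
    using order_less_le_trans[OF that cut_size_complete_multigraph_ge[OF _ _ assms(1,2)]]
    by (rule slim_component_eq_translate_forms)
  have "translate n ` {prod_list fs | fs. length fs = k \<and> set fs \<subseteq> forms {1..n} 1} =
      {prod_list gs | gs. length gs = k \<and> set gs \<subseteq> translate n ` forms {1..n} 1}"
    by (rule translate.image_products)
  also have "\<dots> = {prod_list gs | gs. length gs = k \<and> set gs \<subseteq> slim_component l m n 1}"
  proof (cases "k = 0")
    case False
    then show ?thesis using assms(3) by (simp add: translate_forms)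
  qed auto
  finally show ?thesis
    by (simp add: translate_forms[OF assms(3)] forms_eq_span_products[of _ k]
        flip: translate.span_image)
qed


section \<open>Representations\<close>

lemma vector_space_pointwise:
  assumes "\<And>d. vector_space (s d)"
  shows "vector_space (\<lambda>c f d. s d c (f d))"
proof -
  have "s d a (x + y) = s d a x + s d a y" "s d (a + b) x = s d a x + s d b x"
    "s d a (s d b x) = s d (a * b) x" "s d 1 x = x" for d a b x y
    using assms[of d] by (auto simp: vector_space_def)
  then show ?thesis by unfold_locales (auto simp: fun_eq_iff)
qed

lemma vector_space_fun_mult: "vector_space (\<lambda>c (f :: 'x \<Rightarrow> 'k::field) g. c * f g)"
  by (rule vector_space_pointwise) (unfold_locales, auto simp: algebra_simps)

lemma vector_space_subspace_iff:
  assumes "vector_space s"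
  shows "module.subspace s S \<longleftrightarrow>
    0 \<in> S \<and> (\<forall>x\<in>S. \<forall>y\<in>S. x + y \<in> S) \<and> (\<forall>c. \<forall>x\<in>S. s c x \<in> S)"
proof -
  interpret vector_space s by fact
  show ?thesis by (rule subspace_def)
qed

lemma is_repI:
  assumes "vector_space (rep_scale R)"
    and "0 \<in> rep_space R"
    and "\<And>v w. v \<in> rep_space R \<Longrightarrow> w \<in> rep_space R \<Longrightarrow> v + w \<in> rep_space R"
    and "\<And>c v. v \<in> rep_space R \<Longrightarrow> rep_scale R c v \<in> rep_space R"
    and "\<And>g v. g \<in> carrier G \<Longrightarrow> v \<in> rep_space R \<Longrightarrow> rep_act R g v \<in> rep_space R"
    and "\<And>g v w. g \<in> carrier G \<Longrightarrow> v \<in> rep_space R \<Longrightarrow> w \<in> rep_space R \<Longrightarrow>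
      rep_act R g (v + w) = rep_act R g v + rep_act R g w"
    and "\<And>g c v. g \<in> carrier G \<Longrightarrow> v \<in> rep_space R \<Longrightarrow>
      rep_act R g (rep_scale R c v) = rep_scale R c (rep_act R g v)"
    and "\<And>v. v \<in> rep_space R \<Longrightarrow> rep_act R \<one>\<^bsub>G\<^esub> v = v"
    and "\<And>g h v. g \<in> carrier G \<Longrightarrow> h \<in> carrier G \<Longrightarrow> v \<in> rep_space R \<Longrightarrow>
      rep_act R (g \<otimes>\<^bsub>G\<^esub> h) v = rep_act R g (rep_act R h v)"
  shows "is_rep G R"
  using assms by (simp add: is_rep_def vector_space_subspace_iff)

lemma is_repD:
  assumes "is_rep G R"
  shows "vector_space (rep_scale R)"
    and "0 \<in> rep_space R"
    and "v \<in> rep_space R \<Longrightarrow> w \<in> rep_space R \<Longrightarrow> v + w \<in> rep_space R"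
    and "v \<in> rep_space R \<Longrightarrow> rep_scale R c v \<in> rep_space R"
    and "g \<in> carrier G \<Longrightarrow> v \<in> rep_space R \<Longrightarrow> rep_act R g v \<in> rep_space R"
    and "g \<in> carrier G \<Longrightarrow> v \<in> rep_space R \<Longrightarrow> w \<in> rep_space R \<Longrightarrow>
      rep_act R g (v + w) = rep_act R g v + rep_act R g w"
    and "g \<in> carrier G \<Longrightarrow> v \<in> rep_space R \<Longrightarrow>
      rep_act R g (rep_scale R c v) = rep_scale R c (rep_act R g v)"
    and "v \<in> rep_space R \<Longrightarrow> rep_act R \<one>\<^bsub>G\<^esub> v = v"
    and "g \<in> carrier G \<Longrightarrow> h \<in> carrier G \<Longrightarrow> v \<in> rep_space R \<Longrightarrow>
      rep_act R (g \<otimes>\<^bsub>G\<^esub> h) v = rep_act R g (rep_act R h v)"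
  using assms vector_space_subspace_iff[of "rep_scale R" "rep_space R"] by (auto simp: is_rep_def)

lemma is_rep_act_0:
  assumes "is_rep G R" "g \<in> carrier G"
  shows "rep_act R g 0 = 0"
  using is_repD(6)[OF assms is_repD(2) is_repD(2)] assms(1) by simp

lemma rep_isoI:
  assumes "is_rep G R" "is_rep G S" "bij_betw \<phi> (rep_space R) (rep_space S)"
    and "\<And>v w. v \<in> rep_space R \<Longrightarrow> w \<in> rep_space R \<Longrightarrow> \<phi> (v + w) = \<phi> v + \<phi> w"
    and "\<And>c v. v \<in> rep_space R \<Longrightarrow> \<phi> (rep_scale R c v) = rep_scale S c (\<phi> v)"
    and "\<And>g v. g \<in> carrier G \<Longrightarrow> v \<in> rep_space R \<Longrightarrow> \<phi> (rep_act R g v) = rep_act S g (\<phi> v)"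
  shows "rep_iso G R S"
  using assms unfolding rep_iso_def by blast

lemma rep_iso_sym:
  assumes "rep_iso G R S"
  shows "rep_iso G S R"
proof -
  obtain \<psi> where R: "is_rep G R" and S: "is_rep G S"
    and bij: "bij_betw \<psi> (rep_space R) (rep_space S)"
    and add: "\<And>v w. v \<in> rep_space R \<Longrightarrow> w \<in> rep_space R \<Longrightarrow> \<psi> (v + w) = \<psi> v + \<psi> w"
    and scale: "\<And>c v. v \<in> rep_space R \<Longrightarrow> \<psi> (rep_scale R c v) = rep_scale S c (\<psi> v)"
    and act: "\<And>g v. g \<in> carrier G \<Longrightarrow> v \<in> rep_space R \<Longrightarrow> \<psi> (rep_act R g v) = rep_act S g (\<psi> v)"
    using assms unfolding rep_iso_def by blast
  define \<phi> where "\<phi> = inv_into (rep_space R) \<psi>"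
  have \<phi>: "bij_betw \<phi> (rep_space S) (rep_space R)"
    unfolding \<phi>_def by (rule bij_betw_inv_into[OF bij])
  have in_R: "\<phi> v \<in> rep_space R" and right: "\<psi> (\<phi> v) = v" if "v \<in> rep_space S" for v
    using that bij bij_betwE[OF \<phi>] by (auto simp: \<phi>_def bij_betw_inv_into_right)
  have left: "\<phi> (\<psi> v) = v" if "v \<in> rep_space R" for v
    using that bij by (simp add: \<phi>_def bij_betw_inv_into_left)
  note R_closed = is_repD[OF R]
  show ?thesis
  proof (rule rep_isoI[OF S R \<phi>])
    show "\<phi> (v + w) = \<phi> v + \<phi> w" if "v \<in> rep_space S" "w \<in> rep_space S" for v w
      using left[of "\<phi> v + \<phi> w"] that by (simp add: add in_R right R_closed)
    show "\<phi> (rep_scale S c v) = rep_scale R c (\<phi> v)" if "v \<in> rep_space S" for c v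
      using left[of "rep_scale R c (\<phi> v)"] that by (simp add: scale in_R right R_closed)
    show "\<phi> (rep_act S g v) = rep_act R g (\<phi> v)" if "g \<in> carrier G" "v \<in> rep_space S" for g v
      using left[of "rep_act R g (\<phi> v)"] that by (simp add: act in_R right R_closed)
  qed
qed

lemma is_rep_tensor_char:
  assumes R: "is_rep G R" and "\<chi> \<one>\<^bsub>G\<^esub> = 1"
    and "\<And>g h. g \<in> carrier G \<Longrightarrow> h \<in> carrier G \<Longrightarrow> \<chi> (g \<otimes>\<^bsub>G\<^esub> h) = \<chi> g * \<chi> h"
  shows "is_rep G (tensor_char R \<chi>)"
proof -
  interpret vector_space "rep_scale R" by (rule is_repD(1)[OF R])
  show ?thesis
    using assms unfolding is_rep_def
    by (auto simp: tensor_char_def scale_right_distrib subspace_scale mult.commute)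
qed

lemma is_rep_induced_char:
  assumes "group G" "H \<subseteq> carrier G"
  shows "is_rep G (induced_rep G H (char_rep \<chi>))"
proof -
  interpret group G by fact
  have "h \<otimes>\<^bsub>G\<^esub> g \<in> carrier G" if "h \<in> H" "g \<in> carrier G" for h g
    using that assms by auto
  then show ?thesis
    unfolding is_rep_def using assms(2)
    by (auto simp: induced_rep_def char_rep_def vector_space_fun_mult vector_space_subspace_iff
        fun_eq_iff algebra_simps m_assoc subset_iff)
qed

lemma is_rep_direct_sum:
  assumes vs: "\<And>d. vector_space (rep_scale (R d))" and rep: "\<And>d. d \<in> I \<Longrightarrow> is_rep G (R d)"
  shows "is_rep G (direct_sum_rep I R)"
proof -
  let ?S = "direct_sum_rep I R"
  note D = is_repD[OF rep]
  have scale_0: "rep_scale (R d) c 0 = 0" for d c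
    by (rule module.scale_zero_right) (use vs in \<open>simp add: module_iff_vector_space\<close>)
  have fin_add: "finite {d. (v + w) d \<noteq> 0}" if "v \<in> rep_space ?S" "w \<in> rep_space ?S" for v w
  proof (rule finite_subset)
    show "finite ({d. v d \<noteq> 0} \<union> {d. w d \<noteq> 0})" using that by (simp add: direct_sum_rep_def)
  qed auto
  have fin_scale: "finite {d. rep_scale (R d) c (v d) \<noteq> 0}" if "v \<in> rep_space ?S" for c v
  proof (rule finite_subset)
    show "finite {d. v d \<noteq> 0}" using that by (simp add: direct_sum_rep_def)
  qed (auto simp: scale_0)
  have fin_act: "finite {d. (if d \<in> I then rep_act (R d) g (v d) else 0) \<noteq> 0}"
    if "g \<in> carrier G" "v \<in> rep_space ?S" for g v
  proof (rule finite_subset)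
    show "finite {d. v d \<noteq> 0}" using that by (simp add: direct_sum_rep_def)
  qed (use is_rep_act_0[OF rep that(1)] in auto)
  show ?thesis
  proof (rule is_repI)
    show "vector_space (rep_scale ?S)"
      using vector_space_pointwise[of "\<lambda>d. rep_scale (R d)", OF vs]
      by (simp add: direct_sum_rep_def)
    show "0 \<in> rep_space ?S" using D(2) by (auto simp: direct_sum_rep_def)
    show "v + w \<in> rep_space ?S" if "v \<in> rep_space ?S" "w \<in> rep_space ?S" for v w
      using that fin_add[OF that] D(3) by (auto simp: direct_sum_rep_def)
    show "rep_scale ?S c v \<in> rep_space ?S" if "v \<in> rep_space ?S" for c v
      using that fin_scale[OF that] D(4) by (auto simp: direct_sum_rep_def scale_0)
    show "rep_act ?S g v \<in> rep_space ?S" if "g \<in> carrier G" "v \<in> rep_space ?S" for g v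
      using that fin_act[OF that] D(5) by (auto simp: direct_sum_rep_def)
  qed (auto simp: direct_sum_rep_def fun_eq_iff D scale_0)
qed

lemma mem_direct_sum_induced_char:
  assumes "finite I"
  shows "T \<in> rep_space (direct_sum_rep I (\<lambda>d. induced_rep G (H d) (char_rep (\<chi> d)))) \<longleftrightarrow>
    (\<forall>d\<in>I. \<forall>h\<in>H d. \<forall>g\<in>carrier G. T d (h \<otimes>\<^bsub>G\<^esub> g) = \<chi> d h * T d g) \<and>
    (\<forall>d g. \<not> (d \<in> I \<and> g \<in> carrier G) \<longrightarrow> T d g = 0)"
proof -
  have "finite {d. T d \<noteq> 0}" if "\<forall>d. d \<notin> I \<longrightarrow> T d = 0"
    by (rule finite_subset[OF _ assms]) (use that in blast)
  then show ?thesis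
    by (auto simp: direct_sum_rep_def induced_rep_def char_rep_def fun_eq_iff)
qed

text \<open>Frobenius reciprocity turns the functionals \<open>\<epsilon> d\<close> into the map \<open>v \<mapsto> (\<lambda>d g. \<epsilon> d (g v))\<close>.\<close>

context
  fixes G :: "('g, 'b) monoid_scheme" and R :: "('g, 'v::ab_group_add) crep" and I :: "'d set"
    and H :: "'d \<Rightarrow> 'g set" and \<chi> :: "'d \<Rightarrow> 'g \<Rightarrow> complex" and \<epsilon> :: "'d \<Rightarrow> 'v \<Rightarrow> complex"
  assumes G: "group G" and R: "is_rep G R" and I: "finite I"
    and H: "\<And>d. d \<in> I \<Longrightarrow> H d \<subseteq> carrier G"
    and add: "\<And>d v w. \<epsilon> d (v + w) = \<epsilon> d v + \<epsilon> d w"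
    and scale: "\<And>d c v. \<epsilon> d (rep_scale R c v) = c * \<epsilon> d v"
    and equivariant: "\<And>d h v. d \<in> I \<Longrightarrow> h \<in> H d \<Longrightarrow> v \<in> rep_space R \<Longrightarrow>
      \<epsilon> d (rep_act R h v) = \<chi> d h * \<epsilon> d v"
begin

abbreviation induced_sum :: "('g, 'd \<Rightarrow> 'g \<Rightarrow> complex) crep" where
  "induced_sum \<equiv> direct_sum_rep I (\<lambda>d. induced_rep G (H d) (char_rep (\<chi> d)))"

definition frobenius_map :: "'v \<Rightarrow> 'd \<Rightarrow> 'g \<Rightarrow> complex" where
  "frobenius_map v = (\<lambda>d g. if d \<in> I \<and> g \<in> carrier G then \<epsilon> d (rep_act R g v) else 0)"

lemma is_rep_induced_sum: "is_rep G induced_sum"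
proof (rule is_rep_direct_sum)
  show "vector_space (rep_scale (induced_rep G (H d) (char_rep (\<chi> d))))" for d
    by (simp add: induced_rep_def char_rep_def vector_space_fun_mult)
qed (rule is_rep_induced_char[OF G H])

lemma frobenius_map_add:
  "v \<in> rep_space R \<Longrightarrow> w \<in> rep_space R \<Longrightarrow>
    frobenius_map (v + w) = frobenius_map v + frobenius_map w"
  by (auto simp: frobenius_map_def fun_eq_iff is_repD(6)[OF R] add)

lemma frobenius_map_scale:
  "v \<in> rep_space R \<Longrightarrow> frobenius_map (rep_scale R c v) = rep_scale induced_sum c (frobenius_map v)"
  by (auto simp: frobenius_map_def fun_eq_iff is_repD(7)[OF R] scale direct_sum_rep_def
      induced_rep_def char_rep_def)

lemma frobenius_map_act:
  assumes "x \<in> carrier G" "v \<in> rep_space R"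
  shows "frobenius_map (rep_act R x v) = rep_act induced_sum x (frobenius_map v)"
proof -
  interpret group G by (rule G)
  show ?thesis
    using assms by (auto simp: frobenius_map_def fun_eq_iff is_repD(9)[OF R] direct_sum_rep_def
        induced_rep_def)
qed

lemma frobenius_map_in_induced_sum:
  assumes v: "v \<in> rep_space R"
  shows "frobenius_map v \<in> rep_space induced_sum"
proof -
  interpret group G by (rule G)
  have "frobenius_map v d (h \<otimes>\<^bsub>G\<^esub> g) = \<chi> d h * frobenius_map v d g"
    if "d \<in> I" "h \<in> H d" "g \<in> carrier G" for d h g
    using that v H[OF that(1)] is_repD[OF R] equivariant
    by (auto simp: frobenius_map_def subset_iff)
  then show ?thesis
    unfolding mem_direct_sum_induced_char[OF I] by (auto simp: frobenius_map_def)
qed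

lemma inj_on_frobenius_map:
  assumes separating: "\<And>v. v \<in> rep_space R \<Longrightarrow>
    (\<And>d g. d \<in> I \<Longrightarrow> g \<in> carrier G \<Longrightarrow> \<epsilon> d (rep_act R g v) = 0) \<Longrightarrow> v = 0"
  shows "inj_on frobenius_map (rep_space R)"
proof (rule inj_onI)
  interpret vector_space "rep_scale R" by (rule is_repD(1)[OF R])
  fix v w assume vw: "v \<in> rep_space R" "w \<in> rep_space R" "frobenius_map v = frobenius_map w"
  have "v - w = v + rep_scale R (- 1) w" by simp
  then have diff: "v - w \<in> rep_space R" using vw is_repD(3,4)[OF R] by metis
  have "\<epsilon> d (rep_act R g (v - w)) = 0" if "d \<in> I" "g \<in> carrier G" for d g
  proof -
    have "frobenius_map v d g = frobenius_map (v - w) d g + frobenius_map w d g"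
      using frobenius_map_add[OF diff vw(2)] by simp
    then have "frobenius_map (v - w) d g = 0" using vw(3) by simp
    then show ?thesis using that by (simp add: frobenius_map_def)
  qed
  with diff have "v - w = 0" by (rule separating)
  then show "v = w" by simp
qed

theorem rep_iso_direct_sum_induced_char:
  assumes separating: "\<And>v. v \<in> rep_space R \<Longrightarrow>
      (\<And>d g. d \<in> I \<Longrightarrow> g \<in> carrier G \<Longrightarrow> \<epsilon> d (rep_act R g v) = 0) \<Longrightarrow> v = 0"
    and interpolating: "\<And>T. T \<in> rep_space induced_sum \<Longrightarrow>
      \<exists>v\<in>rep_space R. \<forall>d\<in>I. \<forall>g\<in>carrier G. \<epsilon> d (rep_act R g v) = T d g"
  shows "rep_iso G R induced_sum"
proof (rule rep_isoI[OF R is_rep_induced_sum _ frobenius_map_add frobenius_map_scale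
      frobenius_map_act])
  have "T \<in> frobenius_map ` rep_space R" if T: "T \<in> rep_space induced_sum" for T
  proof -
    obtain v where "v \<in> rep_space R" "\<forall>d\<in>I. \<forall>g\<in>carrier G. \<epsilon> d (rep_act R g v) = T d g"
      using interpolating[OF T] by blast
    moreover from this have "frobenius_map v = T"
      using T unfolding mem_direct_sum_induced_char[OF I]
      by (auto simp: frobenius_map_def fun_eq_iff)
    ultimately show ?thesis by blast
  qed
  then show "bij_betw frobenius_map (rep_space R) (rep_space induced_sum)"
    using inj_on_frobenius_map[OF separating] frobenius_map_in_induced_sum
    by (auto simp: bij_betw_def)
qed

end


section \<open>Symmetry of the slim space\<close>

definition permute_edge :: "('v \<Rightarrow> 'w::linorder) \<Rightarrow> 'v \<times> 'v \<Rightarrow> 'w \<times> 'w" where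
  "permute_edge \<sigma> e = (min (\<sigma> (fst e)) (\<sigma> (snd e)), max (\<sigma> (fst e)) (\<sigma> (snd e)))"

lemma graph_poly_permute_edges:
  "graph_poly (image_mset (permute_edge \<sigma>) G) \<in>
    {permute_vars \<sigma> (graph_poly G), - permute_vars \<sigma> (graph_poly G)}"
proof (induction G)
  case (add e G)
  have "pvar (fst (permute_edge \<sigma> e)) - pvar (snd (permute_edge \<sigma> e)) \<in>
    {permute_vars \<sigma> (pvar (fst e) - pvar (snd e)), - permute_vars \<sigma> (pvar (fst e) - pvar (snd e))}"
    by (auto simp: permute_edge_def permute_vars.hom_minus permute_vars_pvar min_def max_def)
  with add show ?case
    by (auto simp: graph_poly_add_mset permute_vars.hom_mult)
qed simp

lemma permute_edge_bij:
  assumes \<sigma>: "\<sigma> permutes {1..n + 1}"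
  shows "bij_betw (permute_edge \<sigma>) (all_edges n) (all_edges n)"
proof -
  have inj: "inj \<sigma>" using permutes_inj[OF \<sigma>] .
  have "inj_on (permute_edge \<sigma>) (all_edges n)"
  proof (rule inj_onI)
    fix e e' assume ee': "e \<in> all_edges n" "e' \<in> all_edges n" "permute_edge \<sigma> e = permute_edge \<sigma> e'"
    obtain a b a' b' where e: "e = (a, b)" "e' = (a', b')" by (cases e, cases e')
    have "a < b" "a' < b'" using ee' by (auto simp: e mem_all_edges)
    moreover have "\<sigma> a = \<sigma> a' \<and> \<sigma> b = \<sigma> b' \<or> \<sigma> a = \<sigma> b' \<and> \<sigma> b = \<sigma> a'"
      using ee'(3) by (auto simp: e permute_edge_def min_def max_def split: if_splits)
    ultimately show "e = e'" using inj by (auto simp: e inj_eq)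
  qed
  moreover have "permute_edge \<sigma> ` all_edges n \<subseteq> all_edges n"
  proof (rule image_subsetI)
    fix e assume "e \<in> all_edges n"
    moreover obtain a b where e: "e = (a, b)" by (cases e)
    ultimately have "a \<in> {1..n + 1}" "b \<in> {1..n + 1}" "a \<noteq> b" by (auto simp: mem_all_edges)
    then have "\<sigma> a \<in> {1..n + 1}" "\<sigma> b \<in> {1..n + 1}" "\<sigma> a \<noteq> \<sigma> b"
      using permutes_in_image[OF \<sigma>] inj by (auto simp: inj_eq)
    then show "permute_edge \<sigma> e \<in> all_edges n" by (auto simp: e permute_edge_def mem_all_edges)
  qed
  ultimately show ?thesis
    using endo_inj_surj[OF finite_all_edges] by (simp add: bij_betw_def)
qed

lemma edge_mult_permute_edge:
  assumes \<sigma>: "\<sigma> permutes {1..n + 1}" and lm: "\<sigma> permutes {1..n} \<or> l = m" and e: "e \<in> all_edges n"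
  shows "edge_mult l m n (permute_edge \<sigma> e) = edge_mult l m n e"
proof (cases "l = m")
  case False
  then have "\<sigma> permutes {1..n}" using lm by simp
  then have "\<sigma> (n + 1) = n + 1" by (rule permutes_not_in) simp
  then have last: "\<sigma> i = n + 1 \<longleftrightarrow> i = n + 1" for i
    using permutes_inj[OF \<sigma>] by (metis injD)
  obtain a b where ab: "e = (a, b)" by (cases e)
  have "\<sigma> i \<le> n + 1" if "i \<in> {1..n + 1}" for i
    using permutes_in_image[OF \<sigma>, of i] that by auto
  then have "\<sigma> a \<le> n + 1" "\<sigma> b \<le> n + 1" "a \<noteq> n + 1"
    using e by (auto simp: ab mem_all_edges)
  then show ?thesis
    using last[of a] last[of b] by (auto simp: ab edge_mult_def permute_edge_def max_def)
qed (simp add: edge_mult_def)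

lemma complete_multigraph_permute:
  assumes \<sigma>: "\<sigma> permutes {1..n + 1}" and lm: "\<sigma> permutes {1..n} \<or> l = m"
  shows "image_mset (permute_edge \<sigma>) (complete_multigraph l m n) = complete_multigraph l m n"
proof -
  have "image_mset (permute_edge \<sigma>) (\<Sum>e\<in>A. replicate_mset (w e) e) =
      (\<Sum>e\<in>A. replicate_mset (w e) (permute_edge \<sigma> e))" if "finite A" for A w
    using that by induction auto
  then have "image_mset (permute_edge \<sigma>) (complete_multigraph l m n) =
      (\<Sum>e\<in>all_edges n. replicate_mset (edge_mult l m n e) (permute_edge \<sigma> e))"
    by (simp add: complete_multigraph_eq_sum_all_edges)
  also have "\<dots> = (\<Sum>e\<in>all_edges n.
      replicate_mset (edge_mult l m n (permute_edge \<sigma> e)) (permute_edge \<sigma> e))"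
    by (simp add: edge_mult_permute_edge[OF assms])
  also have "\<dots> = complete_multigraph l m n"
    unfolding complete_multigraph_eq_sum_all_edges
    by (rule sum.reindex_bij_betw[OF permute_edge_bij[OF \<sigma>]])
  finally show ?thesis .
qed

lemma connected_multigraph_permute:
  assumes \<sigma>: "\<sigma> permutes U" and connected: "connected_multigraph U E"
  shows "connected_multigraph U (image_mset (permute_edge \<sigma>) E)"
proof -
  have edge: "(\<sigma> u, \<sigma> v) \<in> reachable (image_mset (permute_edge \<sigma>) E)" if "(u, v) \<in># E" for u v
  proof -
    have "permute_edge \<sigma> (u, v) \<in># image_mset (permute_edge \<sigma>) E" using that by auto
    then show ?thesis
      by (intro reachable_edge) (auto simp: permute_edge_def min_def max_def split: if_splits)
  qed
  show ?thesis
    unfolding connected_multigraph_iff_reachable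
  proof (intro ballI)
    fix u v assume "u \<in> U" "v \<in> U"
    then obtain a b where "a \<in> U" "b \<in> U" "u = \<sigma> a" "v = \<sigma> b"
      using permutes_image[OF \<sigma>] by (metis imageE)
    moreover from this have "(a, b) \<in> reachable E"
      using connected by (simp add: connected_multigraph_iff_reachable)
    ultimately show "(u, v) \<in> reachable (image_mset (permute_edge \<sigma>) E)"
      using reachable_map[OF edge] by simp
  qed
qed

lemma permute_vars_slim_space:
  assumes \<sigma>: "\<sigma> permutes {1..n + 1}" and lm: "\<sigma> permutes {1..n} \<or> l = m"
  shows "permute_vars \<sigma> ` slim_space l m n \<subseteq> slim_space l m n"
  unfolding slim_space_def
proof (rule permute_vars.image_span_subset, rule image_subsetI)
  fix p assume "p \<in> {graph_poly G | G. slim l m n G}"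
  then obtain G where G: "p = graph_poly G" "slim l m n G" by auto
  have "slim l m n (image_mset (permute_edge \<sigma>) G)"
    using G(2) complete_multigraph_permute[OF \<sigma> lm]
      connected_multigraph_permute[OF \<sigma>, of "complete_multigraph l m n - G"]
      image_mset_subseteq_mono[of G "complete_multigraph l m n" "permute_edge \<sigma>"]
    by (simp add: slim_def image_mset_Diff)
  then have "graph_poly (image_mset (permute_edge \<sigma>) G) \<in>
      cpoly.span {graph_poly G | G. slim l m n G}"
    by (intro cpoly.span_base) auto
  then show "permute_vars \<sigma> p \<in> cpoly.span {graph_poly G | G. slim l m n G}"
    using graph_poly_permute_edges[of \<sigma> G] cpoly.span_neg by (fastforce simp: G(1))
qed

lemma permute_vars_slim_component:
  assumes "\<sigma> permutes {1..n + 1}" "\<sigma> permutes {1..n} \<or> l = m" "p \<in> slim_component l m n k"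
  shows "permute_vars \<sigma> p \<in> slim_component l m n k"
  using permute_vars_slim_space[OF assms(1,2)] assms(3)
  by (auto simp: slim_component_def homogeneous_permute_vars)

lemma permutes_Suc_range: "(\<sigma> :: nat \<Rightarrow> nat) permutes {1..n} \<Longrightarrow> \<sigma> permutes {1..n + 1}"
  by (erule permutes_subset) auto

lemma is_rep_slim_rep:
  assumes "r = n \<or> r = n + 1 \<and> l = m"
  shows "is_rep (sym_group r) (slim_rep l m n k)"
proof -
  have "permute_vars \<sigma> p \<in> slim_component l m n k"
    if "\<sigma> permutes {1..r}" "p \<in> slim_component l m n k" for \<sigma> p
    using that assms permutes_Suc_range[of \<sigma> n] by (auto intro!: permute_vars_slim_component)
  then show ?thesis
    using subspace_slim_component[of l m n k]
    by (simp add: is_rep_def slim_rep_def cpoly.vector_space_axioms sym_group_carrier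
        sym_group_mult sym_group_one permute_vars.hom_add permute_vars.scale permute_vars_id
        permute_vars_compose)
qed


section \<open>The reflection representation\<close>

lemma is_rep_reflection_rep: "is_rep (sym_group N) (reflection_rep N)"
proof -
  have inv: "inv' \<sigma> permutes {1..N}" if "\<sigma> permutes {1..N}" for \<sigma>
    using that by (rule permutes_inv)
  have sum: "(\<Sum>i\<in>{1..N}. v (inv' \<sigma> i)) = (\<Sum>i\<in>{1..N}. v i)"
    if "\<sigma> permutes {1..N}" for \<sigma> and v :: "nat \<Rightarrow> complex"
    using sum.permute[OF inv[OF that], of v] by (simp add: comp_def)
  have notin: "inv' \<sigma> i \<notin> {1..N}" if "\<sigma> permutes {1..N}" "i \<notin> {1..N}" for \<sigma> i
    using permutes_in_image[OF inv[OF that(1)]] that(2) by blast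
  have inv_comp: "inv' (g \<circ> h) i = inv' h (inv' g i)"
    if "g permutes {1..N}" "h permutes {1..N}" for g h i
    using that by (simp add: o_inv_distrib permutes_bij)
  show ?thesis
    unfolding is_rep_def
    using sum notin
    by (auto simp: reflection_rep_def sym_group_carrier sym_group_mult sym_group_one
        vector_space_fun_mult vector_space_subspace_iff sum.distrib fun_eq_iff inv_comp inv_id
        simp flip: sum_distrib_left simp del: atLeastAtMost_iff)
qed

lemma linear_form_add: "linear_form A (v + w) = linear_form A v + linear_form A w"
  by (simp add: linear_form_def cpoly.scale_left_distrib sum.distrib)

lemma linear_form_scale: "linear_form A (\<lambda>i. c * v i) = pscale c (linear_form A v)"
  by (simp add: linear_form_def cpoly.scale_sum_right)

lemma linear_form_cong: "(\<And>i. i \<in> A \<Longrightarrow> v i = w i) \<Longrightarrow> linear_form A v = linear_form A w"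
  by (simp add: linear_form_def)

lemma linear_form_permute:
  assumes \<sigma>: "\<sigma> permutes A"
  shows "linear_form A (\<lambda>i. v (inv' \<sigma> i)) = permute_vars \<sigma> (linear_form A v)"
proof -
  have "linear_form A (\<lambda>i. v (inv' \<sigma> i)) = (\<Sum>i\<in>A. pscale (v (inv' \<sigma> (\<sigma> i))) (pvar (\<sigma> i)))"
    unfolding linear_form_def using sum.permute[OF \<sigma>, of "\<lambda>i. pscale (v (inv' \<sigma> i)) (pvar i)"]
    by (simp add: comp_def)
  then show ?thesis
    by (simp add: linear_form_def permute_vars.hom_sum permute_vars.scale permute_vars_pvar
        permutes_inverses[OF \<sigma>])
qed

lemma inj_on_linear_form_reflection: "inj_on (linear_form {1..N}) (rep_space (reflection_rep N))"
proof (rule inj_onI, rule ext)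
  fix v w i assume v: "v \<in> rep_space (reflection_rep N)" and w: "w \<in> rep_space (reflection_rep N)"
    and eq: "linear_form {1..N} v = linear_form {1..N} w"
  show "v i = w i"
  proof (cases "i \<in> {1..N}")
    case True
    then show ?thesis
      using eq lookup_linear_form[of "{1..N}" v i] lookup_linear_form[of "{1..N}" w i] by simp
  next
    case False
    then have "v i = 0" "w i = 0" using v w unfolding reflection_rep_def by simp_all
    then show ?thesis by simp
  qed
qed

lemma translate_linear_form:
  assumes "(\<Sum>i\<in>{1..n + 1}. v i) = 0"
  shows "translate n (linear_form {1..n} v) = linear_form {1..n + 1} v"
proof -
  have last: "{1..n + 1} = insert (n + 1) {1..n}" by auto
  have "v (n + 1) = - (\<Sum>i\<in>{1..n}. v i)"
    using assms unfolding last by (simp add: eq_neg_iff_add_eq_0)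
  then show ?thesis
    unfolding linear_form_def last
    by (simp add: translate.hom_sum translate.scale translate_pvar cpoly.scale_right_diff_distrib
        sum_subtractf cpoly.scale_sum_left)
qed

lemma translate_forms_1:
  "translate n ` forms {1..n} 1 = linear_form {1..n + 1} ` rep_space (reflection_rep (n + 1))"
proof (rule subset_antisym; rule image_subsetI)
  have last: "{1..n + 1} = insert (n + 1) {1..n}" by auto
  fix q assume "q \<in> forms {1..n} 1"
  then have q: "q = linear_form {1..n} (\<lambda>i. lookup q (single i 1))"
    by (simp add: forms_1_eq_linear_form)
  define v where "v i = (if i \<in> {1..n} then lookup q (single i 1)
    else if i = n + 1 then - (\<Sum>j\<in>{1..n}. lookup q (single j 1)) else 0)" for i
  have "(\<Sum>i\<in>{1..n}. v i) = (\<Sum>j\<in>{1..n}. lookup q (single j 1))"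
    by (intro sum.cong) (auto simp: v_def)
  then have "(\<Sum>i\<in>{1..n + 1}. v i) = 0" unfolding last by (simp add: v_def)
  moreover have "q = linear_form {1..n} v"
    by (subst q, rule linear_form_cong) (simp add: v_def)
  ultimately have "translate n q = linear_form {1..n + 1} v" by (simp add: translate_linear_form)
  moreover have "v \<in> rep_space (reflection_rep (n + 1))"
    using \<open>(\<Sum>i\<in>{1..n + 1}. v i) = 0\<close> by (auto simp: reflection_rep_def v_def)
  ultimately show "translate n q \<in> linear_form {1..n + 1} ` rep_space (reflection_rep (n + 1))"
    by blast
next
  fix v assume "v \<in> rep_space (reflection_rep (n + 1))"
  then have "linear_form {1..n + 1} v = translate n (linear_form {1..n} v)"
    by (simp add: reflection_rep_def translate_linear_form)
  then show "linear_form {1..n + 1} v \<in> translate n ` forms {1..n} 1"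
    using linear_form_in_forms by blast
qed

theorem slim_component_1_reflection:
  assumes "l \<ge> 1" "n \<ge> 1" "\<not> (l = 1 \<and> n = 1)"
  shows "rep_iso (sym_group (n + 1)) (slim_rep l l n 1) (reflection_rep (n + 1))"
proof (rule rep_iso_sym, rule rep_isoI[where \<phi> = "linear_form {1..n + 1}"])
  show "is_rep (sym_group (n + 1)) (reflection_rep (n + 1))" by (rule is_rep_reflection_rep)
  show "is_rep (sym_group (n + 1)) (slim_rep l l n 1)" by (rule is_rep_slim_rep) simp
  have "1 < cut_size (complete_multigraph l l n) I" if I: "I \<subseteq> {1..n}" "I \<noteq> {}" for I
  proof (cases "n = 1")
    case True
    then have "I = {1}" using I by auto
    then show ?thesis using assms True cut_size_complete_multigraph[OF I(1), of l l] by simp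
  next
    case False
    then show ?thesis using cut_size_complete_multigraph_ge[OF I assms(1,1)] assms(2) by simp
  qed
  then have "slim_component l l n 1 = translate n ` forms {1..n} 1"
    by (rule slim_component_eq_translate_forms)
  then show "bij_betw (linear_form {1..n + 1}) (rep_space (reflection_rep (n + 1)))
      (rep_space (slim_rep l l n 1))"
    by (simp add: bij_betw_def inj_on_linear_form_reflection translate_forms_1 slim_rep_def)
qed (auto simp: linear_form_add linear_form_scale linear_form_permute reflection_rep_def
    slim_rep_def sym_group_carrier)


section \<open>Dyck paths as ballot sequences\<close>

fun rows :: "nat \<Rightarrow> step list \<Rightarrow> nat list" where
  "rows h [] = []"
| "rows h (Horiz # D) = rows (Suc h) D"
| "rows h (Vert # D) = h # rows h D"

definition ballot :: "nat \<Rightarrow> nat \<Rightarrow> nat list \<Rightarrow> bool" where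
  "ballot l m as \<longleftrightarrow> sorted as \<and> (\<forall>j<length as. as ! j \<le> l - 1 + m * j)"

lemma rows_eq_filter:
  "map (\<lambda>i. h + count_list (take i D) Horiz) (filter (\<lambda>i. D ! i = Vert) [0..<length D]) = rows h D"
proof (induction D arbitrary: h)
  case (Cons s D)
  have "[0..<length (s # D)] = 0 # map Suc [0..<length D]"
    by (simp add: upt_conv_Cons map_Suc_upt del: upt_Suc)
  then show ?case
    using Cons[of h] Cons[of "Suc h"] by (cases s) (simp_all add: filter_map comp_def One_nat_def)
qed simp

lemma area_eq_sum_rows: "area l D = sum_list (rows 0 D)"
proof -
  have "nat (int l - 1 + fst (path_point l D i)) = 0 + count_list (take i D) Horiz" for i
    by (simp add: path_point_def)
  then have "area_partition l D = rev (rows 0 D)"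
    unfolding area_partition_def by (simp add: rows_eq_filter[of 0, simplified])
  then show ?thesis by (simp add: area_def)
qed

lemma length_rows: "length (rows h D) = count_list D Vert"
  by (induction h D rule: rows.induct) auto

lemma rows_bounds: "x \<in> set (rows h D) \<Longrightarrow> h \<le> x \<and> x \<le> h + count_list D Horiz"
  by (induction h D rule: rows.induct) auto

lemma sorted_rows: "sorted (rows h D)"
  by (induction h D rule: rows.induct) (auto dest: rows_bounds)

lemma all_le_length_Cons:
  "(\<forall>i\<le>length (s # D). P i) \<longleftrightarrow> P 0 \<and> (\<forall>i\<le>length D. P (Suc i))"
  by (metis (no_types, lifting) Suc_le_mono length_Cons le0 not0_implies_Suc)

text \<open>
  It suffices to test the path in front of its vertical steps: a run of horizontal steps ends
  there or at the last point, which satisfies the bound by assumption.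
\<close>

lemma path_bounded_iff_rows_bounded:
  assumes "h + count_list D Horiz = c + m * (v + count_list D Vert)"
  shows "(\<forall>i\<le>length D.
      h + count_list (take i D) Horiz \<le> c + m * (v + count_list (take i D) Vert)) \<longleftrightarrow>
    (\<forall>j<length (rows h D). rows h D ! j \<le> c + m * (v + j))"
  using assms
proof (induction h D arbitrary: v rule: rows.induct)
  case (2 h D)
  show ?case
    unfolding all_le_length_Cons using 2(1)[of v] 2(2) by (auto dest: spec[of _ 0])
next
  case (3 h D)
  have rows: "(\<forall>j<length (rows h (Vert # D)). P j) \<longleftrightarrow> P 0 \<and> (\<forall>j<length (rows h D). P (Suc j))"
    for P
    by (simp add: All_less_Suc2)
  show ?case
    unfolding all_le_length_Cons rows using 3(1)[of "Suc v"] 3(2) by (simp add: One_nat_def)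
qed simp

lemma dyck_path_iff_ballot:
  assumes "l \<ge> 1" "m \<ge> 1"
  shows "dyck_path l m n D \<longleftrightarrow>
    count_list D Horiz = l - 1 + m * n \<and> count_list D Vert = n \<and> ballot l m (rows 0 D)"
proof -
  have end_iff: "path_point l D (length D) = (int (m * n), int n) \<longleftrightarrow>
      count_list D Horiz = l - 1 + m * n \<and> count_list D Vert = n"
  proof -
    have "int (l - 1 + m * n) = int l - 1 + int (m * n)" using assms by (simp add: of_nat_diff)
    then have "path_point l D (length D) = (int (m * n), int n) \<longleftrightarrow>
        int (count_list D Horiz) = int (l - 1 + m * n) \<and> int (count_list D Vert) = int n"
      by (auto simp: path_point_def)
    then show ?thesis by (simp only: of_nat_eq_iff)
  qed
  have line_iff:
    "real_of_int (snd (path_point l D i)) \<ge> real_of_int (fst (path_point l D i)) / real m \<longleftrightarrow>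
      0 + count_list (take i D) Horiz \<le> l - 1 + m * (0 + count_list (take i D) Vert)" for i
  proof -
    have "real_of_int (snd (path_point l D i)) \<ge> real_of_int (fst (path_point l D i)) / real m \<longleftrightarrow>
        real_of_int (fst (path_point l D i)) \<le> real m * real_of_int (snd (path_point l D i))"
      using assms by (simp add: divide_le_eq mult.commute)
    also have "\<dots> \<longleftrightarrow> fst (path_point l D i) \<le> int m * snd (path_point l D i)"
      by (metis of_int_le_iff of_int_mult of_int_of_nat_eq)
    also have "\<dots> \<longleftrightarrow>
        int (count_list (take i D) Horiz) \<le> int (l - 1 + m * count_list (take i D) Vert)"
      using assms by (simp add: path_point_def of_nat_diff algebra_simps)
    finally show ?thesis by (simp only: of_nat_le_iff add_0)
  qed
  show ?thesis
    unfolding dyck_path_def end_iff line_iff ballot_def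
    using path_bounded_iff_rows_bounded[of 0 D "l - 1" m 0] by (auto simp: length_rows sorted_rows)
qed

lemma rows_inject:
  "rows h D = rows h D' \<Longrightarrow> count_list D Horiz = count_list D' Horiz \<Longrightarrow> D = D'"
proof (induction h D arbitrary: D' rule: rows.induct)
  case (1 h)
  then show ?case by (cases "(h, D')" rule: rows.cases) (auto split: if_splits)
next
  case (2 h D)
  then show ?case
  proof (cases "(h, D')" rule: rows.cases)
    case (3 h' D'')
    then have "h \<in> set (rows (Suc h) D)" using 2 by auto
    then show ?thesis using rows_bounds[of h "Suc h" D] by auto
  qed (auto split: if_splits)
next
  case (3 h D)
  then show ?case
  proof (cases "(h, D')" rule: rows.cases)
    case (2 h' D'')
    then have "h \<in> set (rows (Suc h) D'')"
      using 3(2) by (metis Pair_inject list.set_intros(1) rows.simps(2,3))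
    then show ?thesis using rows_bounds[of h "Suc h" D''] by auto
  qed (auto split: if_splits)
qed

lemma rows_replicate_Horiz: "rows h (replicate k Horiz @ D) = rows (h + k) D"
  by (induction k arbitrary: h) auto

lemma rows_replicate_Vert: "rows h (replicate k Vert @ D) = replicate k h @ rows h D"
  by (induction k) auto

lemma count_list_replicate: "count_list (replicate k x) y = (if x = y then k else 0)"
  by (induction k) auto

lemma rows_surj:
  assumes "sorted as" "\<And>x. x \<in> set as \<Longrightarrow> h \<le> x \<and> x \<le> H" "h \<le> H"
  shows "\<exists>D. rows h D = as \<and> h + count_list D Horiz = H"
  using assms
proof (induction as arbitrary: h)
  case Nil
  then show ?case
    using rows_replicate_Horiz[of h "H - h" "[]"]
    by (intro exI[of _ "replicate (H - h) Horiz"]) (simp add: count_list_replicate)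
next
  case (Cons a as)
  have a: "h \<le> a" "a \<le> H" using Cons.prems(2)[of a] by auto
  have "\<exists>D. rows a D = as \<and> a + count_list D Horiz = H"
    using Cons.prems a by (intro Cons.IH) auto
  then obtain D where D: "rows a D = as" "a + count_list D Horiz = H" by auto
  then show ?case
    using a rows_replicate_Horiz[of h "a - h" "Vert # D"]
    by (intro exI[of _ "replicate (a - h) Horiz @ Vert # D"]) (simp add: count_list_replicate)
qed

lemma bij_betw_rows:
  assumes "l \<ge> 1" "m \<ge> 1"
  shows "bij_betw (rows 0) {D. dyck_path l m n D} {as. length as = n \<and> ballot l m as}"
  unfolding bij_betw_def
proof (intro conjI subset_antisym image_subsetI subsetI)
  show "inj_on (rows 0) {D. dyck_path l m n D}"
    by (auto intro!: inj_onI rows_inject simp: dyck_path_iff_ballot[OF assms])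
  show "rows 0 D \<in> {as. length as = n \<and> ballot l m as}" if "D \<in> {D. dyck_path l m n D}" for D
    using that by (simp add: dyck_path_iff_ballot[OF assms] length_rows)
next
  fix as assume as: "as \<in> {as. length as = n \<and> ballot l m as}"
  have "x \<le> l - 1 + m * n" if x: "x \<in> set as" for x
  proof -
    obtain j where "j < n" "x = as ! j" using x as by (auto simp: in_set_conv_nth)
    then have "x \<le> l - 1 + m * j" using as by (auto simp: ballot_def)
    also have "\<dots> \<le> l - 1 + m * n" using \<open>j < n\<close> by simp
    finally show ?thesis .
  qed
  then obtain D where "rows 0 D = as" "count_list D Horiz = l - 1 + m * n"
    using rows_surj[of as 0 "l - 1 + m * n"] as by (auto simp: ballot_def)
  moreover from this have "dyck_path l m n D"
    using as length_rows[of 0 D] by (simp add: dyck_path_iff_ballot[OF assms])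
  ultimately show "as \<in> rows 0 ` {D. dyck_path l m n D}" by blast
qed

lemma finite_dyck_paths: "finite {D. dyck_path l m n D}"
proof -
  have "set D \<subseteq> {Vert, Horiz}" for D by (metis insertCI step.exhaust subsetI)
  moreover have "length D = count_list D Vert + count_list D Horiz" for D
    by (induction D) (use step.exhaust in auto)
  moreover have "count_list D Vert = n \<and> count_list D Horiz = nat (int (m * n) + int l - 1)"
    if "dyck_path l m n D" for D
    using that by (auto simp: dyck_path_def path_point_def)
  ultimately have "{D. dyck_path l m n D} \<subseteq>
      {D. set D \<subseteq> {Vert, Horiz} \<and> length D = n + nat (int (m * n) + int l - 1)}"
    by auto
  then show ?thesis by (rule finite_subset) (rule finite_lists_length_eq, simp)
qed


section \<open>Exponent vectors\<close>

definition sorted_exponents :: "nat \<Rightarrow> (nat \<Rightarrow>\<^sub>0 nat) \<Rightarrow> nat list" where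
  "sorted_exponents n f = sort (map (lookup f) [1..<n + 1])"

text \<open>The entry at \<open>0\<close> is a dummy, since the variables are \<open>x\<^sub>1, \<dots>, x\<^sub>n\<close>.\<close>

definition exponent_vector :: "nat list \<Rightarrow> nat \<Rightarrow>\<^sub>0 nat" where
  "exponent_vector w = Poly_Mapping.nth (0 # w)"

lemma set_upt_Suc: "set [1..<n + 1] = {1..n}"
  by auto

lemma lookup_exponent_vector:
  "lookup (exponent_vector w) i = (if i \<in> {1..length w} then w ! (i - 1) else 0)"
  by (cases i) (auto simp: exponent_vector_def nth_default_def plus_1_eq_Suc)

lemma keys_exponent_vector: "keys (exponent_vector w) \<subseteq> {1..length w}"
  unfolding subset_iff in_keys_iff lookup_exponent_vector by simp

lemma map_lookup_exponent_vector:
  "map (lookup (exponent_vector w)) [1..<length w + 1] = w"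
  by (rule nth_equalityI) (auto simp: lookup_exponent_vector simp del: upt_Suc)

lemma length_sorted_exponents [simp]: "length (sorted_exponents n f) = n"
  by (simp add: sorted_exponents_def)

lemma sorted_sorted_exponents [simp]: "sorted (sorted_exponents n f)"
  by (simp add: sorted_exponents_def)

lemma mset_sorted_exponents:
  "mset (sorted_exponents n f) = image_mset (lookup f) (mset_set {1..n})"
  unfolding sorted_exponents_def mset_sort mset_map set_upt_Suc[symmetric]
  by (simp add: mset_set_set del: upt_Suc)

lemma sum_list_sorted_exponents:
  assumes "keys f \<subseteq> {1..n}"
  shows "sum_list (sorted_exponents n f) = monom_degree f"
proof -
  have "sum_list (sorted_exponents n f) = (\<Sum>i\<in>{1..n}. lookup f i)"
    by (simp add: mset_sorted_exponents sum_unfold_sum_mset flip: sum_mset_sum_list)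
  then show ?thesis by (simp add: monom_degree_superset[OF finite_atLeastAtMost assms])
qed

lemma sorted_exponents_exponent_vector:
  "sorted_exponents (length w) (exponent_vector w) = sort w"
  unfolding sorted_exponents_def map_lookup_exponent_vector ..

lemma sorted_nth_ge_iff:
  assumes "sorted as" "j < length as"
  shows "b \<le> as ! j \<longleftrightarrow> length as \<le> j + length (filter (\<lambda>x. b \<le> x) as)"
proof
  assume "b \<le> as ! j"
  have "b \<le> x" if x: "x \<in> set (drop j as)" for x
  proof -
    obtain i where "i < length as - j" "x = as ! (j + i)"
      using x by (auto simp: in_set_conv_nth)
    then have "as ! j \<le> x" using sorted_nth_mono[OF assms(1), of j "j + i"] by simp
    with \<open>b \<le> as ! j\<close> show ?thesis by simp
  qed
  then have "filter (\<lambda>x. b \<le> x) (drop j as) = drop j as" by simp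
  then have "length as - j \<le> length (filter (\<lambda>x. b \<le> x) (take j as @ drop j as))"
    by (simp only: filter_append length_append) simp
  then show "length as \<le> j + length (filter (\<lambda>x. b \<le> x) as)" by simp
next
  assume count: "length as \<le> j + length (filter (\<lambda>x. b \<le> x) as)"
  show "b \<le> as ! j"
  proof (rule ccontr)
    assume "\<not> b \<le> as ! j"
    have "\<not> b \<le> x" if x: "x \<in> set (take (Suc j) as)" for x
    proof -
      obtain i where "i \<le> j" "x = as ! i"
        using x by (auto simp: in_set_conv_nth less_Suc_eq_le)
      then have "x \<le> as ! j" using sorted_nth_mono[OF assms(1) _ assms(2)] by simp
      with \<open>\<not> b \<le> as ! j\<close> show ?thesis by simp
    qed
    then have "filter (\<lambda>x. b \<le> x) (take (Suc j) as) = []" by simp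
    then have "length (filter (\<lambda>x. b \<le> x) (take (Suc j) as @ drop (Suc j) as)) \<le> length as - Suc j"
      by (simp only: filter_append append_Nil) (metis length_drop length_filter_le)
    then show False using count assms(2) by simp
  qed
qed

lemma nth_sorted_exponents_ge_iff:
  assumes "j < n"
  shows "b \<le> sorted_exponents n f ! j \<longleftrightarrow> n \<le> j + card {i \<in> {1..n}. b \<le> lookup f i}"
proof -
  have "length (filter (\<lambda>x. b \<le> x) (sorted_exponents n f)) =
      size (filter_mset (\<lambda>x. b \<le> x) (mset (sorted_exponents n f)))"
    by (metis mset_filter size_mset)
  also have "\<dots> = card {i \<in> {1..n}. b \<le> lookup f i}"
    unfolding mset_sorted_exponents filter_mset_image_mset by simp
  finally show ?thesis using sorted_nth_ge_iff[of "sorted_exponents n f" j b] assms by simp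
qed

lemma parking_complete_multigraph_iff_ballot:
  assumes l: "l \<ge> 1" and f: "keys f \<subseteq> {1..n}"
  shows "parking (complete_multigraph l m n) {1..n} f \<longleftrightarrow> ballot l m (sorted_exponents n f)"
proof
  assume park: "parking (complete_multigraph l m n) {1..n} f"
  have "sorted_exponents n f ! j \<le> l - 1 + m * j" if j: "j < n" for j
  proof (rule ccontr)
    define I where "I = {i \<in> {1..n}. l + m * j \<le> lookup f i}"
    assume "\<not> sorted_exponents n f ! j \<le> l - 1 + m * j"
    then have "l + m * j \<le> sorted_exponents n f ! j" using l by simp
    then have card: "n \<le> j + card I" unfolding I_def nth_sorted_exponents_ge_iff[OF j] .
    then have "card I \<noteq> 0" using j by simp
    then have I: "I \<subseteq> {1..n}" "I \<noteq> {}" by (auto simp: I_def)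
    then obtain i where i: "i \<in> I" "lookup f i < l + m * (n - card I)"
      using park unfolding parking_def by (metis out_degree_complete_multigraph)
    note i(2)
    also have "l + m * (n - card I) \<le> l + m * j"
      using card by (intro add_left_mono mult_left_mono) linarith+
    finally show False using i(1) by (simp add: I_def)
  qed
  then show "ballot l m (sorted_exponents n f)" by (simp add: ballot_def)
next
  assume bound: "ballot l m (sorted_exponents n f)"
  show "parking (complete_multigraph l m n) {1..n} f"
    unfolding parking_def
  proof (intro conjI f allI impI, rule ccontr)
    fix I assume I: "I \<subseteq> {1..n}" "I \<noteq> {}"
      and "\<not> (\<exists>i\<in>I. lookup f i < out_degree (complete_multigraph l m n) I i)"
    then have ge: "l + m * (n - card I) \<le> lookup f i" if "i \<in> I" for i
      using that by (simp add: out_degree_complete_multigraph[OF I(1)] not_less)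
    have "card I > 0" "card I \<le> n"
      using I card_mono[OF _ I(1)] card_gt_0_iff[of I] finite_subset[OF I(1)] by auto
    then have j: "n - card I < n" by simp
    have "card I \<le> card {i \<in> {1..n}. l + m * (n - card I) \<le> lookup f i}"
      using I(1) ge by (intro card_mono) auto
    then have "l + m * (n - card I) \<le> sorted_exponents n f ! (n - card I)"
      unfolding nth_sorted_exponents_ge_iff[OF j] by simp
    also have "\<dots> \<le> l - 1 + m * (n - card I)" using bound j by (simp add: ballot_def)
    finally show False using l by simp
  qed
qed

lemma parking_degree_iff_ballot:
  assumes "l \<ge> 1"
  shows "f \<in> parking_degree l m n k \<longleftrightarrow> keys f \<subseteq> {1..n} \<and>
    ballot l m (sorted_exponents n f) \<and> sum_list (sorted_exponents n f) = k"
  using parking_complete_multigraph_iff_ballot[OF assms] sum_list_sorted_exponents[of f n]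
  by (auto simp: parking_degree_def parking_def)

lemma lookup_map_key_permutes:
  "\<sigma> permutes A \<Longrightarrow> lookup (map_key \<sigma> t) i = lookup t (\<sigma> i)"
  by (simp add: map_key.rep_eq permutes_inj)

lemma map_key_permutes_compose:
  assumes "\<sigma> permutes A" "\<tau> permutes A"
  shows "map_key \<tau> (map_key \<sigma> t) = map_key (\<sigma> \<circ> \<tau>) t"
  by (rule poly_mapping_eqI)
    (simp add: lookup_map_key_permutes[OF assms(1)] lookup_map_key_permutes[OF assms(2)]
      lookup_map_key_permutes[OF permutes_compose[OF assms(2,1)]])

lemma keys_map_key_permutes:
  assumes "\<sigma> permutes A" "keys t \<subseteq> A"
  shows "keys (map_key \<sigma> t) \<subseteq> A"
proof
  fix i assume "i \<in> keys (map_key \<sigma> t)"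
  then have "\<sigma> i \<in> keys t" by (simp add: in_keys_iff lookup_map_key_permutes[OF assms(1)])
  then show "i \<in> A" using assms permutes_in_image[OF assms(1)] by blast
qed

lemma sorted_exponents_map_key:
  assumes \<sigma>: "\<sigma> permutes {1..n}"
  shows "sorted_exponents n (map_key \<sigma> t) = sorted_exponents n t"
proof -
  have "lookup (map_key \<sigma> t) = lookup t \<circ> \<sigma>"
    by (simp add: fun_eq_iff lookup_map_key_permutes[OF \<sigma>])
  then have "image_mset (lookup (map_key \<sigma> t)) (mset_set {1..n}) =
      image_mset (lookup t) (image_mset \<sigma> (mset_set {1..n}))"
    by (simp add: multiset.map_comp)
  also have "image_mset \<sigma> (mset_set {1..n}) = mset_set {1..n}"
    using permutes_inj_on[OF \<sigma>] permutes_image[OF \<sigma>] by (simp add: image_mset_mset_set)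
  finally have "mset (sorted_exponents n (map_key \<sigma> t)) = mset (sorted_exponents n t)"
    by (simp add: mset_sorted_exponents)
  then show ?thesis by (metis properties_for_sort sorted_sorted_exponents)
qed

lemma sorted_exponents_eq_imp_map_key:
  assumes "keys s \<subseteq> {1..n}" "keys t \<subseteq> {1..n}" "sorted_exponents n s = sorted_exponents n t"
  obtains \<sigma> where "\<sigma> permutes {1..n}" "s = map_key \<sigma> t"
proof -
  have "image_mset (lookup s) (mset_set {1..n}) = image_mset (lookup t) (mset_set {1..n})"
    using assms(3) by (simp flip: mset_sorted_exponents)
  then obtain \<sigma> where \<sigma>: "\<sigma> permutes {1..n}" "\<forall>i\<in>{1..n}. lookup s i = lookup t (\<sigma> i)"
    by (rule image_mset_eq_implies_permutes[OF finite_atLeastAtMost])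
  have "s = map_key \<sigma> t"
  proof (rule poly_mapping_eqI)
    fix i
    show "lookup s i = lookup (map_key \<sigma> t) i"
    proof (cases "i \<in> {1..n}")
      case False
      then have "i \<notin> keys s" "i \<notin> keys (map_key \<sigma> t)"
        using assms(1) keys_map_key_permutes[OF \<sigma>(1) assms(2)] by auto
      then show ?thesis by (simp add: not_in_keys_iff_lookup_eq_zero)
    qed (use \<sigma> in \<open>simp add: lookup_map_key_permutes\<close>)
  qed
  then show ?thesis using that \<sigma>(1) by blast
qed


section \<open>Young subgroups as stabilizers\<close>

definition block :: "nat list \<Rightarrow> nat \<Rightarrow> nat set" where
  "block lam j = {sum_list (take j lam)<..sum_list (take (Suc j) lam)}"

definition block_word :: "('a \<Rightarrow> nat) \<Rightarrow> 'a list \<Rightarrow> 'a list" where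
  "block_word c xs = concat (map (\<lambda>x. replicate (c x) x) xs)"

lemma young_subgroup_eq_blocks:
  "young_subgroup lam =
    {\<sigma>. \<sigma> permutes {1..sum_list lam} \<and> (\<forall>j<length lam. \<sigma> ` block lam j = block lam j)}"
  by (simp add: young_subgroup_def block_def)

lemma block_cover: "i \<in> {1..sum_list lam} \<Longrightarrow> \<exists>j<length lam. i \<in> block lam j"
proof (induction lam arbitrary: i)
  case (Cons a lam)
  show ?case
  proof (cases "i \<le> a")
    case True
    then show ?thesis using Cons.prems by (intro exI[of _ 0]) (auto simp: block_def)
  next
    case False
    then have "i - a \<in> {1..sum_list lam}" using Cons.prems by (auto simp: One_nat_def)
    then obtain j where "j < length lam" "i - a \<in> block lam j" using Cons.IH by blast
    then show ?thesis using False by (intro exI[of _ "Suc j"]) (auto simp: block_def)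
  qed
qed auto

lemma block_subset: "block lam j \<subseteq> {1..sum_list lam}"
proof -
  have "sum_list lam = sum_list (take (Suc j) lam) + sum_list (drop (Suc j) lam)"
    by (metis append_take_drop_id sum_list_append)
  then show ?thesis by (auto simp: block_def)
qed

lemma length_block_word: "length (block_word c xs) = sum_list (map c xs)"
  by (simp add: block_word_def length_concat comp_def)

lemma nth_block_word:
  "j < length xs \<Longrightarrow> i \<in> block (map c xs) j \<Longrightarrow> block_word c xs ! (i - 1) = xs ! j"
proof (induction xs arbitrary: i j)
  case (Cons x xs)
  show ?case
  proof (cases j)
    case 0
    then have "i - 1 < c x" using Cons.prems by (auto simp: block_def)
    then show ?thesis by (simp add: block_word_def 0 nth_append)
  next
    case (Suc j')
    then have "i - c x \<in> block (map c xs) j'" "i > c x" using Cons.prems by (auto simp: block_def)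
    then show ?thesis using Cons.IH[of j' "i - c x"] Cons.prems
      by (auto simp: block_word_def Suc nth_append add.commute)
  qed
qed simp

lemma block_eq_level_set:
  assumes "distinct xs" "j < length xs"
  shows "block (map c xs) j =
    {i \<in> {1..length (block_word c xs)}. block_word c xs ! (i - 1) = xs ! j}"
proof (rule subset_antisym; rule subsetI)
  fix i assume "i \<in> block (map c xs) j"
  then show "i \<in> {i \<in> {1..length (block_word c xs)}. block_word c xs ! (i - 1) = xs ! j}"
    using block_subset[of "map c xs" j] nth_block_word[OF assms(2)]
    by (auto simp: length_block_word)
next
  fix i assume i: "i \<in> {i \<in> {1..length (block_word c xs)}. block_word c xs ! (i - 1) = xs ! j}"
  then obtain j' where j': "j' < length xs" "i \<in> block (map c xs) j'"
    using block_cover[of i "map c xs"] by (auto simp: length_block_word)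
  then have "xs ! j' = xs ! j" using i nth_block_word by fastforce
  then have "j' = j" using assms j'(1) by (simp add: nth_eq_iff_index_eq)
  then show "i \<in> block (map c xs) j" using j' by simp
qed

lemma permutes_image_level_set_iff:
  assumes "finite A" "\<sigma> permutes A" "f ` A \<subseteq> X"
  shows "(\<forall>x\<in>X. \<sigma> ` {i \<in> A. f i = x} = {i \<in> A. f i = x}) \<longleftrightarrow> (\<forall>i\<in>A. f (\<sigma> i) = f i)"
proof
  assume level: "\<forall>x\<in>X. \<sigma> ` {i \<in> A. f i = x} = {i \<in> A. f i = x}"
  show "\<forall>i\<in>A. f (\<sigma> i) = f i"
  proof
    fix i assume "i \<in> A"
    then have "\<sigma> i \<in> \<sigma> ` {i' \<in> A. f i' = f i}" "f i \<in> X" using assms(3) by auto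
    then show "f (\<sigma> i) = f i" using level by blast
  qed
next
  assume inv: "\<forall>i\<in>A. f (\<sigma> i) = f i"
  show "\<forall>x\<in>X. \<sigma> ` {i \<in> A. f i = x} = {i \<in> A. f i = x}"
  proof
    fix x
    show "\<sigma> ` {i \<in> A. f i = x} = {i \<in> A. f i = x}"
    proof (rule endo_inj_surj)
      show "finite {i \<in> A. f i = x}" using assms(1) by simp
      show "\<sigma> ` {i \<in> A. f i = x} \<subseteq> {i \<in> A. f i = x}"
        using inv permutes_in_image[OF assms(2)] by auto
      show "inj_on \<sigma> {i \<in> A. f i = x}"
        using permutes_inj_on[OF assms(2)] .
    qed
  qed
qed

lemma set_block_word: "set (block_word c xs) \<subseteq> set xs"
  by (auto simp: block_word_def)

lemma young_subgroup_eq_stabilizer: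
  assumes "distinct xs"
  shows "young_subgroup (map c xs) = {\<sigma>. \<sigma> permutes {1..sum_list (map c xs)} \<and>
    map_key \<sigma> (exponent_vector (block_word c xs)) = exponent_vector (block_word c xs)}"
proof -
  let ?w = "block_word c xs" and ?N = "sum_list (map c xs)"
  have "(\<forall>j<length xs. \<sigma> ` block (map c xs) j = block (map c xs) j) \<longleftrightarrow>
      map_key \<sigma> (exponent_vector ?w) = exponent_vector ?w" if \<sigma>: "\<sigma> permutes {1..?N}" for \<sigma>
  proof -
    have "(\<lambda>i. ?w ! (i - 1)) ` {1..?N} \<subseteq> set xs"
      using set_block_word[of c xs]
      by (auto simp flip: length_block_word intro!: subsetD[OF _ nth_mem])
    note iff = permutes_image_level_set_iff[OF _ \<sigma> this]
    have "(\<forall>j<length xs. \<sigma> ` block (map c xs) j = block (map c xs) j) \<longleftrightarrow>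
        (\<forall>x\<in>set xs. \<sigma> ` {i \<in> {1..?N}. ?w ! (i - 1) = x} = {i \<in> {1..?N}. ?w ! (i - 1) = x})"
      by (simp add: block_eq_level_set[OF assms] length_block_word all_set_conv_all_nth)
    also have "\<dots> \<longleftrightarrow> (\<forall>i\<in>{1..?N}. ?w ! (\<sigma> i - 1) = ?w ! (i - 1))" by (rule iff) simp
    also have "\<dots> \<longleftrightarrow> (\<forall>i. lookup (exponent_vector ?w) (\<sigma> i) = lookup (exponent_vector ?w) i)"
      unfolding lookup_exponent_vector length_block_word permutes_in_image[OF \<sigma>] by auto
    also have "\<dots> \<longleftrightarrow> map_key \<sigma> (exponent_vector ?w) = exponent_vector ?w"
      by (simp add: poly_mapping_eq_iff fun_eq_iff lookup_map_key_permutes[OF \<sigma>])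
    finally show ?thesis .
  qed
  then show ?thesis by (auto simp: young_subgroup_eq_blocks)
qed

lemma mset_block_word:
  assumes "distinct xs" "set xs = set_mset M"
  shows "mset (block_word (count M) xs) = M"
proof (rule multiset_eqI)
  fix y
  have "count (mset (block_word c xs)) y = (if y \<in> set xs then c y else 0)" for c :: "'a \<Rightarrow> nat"
    using assms(1) by (induction xs) (auto simp: block_word_def)
  then show "count (mset (block_word (count M) xs)) y = count M y"
    using assms(2) by (simp add: not_in_iff)
qed


section \<open>Decomposition into Young modules\<close>

definition run_values :: "step list \<Rightarrow> nat list" where
  "run_values D = rev (sort_key (count (mset (rows 0 D))) (remdups (rows 0 D)))"

definition dyck_word :: "step list \<Rightarrow> nat list" where
  "dyck_word D = block_word (count (mset (rows 0 D))) (run_values D)"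

definition dyck_monom :: "step list \<Rightarrow> nat \<Rightarrow>\<^sub>0 nat" where
  "dyck_monom D = exponent_vector (dyck_word D)"

lemma remdups_replicate_Suc_append:
  "x \<notin> set ys \<Longrightarrow> remdups (replicate (Suc k) x @ ys) = x # remdups ys"
  by (induction k) auto

lemma vertical_runs_eq_counts:
  "vertical_runs D = map (count (mset (rows h D))) (remdups (rows h D))"
proof (induction D arbitrary: h rule: vertical_runs.induct)
  case (3 D)
  let ?k = "length (takeWhile (\<lambda>s. s = Vert) D)" and ?D' = "dropWhile (\<lambda>s. s = Vert) D"
  have "takeWhile (\<lambda>s. s = Vert) D = replicate ?k Vert"
    by (rule replicate_length_same[symmetric]) (auto dest: set_takeWhileD)
  then have "D = replicate ?k Vert @ ?D'" by (metis takeWhile_dropWhile_id)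
  then have rows: "rows h (Vert # D) = replicate (Suc ?k) h @ rows h ?D'"
    by (metis rows_replicate_Vert append_Cons replicate_Suc)
  have h: "h \<notin> set (rows h ?D')"
  proof (cases ?D')
    case Nil
    then show ?thesis by (metis rows.simps(1) empty_iff list.set(1))
  next
    case (Cons s D'')
    then have "s = Horiz" using hd_dropWhile[of "\<lambda>s. s = Vert" D] by (cases s) auto
    then show ?thesis using Cons rows_bounds[of h "Suc h" D''] by auto
  qed
  have "map (count (mset (rows h (Vert # D)))) (remdups (rows h ?D')) =
      map (count (mset (rows h ?D'))) (remdups (rows h ?D'))"
    unfolding rows by (rule map_cong[OF refl]) (use h in auto)
  moreover have "count (mset (rows h (Vert # D))) h = Suc ?k"
    unfolding rows using h by (simp add: count_mset_0_iff)
  moreover have "remdups (rows h (Vert # D)) = h # remdups (rows h ?D')"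
    unfolding rows by (rule remdups_replicate_Suc_append[OF h])
  ultimately show ?case using 3[of h] by simp
qed simp_all

lemma distinct_run_values: "distinct (run_values D)"
  and set_run_values: "set (run_values D) = set_mset (mset (rows 0 D))"
  by (simp_all add: run_values_def)

lemma vertical_run_partition_eq:
  "vertical_run_partition D = map (count (mset (rows 0 D))) (run_values D)"
proof -
  have "sort (map c xs) = map c (sort_key c xs)" for c :: "nat \<Rightarrow> nat" and xs
    by (rule properties_for_sort) simp_all
  then show ?thesis
    by (simp add: vertical_run_partition_def vertical_runs_eq_counts[of D 0] run_values_def rev_map)
qed

lemma mset_dyck_word: "mset (dyck_word D) = mset (rows 0 D)"
  unfolding dyck_word_def by (rule mset_block_word[OF distinct_run_values set_run_values])

lemma length_dyck_word: "length (dyck_word D) = count_list D Vert"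
  by (metis mset_dyck_word size_mset length_rows)

lemma sum_list_vertical_run_partition: "sum_list (vertical_run_partition D) = count_list D Vert"
  by (simp add: vertical_run_partition_eq flip: length_block_word dyck_word_def length_dyck_word)

lemma young_subgroup_vertical_run_partition:
  "young_subgroup (vertical_run_partition D) =
    {\<sigma>. \<sigma> permutes {1..count_list D Vert} \<and> map_key \<sigma> (dyck_monom D) = dyck_monom D}"
  using young_subgroup_eq_stabilizer[OF distinct_run_values, of "count (mset (rows 0 D))" D]
  by (simp add: sum_list_vertical_run_partition
      flip: dyck_word_def dyck_monom_def vertical_run_partition_eq)

lemma keys_dyck_monom: "keys (dyck_monom D) \<subseteq> {1..count_list D Vert}"
  using keys_exponent_vector[of "dyck_word D"] by (simp add: dyck_monom_def length_dyck_word)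

lemma sorted_exponents_dyck_monom: "sorted_exponents (count_list D Vert) (dyck_monom D) = rows 0 D"
proof -
  have "sort (dyck_word D) = rows 0 D"
    by (rule properties_for_sort) (simp_all add: mset_dyck_word sorted_rows)
  then show ?thesis
    using sorted_exponents_exponent_vector[of "dyck_word D"]
    by (simp add: dyck_monom_def length_dyck_word)
qed

context
  fixes l m :: nat
  assumes lm: "l \<ge> 1" "m \<ge> 1"
begin

lemma young_subgroup_dyck_path:
  "dyck_path l m n D \<Longrightarrow> young_subgroup (vertical_run_partition D) =
    {\<sigma>. \<sigma> permutes {1..n} \<and> map_key \<sigma> (dyck_monom D) = dyck_monom D}"
  by (simp add: dyck_path_iff_ballot[OF lm] young_subgroup_vertical_run_partition)

lemma map_key_dyck_monom_parking:
  assumes "dyck_path l m n D" "area l D = k" "\<sigma> permutes {1..n}"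
  shows "map_key \<sigma> (dyck_monom D) \<in> parking_degree l m n k"
proof -
  have "count_list D Vert = n" "ballot l m (rows 0 D)"
    using assms(1) by (simp_all add: dyck_path_iff_ballot[OF lm])
  then show ?thesis
    using assms(2) sorted_exponents_dyck_monom[of D] keys_dyck_monom[of D]
      keys_map_key_permutes[OF assms(3)]
    by (simp add: parking_degree_iff_ballot[OF lm(1)] sorted_exponents_map_key[OF assms(3)]
        area_eq_sum_rows)
qed

lemma parking_is_map_key_dyck_monom:
  assumes "f \<in> parking_degree l m n k"
  obtains D \<sigma> where "dyck_path l m n D" "area l D = k" "\<sigma> permutes {1..n}"
    "f = map_key \<sigma> (dyck_monom D)"
proof -
  have f: "keys f \<subseteq> {1..n}" "ballot l m (sorted_exponents n f)"
    "sum_list (sorted_exponents n f) = k"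
    using assms by (simp_all add: parking_degree_iff_ballot[OF lm(1)])
  then have "sorted_exponents n f \<in> rows 0 ` {D. dyck_path l m n D}"
    using bij_betw_imp_surj_on[OF bij_betw_rows[OF lm, of n]] by simp
  then obtain D where D: "dyck_path l m n D" "sorted_exponents n f = rows 0 D" by blast
  then have "count_list D Vert = n" by (simp add: dyck_path_iff_ballot[OF lm])
  then obtain \<sigma> where "\<sigma> permutes {1..n}" "f = map_key \<sigma> (dyck_monom D)"
    using sorted_exponents_eq_imp_map_key[of f n "dyck_monom D"] f(1) D(2) keys_dyck_monom[of D]
      sorted_exponents_dyck_monom[of D] by auto
  moreover have "area l D = k" using f(3) D(2) by (simp add: area_eq_sum_rows)
  ultimately show ?thesis using that D(1) by blast
qed

lemma map_key_dyck_monom_eqD: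
  assumes D: "dyck_path l m n D" "dyck_path l m n D'"
    and \<sigma>: "\<sigma> permutes {1..n}" "\<sigma>' permutes {1..n}"
    and eq: "map_key \<sigma> (dyck_monom D) = map_key \<sigma>' (dyck_monom D')"
  shows "D = D'" and "\<exists>h\<in>young_subgroup (vertical_run_partition D). \<sigma>' = h \<circ> \<sigma>"
proof -
  have vert: "count_list D Vert = n" "count_list D' Vert = n"
    using D by (simp_all add: dyck_path_iff_ballot[OF lm])
  have "sorted_exponents n (dyck_monom D) = sorted_exponents n (dyck_monom D')"
    using arg_cong[OF eq, of "sorted_exponents n"] by (simp add: sorted_exponents_map_key \<sigma>)
  then have "rows 0 D = rows 0 D'"
    using sorted_exponents_dyck_monom[of D] sorted_exponents_dyck_monom[of D'] vert by simp
  then show DD: "D = D'"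
    using bij_betw_imp_inj_on[OF bij_betw_rows[OF lm, of n]] D by (auto dest: inj_onD)
  define h where "h = \<sigma>' \<circ> inv' \<sigma>"
  have inv: "inv' \<sigma> permutes {1..n}" using \<sigma>(1) by (rule permutes_inv)
  have "map_key h (dyck_monom D) = map_key (inv' \<sigma>) (map_key \<sigma>' (dyck_monom D'))"
    by (simp add: h_def DD map_key_permutes_compose[OF \<sigma>(2) inv])
  also have "\<dots> = map_key (\<sigma> \<circ> inv' \<sigma>) (dyck_monom D)"
    by (simp add: map_key_permutes_compose[OF \<sigma>(1) inv] flip: eq)
  also have "\<dots> = dyck_monom D"
    by (rule poly_mapping_eqI)
      (simp add: permutes_inv_o[OF \<sigma>(1)] lookup_map_key_permutes[OF permutes_id])
  finally have "h \<in> young_subgroup (vertical_run_partition D)"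
    using permutes_compose[OF inv \<sigma>(2)] vert
    by (simp add: young_subgroup_vertical_run_partition h_def)
  moreover have "\<sigma>' = h \<circ> \<sigma>" by (simp add: h_def fun_eq_iff permutes_inverses[OF \<sigma>(1)])
  ultimately show "\<exists>h\<in>young_subgroup (vertical_run_partition D). \<sigma>' = h \<circ> \<sigma>" by blast
qed

lemma slim_component_eq_0_if_dyck_coeffs:
  assumes "p \<in> slim_component l m n k"
    and "\<And>D g. dyck_path l m n D \<Longrightarrow> area l D = k \<Longrightarrow> g permutes {1..n} \<Longrightarrow>
      lookup p (map_key g (dyck_monom D)) = 0"
  shows "p = 0"
  using assms(1) by (rule slim_component_eq_0I) (metis assms(2) parking_is_map_key_dyck_monom)

lemma slim_component_prescribed_dyck_coeffs:
  assumes T: "\<And>D h g. dyck_path l m n D \<Longrightarrow> area l D = k \<Longrightarrow>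
    h \<in> young_subgroup (vertical_run_partition D) \<Longrightarrow> g permutes {1..n} \<Longrightarrow> T D (h \<circ> g) = T D g"
  obtains p where "p \<in> slim_component l m n k"
    "\<And>D g. dyck_path l m n D \<Longrightarrow> area l D = k \<Longrightarrow> g permutes {1..n} \<Longrightarrow>
      lookup p (map_key g (dyck_monom D)) = T D g"
proof -
  have "\<forall>f\<in>parking_degree l m n k. \<exists>D g. dyck_path l m n D \<and> g permutes {1..n} \<and>
      f = map_key g (dyck_monom D)"
    using parking_is_map_key_dyck_monom by metis
  then obtain path perm where path: "\<And>f. f \<in> parking_degree l m n k \<Longrightarrow>
      dyck_path l m n (path f) \<and> perm f permutes {1..n} \<and>
      f = map_key (perm f) (dyck_monom (path f))"
    by metis
  obtain p where p: "p \<in> slim_component l m n k"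
    "\<And>f. f \<in> parking_degree l m n k \<Longrightarrow> lookup p f = T (path f) (perm f)"
    by (rule slim_component_prescribed_coeffs[of l m n k "\<lambda>f. T (path f) (perm f)"]) blast
  have "lookup p (map_key g (dyck_monom D)) = T D g"
    if D: "dyck_path l m n D" "area l D = k" and g: "g permutes {1..n}" for D g
  proof -
    let ?f = "map_key g (dyck_monom D)"
    have f: "?f \<in> parking_degree l m n k" using D g by (rule map_key_dyck_monom_parking)
    note path = path[OF f]
    have "D = path ?f" "\<exists>h\<in>young_subgroup (vertical_run_partition D). perm ?f = h \<circ> g"
      using map_key_dyck_monom_eqD[of n D "path ?f" g "perm ?f"] D g path by blast+
    then show ?thesis using p(2)[OF f] T[OF D _ g] by auto
  qed
  then show ?thesis using that p(1) by blast
qed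

lemma lookup_slim_rep_act:
  "g \<in> carrier (sym_group n) \<Longrightarrow>
    lookup (rep_act (slim_rep l m n k) g p) t = lookup p (map_key g t)"
  by (simp add: slim_rep_def sym_group_carrier lookup_permute_vars permutes_bij)

theorem slim_component_dyck:
  "rep_iso (sym_group n) (slim_rep l m n k)
    (direct_sum_rep {D. dyck_path l m n D \<and> area l D = k}
      (\<lambda>D. young_module n (vertical_run_partition D)))"
      (is "rep_iso ?G ?R (direct_sum_rep ?paths _)")
  unfolding young_module_def
proof (rule rep_iso_direct_sum_induced_char[where \<epsilon> = "\<lambda>D p. lookup p (dyck_monom D)"])
  show "group ?G" by (rule sym_group_is_group)
  show "is_rep ?G ?R" by (rule is_rep_slim_rep) simp
  show fin: "finite ?paths" by (rule finite_subset[OF _ finite_dyck_paths]) auto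
  show H: "young_subgroup (vertical_run_partition D) \<subseteq> carrier ?G" if "D \<in> ?paths" for D
    using that by (auto simp: young_subgroup_dyck_path sym_group_carrier)
  show "lookup (p + q) (dyck_monom D) = lookup p (dyck_monom D) + lookup q (dyck_monom D)" for D p q
    by (rule lookup_add)
  show "lookup (rep_scale ?R c p) (dyck_monom D) = c * lookup p (dyck_monom D)" for D c p
    by (simp add: slim_rep_def lookup_pscale)
  show "lookup (rep_act ?R h p) (dyck_monom D) = 1 * lookup p (dyck_monom D)"
    if "D \<in> ?paths" "h \<in> young_subgroup (vertical_run_partition D)" for D h p
    using that H[OF that(1)] by (auto simp: lookup_slim_rep_act young_subgroup_dyck_path)
  show "p = 0" if p: "p \<in> rep_space ?R"
    and zero: "\<And>D g. D \<in> ?paths \<Longrightarrow> g \<in> carrier ?G \<Longrightarrow>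
      lookup (rep_act ?R g p) (dyck_monom D) = 0" for p
  proof (rule slim_component_eq_0_if_dyck_coeffs)
    show "p \<in> slim_component l m n k" using p by (simp add: slim_rep_def)
  qed (use zero in \<open>simp add: lookup_slim_rep_act sym_group_carrier\<close>)
  show "\<exists>p\<in>rep_space ?R. \<forall>D\<in>?paths. \<forall>g\<in>carrier ?G.
      lookup (rep_act ?R g p) (dyck_monom D) = T D g"
    if T: "T \<in> rep_space (direct_sum_rep ?paths
      (\<lambda>D. induced_rep ?G (young_subgroup (vertical_run_partition D)) (char_rep (\<lambda>_. 1))))" for T
  proof -
    have "T D (h \<circ> g) = T D g"
      if "dyck_path l m n D" "area l D = k" "h \<in> young_subgroup (vertical_run_partition D)"
        "g permutes {1..n}" for D h g
      using T that unfolding mem_direct_sum_induced_char[OF fin]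
      by (simp add: sym_group_carrier sym_group_mult)
    then obtain p where "p \<in> slim_component l m n k"
      "\<And>D g. dyck_path l m n D \<Longrightarrow> area l D = k \<Longrightarrow> g permutes {1..n} \<Longrightarrow>
        lookup p (map_key g (dyck_monom D)) = T D g"
      using slim_component_prescribed_dyck_coeffs[of n k T] by metis
    then have "p \<in> rep_space ?R \<and> (\<forall>D\<in>?paths. \<forall>g\<in>carrier ?G.
        lookup (rep_act ?R g p) (dyck_monom D) = T D g)"
      by (simp add: lookup_slim_rep_act sym_group_carrier) (simp add: slim_rep_def)
    then show ?thesis by blast
  qed
qed

end


section \<open>Word products and shuffles\<close>

fun word_prod :: "('v \<Rightarrow> 'f::field) \<Rightarrow> 'v list \<Rightarrow> 'f" where
  "word_prod x (a # b # w) = word_prod x (b # w) / (x a - x b)"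
| "word_prod x w = 1"

lemma word_prod_append: "word_prod x (u @ j # v) = word_prod x (u @ [j]) * word_prod x (j # v)"
  by (induction x u rule: word_prod.induct) (auto simp: neq_Nil_conv)

lemma word_prod_map_upt:
  "word_prod x (map \<sigma> [a..<a + k + 1]) = inverse (\<Prod>i\<in>{a..<a + k}. x (\<sigma> i) - x (\<sigma> (i + 1)))"
proof (induction k arbitrary: a)
  case 0
  then show ?case by (simp add: One_nat_def)
next
  case (Suc k)
  let ?w = "[Suc (Suc a)..<a + Suc k + 1]" and ?d = "\<lambda>i. x (\<sigma> i) - x (\<sigma> (i + 1))"
  have upt: "[a..<a + Suc k + 1] = a # Suc a # ?w" "[Suc a..<Suc a + k + 1] = Suc a # ?w"
    by (simp_all add: upt_conv_Cons del: upt_Suc)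
  have "word_prod x (map \<sigma> [a..<a + Suc k + 1]) =
      word_prod x (map \<sigma> [Suc a..<Suc a + k + 1]) / ?d a"
    unfolding upt by (simp add: One_nat_def del: upt_Suc)
  also have "\<dots> = inverse (?d a * (\<Prod>i\<in>{Suc a..<Suc a + k}. ?d i))"
    unfolding Suc.IH by (simp add: divide_inverse mult.commute)
  also have "?d a * (\<Prod>i\<in>{Suc a..<Suc a + k}. ?d i) = (\<Prod>i\<in>{a..<a + Suc k}. ?d i)"
    by (subst (2) prod.atLeast_Suc_lessThan) auto
  finally show ?case .
qed

lemma sum_shuffles_Cons:
  fixes f :: "'a list \<Rightarrow> 'b::comm_monoid_add"
  assumes "a \<noteq> b"
  shows "(\<Sum>w\<in>shuffles (a # u) (b # v). f w) =
    (\<Sum>w\<in>shuffles u (b # v). f (a # w)) + (\<Sum>w\<in>shuffles (a # u) v. f (b # w))"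
proof -
  have "(#) a ` shuffles u (b # v) \<inter> (#) b ` shuffles (a # u) v = {}" using assms by auto
  then show ?thesis by (simp add: sum.union_disjoint sum.reindex)
qed

lemma sum_word_prod_shuffles:
  assumes "inj_on x (insert r (set u \<union> set v))" "distinct (r # u @ v)"
  shows "(\<Sum>w\<in>shuffles u v. word_prod x (r # w)) = word_prod x (r # u) * word_prod x (r # v)"
  using assms
proof (induction u v arbitrary: r rule: shuffles.induct)
  case (3 a u b v)
  have ne: "x r - x a \<noteq> 0" "x r - x b \<noteq> 0" "x a - x b \<noteq> 0" "x b - x a \<noteq> 0" "a \<noteq> b"
    using 3(3,4) by (auto simp: inj_on_def)
  have a: "(\<Sum>w\<in>shuffles u (b # v). word_prod x (a # w)) =
      word_prod x (a # u) * word_prod x (a # b # v)"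
    using 3(3,4) by (intro 3(1)) (auto simp: inj_on_def)
  have b: "(\<Sum>w\<in>shuffles (a # u) v. word_prod x (b # w)) =
      word_prod x (b # a # u) * word_prod x (b # v)"
    using 3(3,4) by (intro 3(2)) (auto simp: inj_on_def)
  have "(\<Sum>w\<in>shuffles (a # u) (b # v). word_prod x (r # w)) =
      word_prod x (a # u) * word_prod x (a # b # v) / (x r - x a) +
      word_prod x (b # a # u) * word_prod x (b # v) / (x r - x b)"
    using a b
    by (simp add: sum_shuffles_Cons[OF ne(5)] del: shuffles.simps flip: sum_divide_distrib)
  also have "\<dots> = word_prod x (a # u) * word_prod x (b # v) *
      (1 / ((x r - x a) * (x a - x b)) + 1 / ((x r - x b) * (x b - x a)))"
    using ne by (simp add: field_simps)
  also have "1 / ((x r - x a) * (x a - x b)) + 1 / ((x r - x b) * (x b - x a)) =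
      1 / ((x r - x a) * (x r - x b))"
    using ne by (simp add: divide_simps) (simp add: algebra_simps)
  finally show ?case by simp
qed simp_all

lemma sum_word_prod_shuffles_eq_0:
  assumes x: "inj_on x (set u \<union> set v)" "distinct (u @ v)" and "u \<noteq> []" "v \<noteq> []"
  shows "(\<Sum>w\<in>shuffles u v. word_prod x w) = 0"
proof -
  obtain a u' b v' where uv: "u = a # u'" "v = b # v'" using assms(3,4) by (cases u; cases v) auto
  have ne: "x a - x b \<noteq> 0" "a \<noteq> b" using x by (auto simp: inj_on_def uv)
  have "(\<Sum>w\<in>shuffles u' (b # v'). word_prod x (a # w)) =
      word_prod x (a # u') * word_prod x (a # b # v')"
    using x by (intro sum_word_prod_shuffles) (auto simp: uv)
  moreover have "(\<Sum>w\<in>shuffles (a # u') v'. word_prod x (b # w)) =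
      word_prod x (b # a # u') * word_prod x (b # v')"
    using x by (intro sum_word_prod_shuffles) (auto simp: uv insert_commute)
  ultimately have "(\<Sum>w\<in>shuffles u v. word_prod x w) =
      word_prod x (a # u') * word_prod x (a # b # v') +
        word_prod x (b # a # u') * word_prod x (b # v')"
    unfolding uv sum_shuffles_Cons[OF ne(2), of "word_prod x"] by simp
  also have "\<dots> = 0"
    using ne(1) by (simp add: divide_simps) (simp add: algebra_simps)
  finally show ?thesis .
qed

lemma shuffles_iff_filter:
  assumes "\<And>z. z \<in> set u \<Longrightarrow> Q z" "\<And>z. z \<in> set v \<Longrightarrow> \<not> Q z"
  shows "w \<in> shuffles u v \<longleftrightarrow> filter Q w = u \<and> filter (\<lambda>z. \<not> Q z) w = v"
proof
  assume w: "w \<in> shuffles u v"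
  have "filter Q u = u" "filter Q v = []" "filter (\<lambda>z. \<not> Q z) u = []" "filter (\<lambda>z. \<not> Q z) v = v"
    using assms by (auto simp: filter_empty_conv filter_id_conv)
  then show "filter Q w = u \<and> filter (\<lambda>z. \<not> Q z) w = v"
    using w filter_shuffles[of Q u v] filter_shuffles[of "\<lambda>z. \<not> Q z" u v] by auto
qed (use partition_in_shuffles[of w Q] in auto)

lemma sum_word_prod_shuffle_closed_eq_0:
  assumes A: "finite A" "inj_on x A" "a \<in> A" "Q a" "b \<in> A" "\<not> Q b"
    and X: "X \<subseteq> permutations_of_set A"
    and closed: "\<And>w w'. w \<in> X \<Longrightarrow> w' \<in> permutations_of_set A \<Longrightarrow> filter Q w' = filter Q w \<Longrightarrow>
      filter (\<lambda>z. \<not> Q z) w' = filter (\<lambda>z. \<not> Q z) w \<Longrightarrow> w' \<in> X"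
  shows "(\<Sum>w\<in>X. word_prod x w) = 0"
proof -
  define parts where "parts w = (filter Q w, filter (\<lambda>z. \<not> Q z) w)" for w
  have fin: "finite X" using X by (rule finite_subset) (simp add: A(1))
  have fiber: "(\<Sum>w\<in>{w \<in> X. parts w = parts w0}. word_prod x w) = 0" if w0: "w0 \<in> X" for w0
  proof -
    let ?u = "filter Q w0" and ?v = "filter (\<lambda>z. \<not> Q z) w0"
    have w0_perm: "set w0 = A" "distinct w0" using w0 X by (auto dest: permutations_of_setD)
    have disjoint: "set ?u \<inter> set ?v = {}" by auto
    have "w \<in> permutations_of_set A" if "w \<in> shuffles ?u ?v" for w
    proof (rule permutations_of_setI)
      show "set w = A" using set_shuffles[OF that] w0_perm(1) by auto
      show "distinct w"
        using distinct_disjoint_shuffles[OF _ _ disjoint that] w0_perm(2) by simp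
    qed
    moreover have "w \<in> shuffles ?u ?v \<longleftrightarrow> parts w = parts w0" for w
      unfolding parts_def prod.inject by (rule shuffles_iff_filter) auto
    ultimately have "{w \<in> X. parts w = parts w0} = shuffles ?u ?v"
      using closed[OF w0] by (auto simp: parts_def)
    moreover have "?u \<noteq> []" "?v \<noteq> []"
      using A(3-6) w0_perm(1) by (auto simp: filter_empty_conv)
    moreover have "inj_on x (set ?u \<union> set ?v)" "distinct (?u @ ?v)"
      using A(2) w0_perm disjoint by (auto intro: inj_on_subset)
    ultimately show ?thesis by (simp add: sum_word_prod_shuffles_eq_0)
  qed
  have "(\<Sum>w\<in>X. word_prod x w) = (\<Sum>y\<in>parts ` X. \<Sum>w\<in>{w \<in> X. parts w = y}. word_prod x w)"
    by (rule sum.group[symmetric, OF fin finite_imageI[OF fin] order_refl])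
  also have "\<dots> = 0" using fiber by (intro sum.neutral) auto
  finally show ?thesis .
qed


subsection \<open>Klyachko's identity\<close>

definition before :: "'v list \<Rightarrow> 'v \<Rightarrow> 'v \<Rightarrow> bool" where
  "before w i j \<longleftrightarrow> filter (\<lambda>z. z = i \<or> z = j) w = [i, j]"

lemma before_filter: "Q i \<Longrightarrow> Q j \<Longrightarrow> before (filter Q w) i j \<longleftrightarrow> before w i j"
  unfolding before_def filter_filter by (rule arg_cong2[of _ _ _ _ "(=)"]) (auto intro: filter_cong)

lemma before_map_permutation:
  assumes "\<sigma> permutes {1..N}" "i \<in> {1..N}" "j \<in> {1..N}" "i \<noteq> j"
  shows "before (map \<sigma> [1..<N + 1]) i j \<longleftrightarrow> inv' \<sigma> i < inv' \<sigma> j"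
proof -
  let ?a = "inv' \<sigma> i" and ?b = "inv' \<sigma> j"
  note inv = permutes_inverses[OF assms(1)]
  have ab: "?a \<in> {1..N}" "?b \<in> {1..N}" "?a \<noteq> ?b"
    using permutes_in_image[OF permutes_inv[OF assms(1)]] assms inv by (metis (no_types, lifting))+
  have "(\<sigma> k = i \<or> \<sigma> k = j) \<longleftrightarrow> (k = ?a \<or> k = ?b)" for k using inv by auto
  then have "filter (\<lambda>z. z = i \<or> z = j) (map \<sigma> [1..<N + 1]) =
      map \<sigma> (filter (\<lambda>k. k = ?a \<or> k = ?b) [1..<N + 1])"
    by (simp add: filter_map comp_def)
  also have "filter (\<lambda>k. k = ?a \<or> k = ?b) [1..<N + 1] = (if ?a < ?b then [?a, ?b] else [?b, ?a])"
    using ab by (intro sorted_distinct_set_unique sorted_wrt_filter distinct_filter)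
      (auto simp del: upt_Suc)
  finally show ?thesis using inv assms(4) by (auto simp: before_def)
qed

lemma map_upt_increasing_permutation:
  assumes "\<sigma> permutes {1..N}" "\<And>i. i \<in> {1..<N} \<Longrightarrow> \<sigma> i < \<sigma> (i + 1)"
  shows "map \<sigma> [1..<N + 1] = [1..<N + 1]"
proof (rule sorted_distinct_set_unique)
  show "sorted (map \<sigma> [1..<N + 1])"
    unfolding sorted_iff_nth_Suc
  proof (intro allI impI)
    fix i assume "Suc i < length (map \<sigma> [1..<N + 1])"
    then have "Suc i < N" by simp
    then show "map \<sigma> [1..<N + 1] ! i \<le> map \<sigma> [1..<N + 1] ! Suc i"
      using assms(2)[of "Suc i"] by (simp add: less_imp_le One_nat_def del: upt_Suc)
  qed
  show "distinct (map \<sigma> [1..<N + 1])"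
    using permutes_inj_on[OF assms(1)] by (simp add: distinct_map)
  show "set (map \<sigma> [1..<N + 1]) = set [1..<N + 1]"
    using permutes_image[OF assms(1)] by (simp only: set_map set_upt_Suc)
qed auto

lemma bij_betw_map_permutations_of_set:
  assumes "distinct xs"
  shows "bij_betw (\<lambda>\<sigma>. map \<sigma> xs) {\<sigma>. \<sigma> permutes set xs} (permutations_of_set (set xs))"
proof -
  let ?f = "\<lambda>\<sigma>. map \<sigma> xs" and ?P = "{\<sigma>. \<sigma> permutes set xs}"
  have inj: "inj_on ?f ?P"
  proof (rule inj_onI, rule ext)
    fix \<sigma> \<tau> i assume "\<sigma> \<in> ?P" "\<tau> \<in> ?P" "?f \<sigma> = ?f \<tau>"
    then show "\<sigma> i = \<tau> i" by (cases "i \<in> set xs") (auto simp: permutes_not_in)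
  qed
  moreover have "?f ` ?P \<subseteq> permutations_of_set (set xs)"
    using assms permutes_inj_on
    by (auto intro!: permutations_of_setI simp: permutes_image distinct_map)
  moreover have "card (?f ` ?P) = card (permutations_of_set (set xs))"
    using card_image[OF inj] card_permutations[of "set xs" "card (set xs)"] by simp
  ultimately show ?thesis by (simp add: bij_betw_def card_subset_eq)
qed

lemmas bij_betw_permutation_words =
  bij_betw_map_permutations_of_set[of "[1..<N + 1]" for N, unfolded set_upt_Suc, OF distinct_upt]

lemma permutations_all_before:
  "{w \<in> permutations_of_set {1..N}. \<forall>i\<in>{1..<N}. before w i (i + 1)} = {[1..<N + 1]}"
  (is "?X = _")
proof (rule subset_antisym; rule subsetI)
  fix w assume w: "w \<in> ?X"
  then have "w \<in> (\<lambda>\<sigma>. map \<sigma> [1..<N + 1]) ` {\<sigma>. \<sigma> permutes {1..N}}"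
    using bij_betw_permutation_words[of N] unfolding bij_betw_def by blast
  then obtain \<sigma> where \<sigma>: "w = map \<sigma> [1..<N + 1]" "\<sigma> permutes {1..N}" by blast
  have "inv' \<sigma> i < inv' \<sigma> (i + 1)" if i: "i \<in> {1..<N}" for i
  proof -
    have "before w i (i + 1)" using w i by blast
    then show ?thesis using before_map_permutation[OF \<sigma>(2), of i "i + 1"] i by (simp add: \<sigma>(1))
  qed
  then have id: "map (inv' \<sigma>) [1..<N + 1] = [1..<N + 1]"
    by (intro map_upt_increasing_permutation permutes_inv[OF \<sigma>(2)])
  have "w = map \<sigma> (map (inv' \<sigma>) [1..<N + 1])" by (simp only: id \<sigma>(1))
  also have "\<dots> = [1..<N + 1]" by (simp add: permutes_inverses[OF \<sigma>(2)] comp_def)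
  finally show "w \<in> {[1..<N + 1]}" by simp
next
  fix w assume "w \<in> {[1..<N + 1]}"
  then have w: "w = map id [1..<N + 1]" by simp
  have "before w i (i + 1)" if "i \<in> {1..<N}" for i
    unfolding w using that by (subst before_map_permutation[OF permutes_id]) (auto simp: inv_id)
  moreover have "w \<in> permutations_of_set {1..N}" unfolding w by (intro permutations_of_setI) auto
  ultimately show "w \<in> ?X" by blast
qed

lemma sum_word_prod_constrained:
  assumes x: "inj_on x {1..N}" and S: "S \<subseteq> {1..<N}"
  shows "(\<Sum>w\<in>{w \<in> permutations_of_set {1..N}. \<forall>i\<in>S. before w i (i + 1)}. word_prod x w) =
    (if S = {1..<N} then word_prod x [1..<N + 1] else 0)"
proof (cases "S = {1..<N}")
  case True
  then show ?thesis by (simp add: permutations_all_before del: upt_Suc)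
next
  case False
  then obtain k where k: "k \<in> {1..<N}" "k \<notin> S" using S by blast
  have "(\<Sum>w\<in>{w \<in> permutations_of_set {1..N}. \<forall>i\<in>S. before w i (i + 1)}. word_prod x w) = 0"
  proof (rule sum_word_prod_shuffle_closed_eq_0[where Q = "\<lambda>z. z \<le> k" and a = 1 and b = N])
    fix w w' assume w: "w \<in> {w \<in> permutations_of_set {1..N}. \<forall>i\<in>S. before w i (i + 1)}"
      and w': "w' \<in> permutations_of_set {1..N}" "filter (\<lambda>z. z \<le> k) w' = filter (\<lambda>z. z \<le> k) w"
        "filter (\<lambda>z. \<not> z \<le> k) w' = filter (\<lambda>z. \<not> z \<le> k) w"
    have "before w' i (i + 1)" if "i \<in> S" for i
    proof -
      have "before w i (i + 1)" "i \<noteq> k" using w that k by auto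
      moreover from this have "i + 1 \<le> k \<or> k < i" by linarith
      ultimately show ?thesis
        using before_filter[of "\<lambda>z. z \<le> k" i "i + 1"] before_filter[of "\<lambda>z. \<not> z \<le> k" i "i + 1"] w'
        by (metis add_leD1 leD leI less_add_same_cancel1 less_trans zero_less_one)
    qed
    then show "w' \<in> {w \<in> permutations_of_set {1..N}. \<forall>i\<in>S. before w i (i + 1)}" using w'(1) by blast
  qed (use x k in auto)
  then show ?thesis using False by simp
qed

lemma prod_if_eq_sum_Pow:
  fixes c :: "'i \<Rightarrow> 'f::comm_ring_1"
  assumes "finite A"
  shows "(\<Prod>i\<in>A. if P i then 1 else c i) =
    (\<Sum>S\<in>Pow A. (\<Prod>i\<in>S. 1 - c i) * (\<Prod>i\<in>A - S. c i) * (if \<forall>i\<in>S. P i then 1 else 0))"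
proof -
  have "(\<Prod>i\<in>A. if P i then 1 else c i) = (\<Prod>i\<in>A. (1 - c i) * (if P i then 1 else 0) + c i)"
    by (intro prod.cong) auto
  also have "\<dots> = (\<Sum>S\<in>Pow A. (\<Prod>i\<in>S. (1 - c i) * (if P i then 1 else 0)) * (\<Prod>i\<in>A - S. c i))"
    by (rule prod_add[OF assms])
  also have "\<dots> =
      (\<Sum>S\<in>Pow A. (\<Prod>i\<in>S. 1 - c i) * (\<Prod>i\<in>A - S. c i) * (if \<forall>i\<in>S. P i then 1 else 0))"
  proof (rule sum.cong[OF refl])
    fix S assume "S \<in> Pow A"
    then have "finite S" using finite_subset assms by blast
    then have "(\<Prod>i\<in>S. if P i then 1 else 0 :: 'f) = (if \<forall>i\<in>S. P i then 1 else 0)"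
      by (induction S) auto
    then show "(\<Prod>i\<in>S. (1 - c i) * (if P i then 1 else 0)) * (\<Prod>i\<in>A - S. c i) =
        (\<Prod>i\<in>S. 1 - c i) * (\<Prod>i\<in>A - S. c i) * (if \<forall>i\<in>S. P i then 1 else 0)"
      by (simp add: prod.distrib)
  qed
  finally show ?thesis .
qed

text \<open>
  Each factor is \<open>c i + (1 - c i) [i before i + 1]\<close>; after expanding the product, every term but
  the full one is a sum over shuffles and vanishes.
\<close>

theorem klyachko_sum:
  fixes x :: "nat \<Rightarrow> 'f::field"
  assumes x: "inj_on x {1..N}"
  shows "(\<Sum>w\<in>permutations_of_set {1..N}.
      (\<Prod>i\<in>{1..<N}. if before w i (i + 1) then 1 else c i) * word_prod x w) =
    (\<Prod>i\<in>{1..<N}. 1 - c i) * word_prod x [1..<N + 1]"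
proof -
  let ?W = "permutations_of_set {1..N}"
  let ?k = "\<lambda>S. (\<Prod>i\<in>S. 1 - c i) * (\<Prod>i\<in>{1..<N} - S. c i)"
  let ?before = "\<lambda>w S. if \<forall>i\<in>S. before w i (i + 1) then 1 else 0"
  have "(\<Sum>w\<in>?W. (\<Prod>i\<in>{1..<N}. if before w i (i + 1) then 1 else c i) * word_prod x w) =
      (\<Sum>S\<in>Pow {1..<N}. \<Sum>w\<in>?W. ?k S * (?before w S * word_prod x w))"
    unfolding prod_if_eq_sum_Pow[OF finite_atLeastLessThan] sum_distrib_right
    by (subst sum.swap) (simp add: mult.assoc)
  also have "\<dots> = (\<Sum>S\<in>Pow {1..<N}. ?k S * (if S = {1..<N} then word_prod x [1..<N + 1] else 0))"
  proof (rule sum.cong[OF refl])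
    fix S assume "S \<in> Pow {1..<N}"
    then have S: "S \<subseteq> {1..<N}" by simp
    have "(\<Sum>w\<in>?W. ?before w S * word_prod x w) =
        (\<Sum>w\<in>{w \<in> ?W. \<forall>i\<in>S. before w i (i + 1)}. word_prod x w)"
      by (intro sum.mono_neutral_cong_right) auto
    then show "(\<Sum>w\<in>?W. ?k S * (?before w S * word_prod x w)) =
        ?k S * (if S = {1..<N} then word_prod x [1..<N + 1] else 0)"
      unfolding sum_distrib_left[symmetric] sum_word_prod_constrained[OF x S, symmetric] by simp
  qed
  also have "\<dots> = (\<Sum>S\<in>{{1..<N}}. ?k S * (if S = {1..<N} then word_prod x [1..<N + 1] else 0))"
    by (rule sum.mono_neutral_right) auto
  finally show ?thesis by simp
qed


subsection \<open>Products over trees\<close>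

interpretation int_module: Modules.module "\<lambda>(c::int) (y::'a::ring_1). of_int c * y"
  by unfold_locales (simp_all add: algebra_simps)

abbreviation word_span :: "('v \<Rightarrow> 'f::field) \<Rightarrow> 'v set \<Rightarrow> 'f set" where
  "word_span x A \<equiv> int_module.span (word_prod x ` permutations_of_set A)"

definition edge_prod :: "('v \<Rightarrow> 'f::field) \<Rightarrow> ('v \<times> 'v) multiset \<Rightarrow> 'f" where
  "edge_prod x E = (\<Prod>e\<in>#E. 1 / (x (fst e) - x (snd e)))"

lemma edge_prod_add_mset:
  "edge_prod x (add_mset e E) = edge_prod x E / (x (fst e) - x (snd e))"
  by (simp add: edge_prod_def)

lemma word_prod_attach_leaf:
  assumes x: "inj_on x (insert v A)" and j: "j \<in> A" and v: "v \<notin> A"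
    and w: "w \<in> permutations_of_set A"
  shows "word_prod x w / (x j - x v) \<in> word_span x (insert v A)"
proof -
  have w_perm: "set w = A" "distinct w" using permutations_of_setD[OF w] by auto
  then obtain a b where ab: "w = a @ j # b" using j by (metis split_list)
  have "word_prod x w / (x j - x v) =
      word_prod x (a @ [j]) * (word_prod x (j # b) * word_prod x (j # [v]))"
    unfolding ab by (subst word_prod_append) simp
  also have "word_prod x (j # b) * word_prod x (j # [v]) =
      (\<Sum>u\<in>shuffles b [v]. word_prod x (j # u))"
  proof (rule sum_word_prod_shuffles[symmetric])
    show "inj_on x (insert j (set b \<union> set [v]))"
      using w_perm ab by (intro inj_on_subset[OF x]) auto
    show "distinct (j # b @ [v])" using w_perm ab v by auto
  qed
  also have "word_prod x (a @ [j]) * \<dots> = (\<Sum>u\<in>shuffles b [v]. word_prod x (a @ j # u))"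
    by (subst (2) word_prod_append) (simp add: sum_distrib_left)
  also have "\<dots> \<in> word_span x (insert v A)"
  proof (intro int_module.span_sum int_module.span_base imageI permutations_of_setI)
    fix u assume u: "u \<in> shuffles b [v]"
    have vb: "v \<notin> set b" "distinct b" using w_perm ab v by auto
    have "set u = insert v (set b)" using set_shuffles[OF u] by auto
    moreover have "distinct u" using distinct_disjoint_shuffles[OF _ _ _ u] vb by auto
    ultimately show "set (a @ j # u) = insert v A" "distinct (a @ j # u)"
      using w_perm ab v by auto
  qed
  finally show ?thesis .
qed

lemma word_span_attach_leaf:
  assumes "inj_on x (insert v A)" "j \<in> A" "v \<notin> A" "y \<in> word_span x A"
  shows "y / (x j - x v) \<in> word_span x (insert v A)"
proof -
  interpret division: module_hom "\<lambda>c y. of_int c * y" "\<lambda>c y. of_int c * y" "\<lambda>y. y / (x j - x v)"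
    by unfold_locales (simp_all add: add_divide_distrib)
  have "(\<lambda>y. y / (x j - x v)) ` word_span x A \<subseteq> word_span x (insert v A)"
    by (rule division.image_span_subset) (use word_prod_attach_leaf[OF assms(1-3)] in auto)
  then show ?thesis using assms(4) by blast
qed

lemma edge_prod_attach_leaf:
  assumes x: "inj_on x (S \<union> {fst e, snd e})" and e: "crosses S e"
    and F: "edge_prod x F \<in> word_span x S"
  shows "edge_prod x (add_mset e F) \<in> word_span x (S \<union> {fst e, snd e})"
proof (cases "fst e \<in> S")
  case True
  then have "snd e \<notin> S" "S \<union> {fst e, snd e} = insert (snd e) S" using e by (auto simp: crosses_def)
  then show ?thesis
    using word_span_attach_leaf[of x "snd e" S "fst e"] True F x by (simp add: edge_prod_add_mset)
next
  case False
  then have "snd e \<in> S" "S \<union> {fst e, snd e} = insert (fst e) S" using e by (auto simp: crosses_def)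
  then have "edge_prod x F / (x (snd e) - x (fst e)) \<in> word_span x (S \<union> {fst e, snd e})"
    using word_span_attach_leaf[of x "fst e" S "snd e"] False F x by simp
  then have "- (edge_prod x F / (x (snd e) - x (fst e))) \<in> word_span x (S \<union> {fst e, snd e})"
    by (rule int_module.span_neg)
  moreover have "- (y / (x (snd e) - x (fst e))) = y / (x (fst e) - x (snd e))" for y
    by (metis minus_diff_eq minus_divide_right)
  ultimately show ?thesis by (simp add: edge_prod_add_mset)
qed

text \<open>Grow the tree one crossing edge at a time; each new edge attaches a leaf.\<close>

lemma edge_prod_partial_tree:
  assumes connected: "connected_multigraph U E" and U: "finite U"
    and inside: "\<And>e. e \<in># E \<Longrightarrow> fst e \<in> U \<and> snd e \<in> U" and x: "inj_on x U" and "k < card U"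
  shows "\<exists>S F. S \<subseteq> U \<and> card S = Suc k \<and> F \<subseteq># E \<and> size F = k \<and>
    (\<forall>e\<in>#F. \<not> crosses S e \<and> fst e \<in> S) \<and> edge_prod x F \<in> word_span x S"
  using \<open>k < card U\<close>
proof (induction k)
  case 0
  then obtain u where "u \<in> U" by fastforce
  moreover have "1 \<in> word_span x {u}"
    using int_module.span_base[of "word_prod x [u]" "word_prod x ` permutations_of_set {u}"] by simp
  ultimately show ?case
    by (intro exI[of _ "{u}"] exI[of _ "{#}"]) (auto simp: edge_prod_def)
next
  case (Suc k)
  then obtain S F where S: "S \<subseteq> U" "card S = Suc k" and F: "F \<subseteq># E" "size F = k"
    "\<forall>e\<in>#F. \<not> crosses S e \<and> fst e \<in> S" "edge_prod x F \<in> word_span x S"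
    by auto
  have "S \<noteq> U" "S \<noteq> {}" using S(2) Suc.prems by auto
  then obtain s u where "s \<in> S" "u \<in> U" "u \<notin> S" using S(1) by blast
  then have "(s, u) \<in> reachable E"
    using connected S(1) by (auto simp: connected_multigraph_iff_reachable)
  then obtain e where e: "e \<in># E" "crosses S e"
    using \<open>s \<in> S\<close> \<open>u \<notin> S\<close> by (rule reachable_crossing_edge)
  let ?S = "S \<union> {fst e, snd e}"
  have "card ?S = Suc (Suc k)"
    using e(2) S(2) finite_subset[OF S(1) U] by (auto simp: crosses_def insert_absorb)
  moreover have "?S \<subseteq> U" using S(1) inside[OF e(1)] by auto
  moreover from this have "edge_prod x (add_mset e F) \<in> word_span x ?S"
    by (intro edge_prod_attach_leaf e(2) F(4) inj_on_subset[OF x])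
  moreover have "e \<notin># F" using F(3) e(2) by blast
  then have "F \<subseteq># E - {#e#}"
    using mset_subset_eq_count[OF F(1)] by (intro mset_subset_eqI) (auto simp: not_in_iff)
  then have "add_mset e F \<subseteq># E" using e(1) by (simp add: insert_subset_eq_iff)
  moreover have "\<forall>e'\<in>#add_mset e F. \<not> crosses ?S e' \<and> fst e' \<in> ?S"
    using F(3) by (auto simp: crosses_def)
  ultimately show ?case using F(2) by (intro exI[of _ ?S] exI[of _ "add_mset e F"]) simp
qed

theorem edge_prod_spanning_tree:
  assumes "connected_multigraph U E" "finite U" "U \<noteq> {}" "size E = card U - 1"
    and "\<And>e. e \<in># E \<Longrightarrow> fst e \<in> U \<and> snd e \<in> U" "inj_on x U"
  shows "edge_prod x E \<in> word_span x U"
proof -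
  have "card U > 0" using assms(2,3) by (simp add: card_gt_0_iff)
  then obtain S F where S: "S \<subseteq> U" "card S = card U" and F: "F \<subseteq># E" "size F = card U - 1"
    "edge_prod x F \<in> word_span x S"
    using edge_prod_partial_tree[OF assms(1,2,5,6), of "card U - 1"] by auto
  have "S = U" using S assms(2) card_subset_eq by blast
  moreover have "F = E"
    using F(1,2) assms(4) by (metis mset_subset_size subset_mset.le_imp_less_or_eq nat_neq_iff)
  ultimately show ?thesis using F(3) by simp
qed


section \<open>The Vandermonde product\<close>

definition vandermonde :: "nat \<Rightarrow> cpoly" where
  "vandermonde n = (\<Prod>e\<in>all_edges n. pvar (fst e) - pvar (snd e))"

lemma vandermonde_neq_0: "vandermonde n \<noteq> 0"
  by (auto simp: vandermonde_def pvar_eq_iff mem_all_edges)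

lemma graph_poly_complete_multigraph: "graph_poly (complete_multigraph l l n) = vandermonde n ^ l"
proof -
  have rep: "graph_poly (replicate_mset k e) = (pvar (fst e) - pvar (snd e)) ^ k" for k e
    by (induction k) (simp_all add: graph_poly_add_mset)
  have "graph_poly (\<Sum>e\<in>A. replicate_mset l e) = (\<Prod>e\<in>A. pvar (fst e) - pvar (snd e)) ^ l"
    if "finite A" for A
    using that by induction (simp_all add: graph_poly_union rep power_mult_distrib)
  then show ?thesis
    by (simp add: complete_multigraph_eq_sum_all_edges vandermonde_def edge_mult_def)
qed

lemma permute_vandermonde_cases:
  assumes "\<sigma> permutes {1..n + 1}"
  shows "permute_vars \<sigma> (vandermonde n) \<in> {vandermonde n, - vandermonde n}"
proof -
  have "vandermonde n = permute_vars \<sigma> (vandermonde n) \<or>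
      vandermonde n = - permute_vars \<sigma> (vandermonde n)"
    using complete_multigraph_permute[OF assms, of 1 1] graph_poly_complete_multigraph[of 1 n]
      graph_poly_permute_edges[of \<sigma> "complete_multigraph 1 1 n"]
    by simp
  then show ?thesis by (metis insertCI minus_minus)
qed

lemma csubst_identify_vars_eq_0:
  assumes "permute_vars (Transposition.transpose a b) p = - p"
  shows "csubst (\<lambda>i. pvar (if i = b then a else i)) p = 0"
proof -
  let ?\<kappa> = "csubst (\<lambda>i. pvar (if i = b then a else i))"
  have "(\<lambda>i. ?\<kappa> (pvar (Transposition.transpose a b i))) = (\<lambda>i. pvar (if i = b then a else i))"
    by (auto simp: fun_eq_iff csubst_pvar transpose_def)
  then have "?\<kappa> (permute_vars (Transposition.transpose a b) p) = ?\<kappa> p"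
    unfolding permute_vars_csubst pconst.psubst_psubst by simp
  then have "?\<kappa> p = - ?\<kappa> p" by (simp add: assms csubst.hom_uminus)
  then have "2 * ?\<kappa> p = 0" by (simp only: mult_2 eq_neg_iff_add_eq_0)
  then show ?thesis by simp
qed

text \<open>
  If a transposition of \<open>a\<close> and \<open>b\<close> fixed the product, it would negate the product of the factors
  other than \<open>x\<^sub>a - x\<^sub>b\<close>; but that one does not vanish after identifying \<open>x\<^sub>a\<close> with \<open>x\<^sub>b\<close>.
\<close>

lemma permute_vandermonde_transpose_less:
  assumes ab: "a \<in> {1..n + 1}" "b \<in> {1..n + 1}" "a < b"
  shows "permute_vars (Transposition.transpose a b) (vandermonde n) = - vandermonde n"
proof (rule ccontr)
  let ?\<tau> = "Transposition.transpose a b"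
  define d where "d = pvar a - pvar b"
  define D where "D = (\<Prod>e\<in>all_edges n - {(a, b)}. pvar (fst e) - pvar (snd e))"
  assume "permute_vars ?\<tau> (vandermonde n) \<noteq> - vandermonde n"
  then have "permute_vars ?\<tau> (vandermonde n) = vandermonde n"
    using permute_vandermonde_cases[OF permutes_swap_id[OF ab(1,2)]] by blast
  moreover have "vandermonde n = d * D"
    using ab prod.remove[OF finite_all_edges, of "(a, b)" n "\<lambda>e. pvar (fst e) - pvar (snd e)"]
    by (simp add: vandermonde_def mem_all_edges d_def D_def)
  moreover have "permute_vars ?\<tau> d = - d"
    by (simp add: d_def permute_vars.hom_minus permute_vars_pvar)
  ultimately have "d * (- permute_vars ?\<tau> D) = d * D" by (simp add: permute_vars.hom_mult)
  moreover have "d \<noteq> 0" using ab(3) by (simp add: d_def pvar_eq_iff)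
  ultimately have "- permute_vars ?\<tau> D = D" by (metis mult_left_cancel)
  then have "permute_vars ?\<tau> D = - D" by (metis minus_minus)
  then have "csubst (\<lambda>i. pvar (if i = b then a else i)) D = 0" by (rule csubst_identify_vars_eq_0)
  then obtain e where "e \<in> all_edges n - {(a, b)}"
    "(if fst e = b then a else fst e) = (if snd e = b then a else snd e)"
    by (auto simp: D_def csubst.hom_prod csubst.hom_minus csubst_pvar pvar_eq_iff)
  then show False using ab(3) by (cases e) (auto simp: mem_all_edges split: if_splits)
qed

lemma permute_vandermonde:
  assumes "\<sigma> permutes {1..n + 1}"
  shows "permute_vars \<sigma> (vandermonde n) = pscale (sign_char \<sigma>) (vandermonde n)"
  using assms finite_atLeastAtMost
proof (induction rule: permutes_induct)
  case id
  show ?case using permute_vars_id[of "vandermonde n"] by (simp add: sign_char_def id_def)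
next
  case (swap a b p)
  have "permute_vars (Transposition.transpose a b) (vandermonde n) = - vandermonde n"
    using permute_vandermonde_transpose_less[of a n b] permute_vandermonde_transpose_less[of b n a]
      swap(1-3)
    by (cases a b rule: linorder_cases) (auto simp: transpose_commute)
  moreover have "sign (Transposition.transpose a b \<circ> p) = - sign p"
  proof -
    have "permutation p"
      unfolding permutation_permutes using swap by (intro exI[of _ "{1..n + 1}"]) simp
    then show ?thesis
      using swap.hyps(3) by (simp add: sign_compose permutation_swap_id sign_swap_id)
  qed
  ultimately have "permute_vars (Transposition.transpose a b \<circ> p) (vandermonde n) =
      pscale (sign_char (Transposition.transpose a b \<circ> p)) (vandermonde n)"
    unfolding permute_vars_compose swap.IH by (simp add: permute_vars.scale sign_char_def)
  then show ?case by (simp add: comp_def)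
qed

lemma sign_char_power_square: "sign_char \<sigma> ^ l * sign_char \<sigma> ^ l = 1"
proof -
  have "sign_char \<sigma> * sign_char \<sigma> = 1" by (simp add: sign_char_def flip: of_int_mult)
  then show ?thesis by (simp flip: power_mult_distrib)
qed

lemma sign_char_compose:
  "finite A \<Longrightarrow> \<sigma> permutes A \<Longrightarrow> \<tau> permutes A \<Longrightarrow> sign_char (\<sigma> \<circ> \<tau>) = sign_char \<sigma> * sign_char \<tau>"
  using permutation_permutes[of \<sigma>] permutation_permutes[of \<tau>]
  by (auto simp: sign_char_def sign_compose)

lemma permute_vandermonde_power:
  assumes "\<sigma> permutes {1..n + 1}"
  shows "permute_vars \<sigma> (vandermonde n ^ l) = pscale (sign_char \<sigma> ^ l) (vandermonde n ^ l)"
  by (simp add: permute_vars.hom_power permute_vandermonde[OF assms] pscale_def power_mult_distrib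
      pconst.hom_power)


section \<open>The top degree component\<close>

definition top_degree :: "nat \<Rightarrow> nat \<Rightarrow> nat \<Rightarrow> nat" where
  "top_degree l m n = (\<Sum>j<n. l - 1 + m * j)"

lemma size_complete_multigraph_top_degree:
  assumes "l \<ge> 1"
  shows "size (complete_multigraph l m n) = top_degree l m n + n"
proof -
  have "(\<Sum>j<n. l + m * j) = (\<Sum>j<n. l - 1 + m * j + 1)" using assms by (intro sum.cong) auto
  then show ?thesis by (simp add: size_complete_multigraph top_degree_def sum.distrib)
qed

lemma parking_degree_le_top_degree:
  assumes "l \<ge> 1" "f \<in> parking_degree l m n k"
  shows "k \<le> top_degree l m n"
proof -
  have "k = (\<Sum>j<n. sorted_exponents n f ! j)"
    using assms by (simp add: parking_degree_iff_ballot sum_list_sum_nth atLeast0LessThan)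
  also have "\<dots> \<le> top_degree l m n"
    using assms unfolding top_degree_def
    by (intro sum_mono) (simp add: parking_degree_iff_ballot ballot_def)
  finally show ?thesis .
qed

lemma inj_on_map_key_exponent_vector:
  assumes "distinct w"
  shows "inj_on (\<lambda>\<sigma>. map_key \<sigma> (exponent_vector w)) {\<sigma>. \<sigma> permutes {1..length w}}"
proof (rule inj_onI, rule ext)
  fix \<sigma> \<tau> i
  assume "\<sigma> \<in> {\<sigma>. \<sigma> permutes {1..length w}}" "\<tau> \<in> {\<sigma>. \<sigma> permutes {1..length w}}"
    and eq: "map_key \<sigma> (exponent_vector w) = map_key \<tau> (exponent_vector w)"
  then have \<sigma>: "\<sigma> permutes {1..length w}" and \<tau>: "\<tau> permutes {1..length w}" by auto
  show "\<sigma> i = \<tau> i"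
  proof (cases "i \<in> {1..length w}")
    case True
    then have in_range: "\<sigma> i \<in> {1..length w}" "\<tau> i \<in> {1..length w}"
      using permutes_in_image[OF \<sigma>] permutes_in_image[OF \<tau>] by blast+
    have "lookup (exponent_vector w) (\<sigma> i) = lookup (exponent_vector w) (\<tau> i)"
      using arg_cong[OF eq, of "\<lambda>f. lookup f i"]
      by (simp add: lookup_map_key_permutes[OF \<sigma>] lookup_map_key_permutes[OF \<tau>])
    then have "w ! (\<sigma> i - 1) = w ! (\<tau> i - 1)"
      using in_range unfolding lookup_exponent_vector by (simp only: if_True)
    then have "\<sigma> i - 1 = \<tau> i - 1" using in_range assms by (subst (asm) nth_eq_iff_index_eq) auto
    then show ?thesis using in_range by auto
  qed (simp add: permutes_not_in[OF \<sigma>] permutes_not_in[OF \<tau>])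
qed

lemma top_parking_functions:
  assumes "l \<ge> 1" "m \<ge> 1"
  obtains T where "T \<subseteq> parking_degree l m n (top_degree l m n)" "finite T" "card T = fact n"
proof
  define w where "w = map (\<lambda>j. l - 1 + m * j) [0..<n]"
  let ?f = "\<lambda>\<sigma>. map_key \<sigma> (exponent_vector w)"
  have [simp]: "length w = n" by (simp add: w_def)
  have "sorted w" by (auto simp: w_def sorted_iff_nth_mono)
  then have exponents: "sorted_exponents n (exponent_vector w) = w"
    using sorted_exponents_exponent_vector[of w] by (simp add: sorted_sort_id)
  have ballot: "ballot l m w" using \<open>sorted w\<close> by (simp add: ballot_def w_def)
  have sum: "sum_list w = top_degree l m n"
    by (simp add: w_def top_degree_def interv_sum_list_conv_sum_set_nat atLeast0LessThan)
  show "?f ` {\<sigma>. \<sigma> permutes {1..n}} \<subseteq> parking_degree l m n (top_degree l m n)"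
  proof (rule image_subsetI)
    fix \<sigma> assume "\<sigma> \<in> {\<sigma>. \<sigma> permutes {1..n}}"
    then show "?f \<sigma> \<in> parking_degree l m n (top_degree l m n)"
      using keys_exponent_vector[of w] keys_map_key_permutes[of \<sigma> "{1..n}" "exponent_vector w"]
      by (simp add: parking_degree_iff_ballot[OF assms(1)] sorted_exponents_map_key exponents
          ballot sum)
  qed
  have "distinct w" using assms(2) by (auto simp: w_def distinct_map inj_on_def)
  then show "card (?f ` {\<sigma>. \<sigma> permutes {1..n}}) = fact n"
    using inj_on_map_key_exponent_vector[of w] by (simp add: card_image card_permutations)
qed (simp add: finite_permutations)

lemma slim_component_above_top:
  assumes "l \<ge> 1" "k > top_degree l m n"
  shows "slim_component l m n k = {0}"
proof (rule subset_antisym)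
  have "p = 0" if "p \<in> slim_component l m n k" for p
    using that by (rule slim_component_eq_0I)
      (use parking_degree_le_top_degree[OF assms(1)] assms(2) in \<open>auto simp: not_le[symmetric]\<close>)
  then show "slim_component l m n k \<subseteq> {0}" by blast
qed (use cpoly.subspace_0[OF subspace_slim_component] in blast)

lemma slim_component_top_nonzero:
  assumes "l \<ge> 1" "m \<ge> 1"
  shows "slim_component l m n (top_degree l m n) \<noteq> {0}"
proof -
  obtain T where T: "T \<subseteq> parking_degree l m n (top_degree l m n)" "card T = fact n"
    using top_parking_functions[OF assms] by metis
  then have "T \<noteq> {}" by auto
  then obtain f where f: "f \<in> parking_degree l m n (top_degree l m n)" using T(1) by blast
  obtain p where "p \<in> slim_component l m n (top_degree l m n)"
    "\<And>f. f \<in> parking_degree l m n (top_degree l m n) \<Longrightarrow> lookup p f = 1"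
    using slim_component_prescribed_coeffs[of l m n "top_degree l m n" "\<lambda>_. 1"] by metis
  moreover from this(2)[OF f] have "p \<noteq> 0" by auto
  ultimately show ?thesis by blast
qed


subsection \<open>The spanning set of permuted path products\<close>

definition path_graph :: "nat \<Rightarrow> (nat \<times> nat) multiset" where
  "path_graph n = mset_set ((\<lambda>i. (i, i + 1)) ` {1..n})"

lemma graph_poly_path: "graph_poly (path_graph n) = (\<Prod>i\<in>{1..n}. pvar i - pvar (i + 1))"
  unfolding graph_poly_def path_graph_def
  by (simp add: prod_unfold_prod_mset[symmetric] prod.reindex inj_on_def case_prod_unfold)

lemma size_path_graph: "size (path_graph n) = n"
  by (simp add: path_graph_def card_image inj_on_def)

lemma path_graph_subset:
  assumes "l \<ge> 1" "m \<ge> 1"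
  shows "path_graph n \<subseteq># complete_multigraph l m n"
proof (rule mset_subset_eqI)
  fix e
  have "(\<lambda>i. (i, i + 1)) ` {1..n} \<subseteq> all_edges n" by (auto simp: mem_all_edges)
  then show "count (path_graph n) e \<le> count (complete_multigraph l m n) e"
    using assms unfolding count_complete_multigraph
    by (cases "e \<in> (\<lambda>i. (i, i + 1)) ` {1..n}") (auto simp: path_graph_def edge_mult_def subset_iff)
qed

lemma connected_path_graph: "connected_multigraph {1..n + 1} (path_graph n)"
proof (rule connected_multigraph_if_all_reach)
  have from_Suc: "(Suc k, 1) \<in> reachable (path_graph n)" if "k \<le> n" for k
    using that
  proof (induction k)
    case (Suc k)
    then have "(Suc k, Suc (Suc k)) \<in># path_graph n" by (auto simp: path_graph_def)
    then have "(Suc (Suc k), Suc k) \<in> reachable (path_graph n)" by (simp add: reachable_edge)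
    moreover have "(Suc k, 1) \<in> reachable (path_graph n)" using Suc by simp
    ultimately show ?case by (rule reachable_trans)
  qed (simp add: One_nat_def)
  show "(u, 1) \<in> reachable (path_graph n)" if "u \<in> {1..n + 1}" for u
    using from_Suc[of "u - 1"] that by auto
qed

definition path_poly :: "nat \<Rightarrow> nat \<Rightarrow> nat \<Rightarrow> cpoly" where
  "path_poly l m n = graph_poly (complete_multigraph l m n - path_graph n)"

lemma path_poly_in_slim_component:
  assumes "l \<ge> 1" "m \<ge> 1"
  shows "path_poly l m n \<in> slim_component l m n (top_degree l m n)"
proof -
  let ?K = "complete_multigraph l m n"
  note sub = path_graph_subset[OF assms, of n]
  have "?K - (?K - path_graph n) = path_graph n"
    using sub by (metis subset_mset.add_diff_inverse add_diff_cancel_right')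
  then have "slim l m n (?K - path_graph n)"
    using connected_path_graph by (simp add: slim_def)
  moreover have "size (?K - path_graph n) = top_degree l m n"
    using sub size_complete_multigraph_top_degree[OF assms(1)]
    by (simp add: size_Diff_submset size_path_graph)
  ultimately show ?thesis
    unfolding path_poly_def slim_component_eq_span by (intro cpoly.span_base) blast
qed

definition path_form :: "nat \<Rightarrow> nat \<Rightarrow> (nat \<Rightarrow> nat) \<Rightarrow> cpoly" where
  "path_form l n \<sigma> = pscale (sign_char \<sigma> ^ l) (permute_vars \<sigma> (path_poly l l n))"

abbreviation xfrac :: "nat \<Rightarrow> cpoly fract" where
  "xfrac i \<equiv> to_fract (pvar i)"

lemma inj_xfrac: "inj_on xfrac A"
  by (simp add: inj_on_def pvar_eq_iff)

lemma edge_prod_xfrac: "edge_prod xfrac E = inverse (to_fract (graph_poly E))"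
  by (induction E)
    (simp_all add: edge_prod_def graph_poly_add_mset divide_inverse mult.commute
      to_fract_hom.hom_mult to_fract_hom.hom_minus)

lemma to_fract_eq_quotient:
  assumes "p * q = v" "q \<noteq> (0 :: 'a::idom)"
  shows "to_fract p = to_fract v * inverse (to_fract q)"
proof -
  have "to_fract v = to_fract p * to_fract q" using assms(1) by auto
  then show ?thesis using assms(2) by (simp add: mult.assoc)
qed

lemma to_fract_graph_poly:
  assumes "G \<subseteq># complete_multigraph l l n"
  shows "to_fract (graph_poly G) =
    to_fract (vandermonde n ^ l) * edge_prod xfrac (complete_multigraph l l n - G)"
proof -
  have "graph_poly G * graph_poly (complete_multigraph l l n - G) = vandermonde n ^ l"
    using assms by (simp flip: graph_poly_union graph_poly_complete_multigraph)
  moreover from this have "graph_poly (complete_multigraph l l n - G) \<noteq> 0"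
    using vandermonde_neq_0[of n] by auto
  ultimately show ?thesis
    unfolding edge_prod_xfrac by (rule to_fract_eq_quotient)
qed

context
  fixes l n :: nat
  assumes l: "l \<ge> 1"
begin

lemma path_form_in_slim_component:
  assumes "\<sigma> permutes {1..n + 1}"
  shows "path_form l n \<sigma> \<in> slim_component l l n (top_degree l l n)"
  unfolding path_form_def using assms path_poly_in_slim_component[OF l l]
  by (intro cpoly.subspace_scale[OF subspace_slim_component] permute_vars_slim_component) simp_all

lemma permute_path_form:
  assumes "\<sigma> permutes {1..n + 1}" "\<tau> permutes {1..n + 1}"
  shows "permute_vars \<tau> (path_form l n \<sigma>) = pscale (sign_char \<tau> ^ l) (path_form l n (\<tau> \<circ> \<sigma>))"
proof -
  have "sign_char \<tau> ^ l * sign_char (\<tau> \<circ> \<sigma>) ^ l = sign_char \<sigma> ^ l"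
    using sign_char_power_square[of \<tau> l]
    by (simp add: sign_char_compose[OF _ assms(2,1)] power_mult_distrib flip: mult.assoc)
  then show ?thesis
    by (simp add: path_form_def permute_vars.scale permute_vars_compose)
qed

lemma to_fract_path_form:
  assumes \<sigma>: "\<sigma> permutes {1..n + 1}"
  shows "to_fract (path_form l n \<sigma>) =
    to_fract (vandermonde n ^ l) * word_prod xfrac (map \<sigma> [1..<n + 1 + 1])"
proof -
  let ?Q = "\<Prod>i\<in>{1..n}. pvar (\<sigma> i) - pvar (\<sigma> (i + 1))"
  have Q: "permute_vars \<sigma> (graph_poly (path_graph n)) = ?Q"
    by (simp add: graph_poly_path permute_vars.hom_prod permute_vars.hom_minus permute_vars_pvar)
  have "path_poly l l n * graph_poly (path_graph n) = vandermonde n ^ l"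
    using path_graph_subset[OF l l, of n]
    by (simp add: path_poly_def flip: graph_poly_union graph_poly_complete_multigraph)
  then have "permute_vars \<sigma> (path_poly l l n) * ?Q = pscale (sign_char \<sigma> ^ l) (vandermonde n ^ l)"
    by (metis Q permute_vandermonde_power[OF \<sigma>] permute_vars.hom_mult)
  then have "path_form l n \<sigma> * ?Q =
      pscale (sign_char \<sigma> ^ l) (pscale (sign_char \<sigma> ^ l) (vandermonde n ^ l))"
    by (simp add: path_form_def pscale_def mult.assoc)
  then have eq: "path_form l n \<sigma> * ?Q = vandermonde n ^ l"
    unfolding cpoly.scale_scale sign_char_power_square by simp
  moreover have "?Q \<noteq> 0" using vandermonde_neq_0[of n] eq by (metis mult_zero_right power_not_zero)
  ultimately have "to_fract (path_form l n \<sigma>) =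
      to_fract (vandermonde n ^ l) * inverse (to_fract ?Q)"
    by (rule to_fract_eq_quotient)
  also have "to_fract ?Q = (\<Prod>i\<in>{1..<1 + n}. xfrac (\<sigma> i) - xfrac (\<sigma> (i + 1)))"
  proof -
    have "{1..<1 + n} = {1..n}" by auto
    then show ?thesis by (simp add: to_fract_hom.hom_prod to_fract_hom.hom_minus)
  qed
  finally show ?thesis
    using word_prod_map_upt[of xfrac \<sigma> 1 n] by (simp add: add.commute del: upt_Suc)
qed

lemma word_span_path_forms:
  "word_span xfrac {1..n + 1} \<subseteq>
    {y. \<exists>p\<in>cpoly.span (path_form l n ` {\<sigma>. \<sigma> permutes {1..n + 1}}).
      to_fract p = to_fract (vandermonde n ^ l) * y}" (is "_ \<subseteq> ?Y")
proof (rule int_module.span_minimal)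
  let ?V = "cpoly.span (path_form l n ` {\<sigma>. \<sigma> permutes {1..n + 1}})"
  show "word_prod xfrac ` permutations_of_set {1..n + 1} \<subseteq> ?Y"
  proof (rule image_subsetI)
    fix w assume "w \<in> permutations_of_set {1..n + 1}"
    then have "w \<in> (\<lambda>\<sigma>. map \<sigma> [1..<n + 1 + 1]) ` {\<sigma>. \<sigma> permutes {1..n + 1}}"
      using bij_betw_permutation_words[of "n + 1"] unfolding bij_betw_def by blast
    then obtain \<sigma> where \<sigma>: "w = map \<sigma> [1..<n + 1 + 1]" "\<sigma> permutes {1..n + 1}" by blast
    then have "path_form l n \<sigma> \<in> ?V" by (intro cpoly.span_base) blast
    then show "word_prod xfrac w \<in> ?Y" using to_fract_path_form[OF \<sigma>(2)] \<sigma>(1) by blast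
  qed
  show "int_module.subspace ?Y"
  proof (rule int_module.subspaceI)
    show "0 \<in> ?Y" by (auto intro!: bexI[of _ 0] cpoly.span_zero)
    fix y assume "y \<in> ?Y"
    then obtain p where p: "p \<in> ?V" "to_fract p = to_fract (vandermonde n ^ l) * y" by blast
    show "y + z \<in> ?Y" if z: "z \<in> ?Y" for z
    proof -
      obtain q where "q \<in> ?V" "to_fract q = to_fract (vandermonde n ^ l) * z" using z by blast
      then have "p + q \<in> ?V \<and> to_fract (p + q) = to_fract (vandermonde n ^ l) * (y + z)"
        using p by (simp add: cpoly.span_add to_fract_hom.hom_add distrib_left)
      then show ?thesis by blast
    qed
    show "of_int c * y \<in> ?Y" for c
    proof -
      have "of_int c * p = pscale (of_int c) p" by (simp add: pscale_def pconst.hom_of_int)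
      then have "of_int c * p \<in> ?V" using p(1) by (simp add: cpoly.span_scale)
      moreover have "to_fract (of_int c * p) = to_fract (vandermonde n ^ l) * (of_int c * y)"
        using p(2) by (simp add: to_fract_hom.hom_mult to_fract_hom.hom_of_int mult.left_commute)
      ultimately show ?thesis by blast
    qed
  qed
qed

theorem slim_component_top_subset_span:
  "slim_component l l n (top_degree l l n) \<subseteq>
    cpoly.span (path_form l n ` {\<sigma>. \<sigma> permutes {1..n + 1}})" (is "_ \<subseteq> ?V")
  unfolding slim_component_eq_span
proof (rule cpoly.span_minimal[OF _ cpoly.subspace_span], rule subsetI)
  let ?K = "complete_multigraph l l n"
  fix p assume "p \<in> {graph_poly G | G. slim l l n G \<and> size G = top_degree l l n}"
  then obtain G where G: "p = graph_poly G" "slim l l n G" "size G = top_degree l l n" by auto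
  have sub: "G \<subseteq># ?K" and connected: "connected_multigraph {1..n + 1} (?K - G)"
    using G(2) by (auto simp: slim_def)
  have "edge_prod xfrac (?K - G) \<in> word_span xfrac {1..n + 1}"
  proof (rule edge_prod_spanning_tree[OF connected _ _ _ _ inj_xfrac])
    show "size (?K - G) = card {1..n + 1} - 1"
      using size_complete_multigraph_top_degree[OF l, of l n] G(3) sub
      by (simp add: size_Diff_submset)
    show "fst e \<in> {1..n + 1} \<and> snd e \<in> {1..n + 1}" if "e \<in># ?K - G" for e
      using complete_multigraph_edge[OF in_diffD[OF that]] by (cases e) (auto simp: mem_all_edges)
  qed auto
  then obtain q where q: "q \<in> ?V"
    "to_fract q = to_fract (vandermonde n ^ l) * edge_prod xfrac (?K - G)"
    using word_span_path_forms by blast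
  then have "to_fract q = to_fract p" using to_fract_graph_poly[OF sub] G(1) by simp
  then show "p \<in> ?V" using q(1) by simp
qed

end


section \<open>The Lie representation\<close>

definition root_unity :: "nat \<Rightarrow> complex" where
  "root_unity n = exp (2 * of_real pi * \<i> / of_nat (n + 1))"

lemma root_unity_neq_0 [simp]: "root_unity n \<noteq> 0"
  by (simp add: root_unity_def)

lemma root_unity_power: "root_unity n ^ k = cis (2 * pi * real k / real (n + 1))"
proof -
  have "root_unity n = cis (2 * pi / real (n + 1))"
    by (simp add: root_unity_def cis_conv_exp mult.commute)
  then show ?thesis by (simp add: DeMoivre field_simps)
qed

lemma root_unity_power_order: "root_unity n ^ (n + 1) = 1"
  unfolding root_unity_power by simp

lemma root_unity_power_mod: "root_unity n ^ (k mod (n + 1)) = root_unity n ^ k"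
proof -
  have "root_unity n ^ k =
      root_unity n ^ ((n + 1) * (k div (n + 1))) * root_unity n ^ (k mod (n + 1))"
    by (simp only: mult_div_mod_eq flip: power_add)
  also have "\<dots> = root_unity n ^ (k mod (n + 1))"
    by (simp only: power_mult root_unity_power_order power_one mult_1_left)
  finally show ?thesis ..
qed

lemma root_unity_power_neq_1:
  assumes "0 < k" "k < n + 1"
  shows "root_unity n ^ k \<noteq> 1"
proof
  assume "root_unity n ^ k = 1"
  then have eq: "cis (2 * pi * real k / real (n + 1)) = cis (2 * pi * real 0 / real (n + 1))"
    unfolding root_unity_power by simp
  have inj: "inj_on (\<lambda>k. cis (2 * pi * real k / real (n + 1))) {..<n + 1}"
    using bij_betw_roots_unity[of "n + 1"] by (simp add: bij_betw_def)
  have "k = 0" by (rule inj_onD[OF inj eq]) (use assms in auto)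
  then show False using assms by simp
qed

lemma long_cycle_permutes: "long_cycle n permutes {1..n + 1}"
proof -
  have "set [1..<n + 2] = {1..n + 1}" by auto
  then show ?thesis unfolding long_cycle_def using cycle_permutes[of "[1..<n + 2]"] by simp
qed

lemma long_cycle_apply:
  assumes i: "i \<in> {1..n + 1}"
  shows "long_cycle n i = i mod (n + 1) + 1"
proof -
  let ?L = "[1..<n + 2]"
  have L: "?L ! j = j + 1" if "j < n + 1" for j
    using that by (simp add: add.commute del: upt_Suc)
  have "map (long_cycle n) ?L = rotate1 ?L"
    using cyclic_rotation[of ?L 1] by (simp add: long_cycle_def One_nat_def del: upt_Suc)
  moreover have "i - 1 < length ?L" using i by auto
  ultimately have "long_cycle n (?L ! (i - 1)) = ?L ! (Suc (i - 1) mod length ?L)"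
    by (metis nth_map nth_rotate1)
  moreover have "i mod (n + 1) < n + 1" by (rule mod_less_divisor) simp
  ultimately show ?thesis using i L[of "i - 1"] L[of "i mod (n + 1)"]
    by (simp add: Suc_eq_plus1 del: upt_Suc)
qed

lemma long_cycle_funpow_permutes: "(long_cycle n ^^ k) permutes {1..n + 1}"
proof (induction k)
  case 0
  then show ?case using permutes_id by (simp add: id_def)
next
  case (Suc k)
  show ?case using permutes_compose[OF Suc long_cycle_permutes] by (simp add: comp_def)
qed

lemma long_cycle_funpow_apply:
  assumes "i \<in> {1..n + 1}"
  shows "(long_cycle n ^^ k) i = (i - 1 + k) mod (n + 1) + 1"
proof (induction k)
  case 0
  then show ?case using assms by auto
next
  case (Suc k)
  have "(i - 1 + k) mod (n + 1) < n + 1" by (rule mod_less_divisor) simp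
  then have "(i - 1 + k) mod (n + 1) + 1 \<in> {1..n + 1}" unfolding atLeastAtMost_iff by linarith
  then have "(long_cycle n ^^ Suc k) i = ((i - 1 + k) mod (n + 1) + 1) mod (n + 1) + 1"
    by (simp add: Suc.IH long_cycle_apply)
  also have "((i - 1 + k) mod (n + 1) + 1) mod (n + 1) = (i - 1 + Suc k) mod (n + 1)"
    by (metis Suc_eq_plus1 add_Suc_right mod_add_left_eq)
  finally show ?case .
qed

lemma sym_group_nat_pow: "\<sigma> [^]\<^bsub>sym_group n\<^esub> (k::nat) = \<sigma> ^^ k"
  by (induction k) (simp_all add: nat_pow_def sym_group_def funpow_Suc_right del: funpow.simps(2))

lemma cyclic_subgroup_eq_funpow: "cyclic_subgroup n = range (\<lambda>k. long_cycle n ^^ k)"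
proof -
  interpret group "sym_group (n + 1)" by (rule sym_group_is_group)
  have "finite (carrier (sym_group (n + 1)))" by (simp add: sym_group_def finite_permutations)
  then show ?thesis
    unfolding cyclic_subgroup_def
    by (subst generate_pow_on_finite_carrier)
      (auto simp: sym_group_carrier long_cycle_permutes sym_group_nat_pow)
qed

lemma is_rep_lie_rep: "is_rep (sym_group (n + 1)) (lie_rep n)"
  unfolding lie_rep_def
  by (rule is_rep_induced_char[OF sym_group_is_group])
    (auto simp: cyclic_subgroup_eq_funpow sym_group_carrier long_cycle_funpow_permutes)

lemma rep_scale_lie_rep: "rep_scale (lie_rep n) = (\<lambda>c F g. c * F g)"
  by (simp add: lie_rep_def induced_rep_def char_rep_def)

lemma rep_act_lie_rep:
  "rep_act (lie_rep n) \<tau> F = (\<lambda>g. if g permutes {1..n + 1} then F (g \<circ> \<tau>) else 0)"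
  by (simp add: lie_rep_def induced_rep_def sym_group_def cong: if_cong)

lemma equivariant_funpow:
  assumes "\<And>g. g permutes A \<Longrightarrow> F (c \<circ> g) = (\<omega> :: 'a::monoid_mult) * F g"
    and "c permutes A" "g permutes A"
  shows "F ((c ^^ k) \<circ> g) = \<omega> ^ k * F g"
proof (induction k)
  case (Suc k)
  have "(c ^^ k) \<circ> g permutes A"
    using permutes_compose[OF assms(3) permutes_funpow[OF assms(2)]] .
  then have "F (c \<circ> ((c ^^ k) \<circ> g)) = \<omega> * (\<omega> ^ k * F g)" by (simp add: assms(1) Suc)
  then show ?case by (simp add: comp_def mult.assoc)
qed (simp add: comp_def)

lemma mem_lie_rep:
  assumes "n \<ge> 1"
  shows "F \<in> rep_space (lie_rep n) \<longleftrightarrow> (\<forall>g. \<not> g permutes {1..n + 1} \<longrightarrow> F g = 0) \<and>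
    (\<forall>g. g permutes {1..n + 1} \<longrightarrow> F (long_cycle n \<circ> g) = root_unity n * F g)"
proof -
  let ?c = "long_cycle n"
  have mem: "F \<in> rep_space (lie_rep n) \<longleftrightarrow> (\<forall>g. \<not> g permutes {1..n + 1} \<longrightarrow> F g = 0) \<and>
      (\<forall>h\<in>range (\<lambda>k. ?c ^^ k). \<forall>g. g permutes {1..n + 1} \<longrightarrow> F (h \<circ> g) = zeta n h * F g)"
    by (simp add: lie_rep_def induced_rep_def char_rep_def sym_group_def
        flip: cyclic_subgroup_eq_funpow)
  have "?c \<noteq> id" using long_cycle_apply[of 1 n] assms by auto
  then have "(LEAST k. ?c ^^ k = ?c) = 1"
    by (intro Least_equality) (auto simp: One_nat_def Suc_le_eq intro!: gr0I)
  then have zeta: "zeta n ?c = root_unity n" by (simp add: zeta_def root_unity_def)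
  have "F (h \<circ> g) = zeta n h * F g"
    if eq: "\<And>g. g permutes {1..n + 1} \<Longrightarrow> F (?c \<circ> g) = root_unity n * F g"
      and h: "h \<in> range (\<lambda>k. ?c ^^ k)" and g: "g permutes {1..n + 1}" for h g
  proof -
    let ?k = "LEAST k. ?c ^^ k = h"
    have "?c ^^ ?k = h" by (rule LeastI_ex) (use h in auto)
    then show ?thesis
      using equivariant_funpow[of _ F ?c, OF eq long_cycle_permutes g, of ?k]
      by (simp add: zeta_def root_unity_def)
  qed
  moreover have "?c \<in> range (\<lambda>k. ?c ^^ k)" by (rule range_eqI[of _ _ 1]) (simp add: One_nat_def)
  ultimately show ?thesis unfolding mem using zeta by metis
qed


subsection \<open>The major index\<close>

definition major_index :: "nat \<Rightarrow> (nat \<Rightarrow> nat) \<Rightarrow> nat" where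
  "major_index N g = (\<Sum>i\<in>{1..<N}. if g i < g (i + 1) then 0 else i)"

definition major_weight :: "nat \<Rightarrow> (nat \<Rightarrow> nat) \<Rightarrow> complex" where
  "major_weight n g =
    (if g permutes {1..n + 1} then inverse (root_unity n) ^ major_index (n + 1) g else 0)"

lemma power_major_index:
  "q ^ major_index N g = (\<Prod>i\<in>{1..<N}. if g i < g (i + 1) then 1 else q ^ i)"
  unfolding major_index_def power_sum by (intro prod.cong) auto

text \<open>
  Multiplying \<open>g\<close> by the cycle moves the descent after the position \<open>p\<close> of the largest value one
  step to the left.
\<close>

lemma major_index_long_cycle:
  assumes g: "g permutes {1..n + 1}" and p: "g p = n + 1"
  shows "major_index (n + 1) (long_cycle n \<circ> g) + (if p \<le> n then p else 0) =
    major_index (n + 1) g + (p - 1)"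
proof -
  let ?c = "long_cycle n" and ?I = "{1..<n + 1}"
  have gp: "g i = n + 1 \<longleftrightarrow> i = p" for i
    using p permutes_inj[OF g] by (metis injD)
  have gin: "g i \<in> {1..n + 1}" if "i \<in> {1..n + 1}" for i
    using permutes_in_image[OF g] that by blast
  have p_range: "p \<in> {1..n + 1}" using permutes_in_image[OF g, of p] p by simp
  have c: "?c x = (if x = n + 1 then 1 else x + 1)" if "x \<in> {1..n + 1}" for x
    using long_cycle_apply[OF that] that by auto
  have "(if (?c \<circ> g) i < (?c \<circ> g) (i + 1) then 0 else i) + (if i = p then i else 0) =
      (if g i < g (i + 1) then 0 else i) + (if i + 1 = p then i else 0)" if i: "i \<in> ?I" for i
  proof -
    have i1: "g i \<in> {1..n + 1}" "g (i + 1) \<in> {1..n + 1}" using i gin by auto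
    have ne: "g i \<noteq> g (i + 1)" using permutes_inj[OF g] by (metis Suc_eq_plus1 injD n_not_Suc_n)
    show ?thesis
      using i1 ne unfolding comp_def c[OF i1(1)] c[OF i1(2)] gp[symmetric] by auto
  qed
  then have "major_index (n + 1) (?c \<circ> g) + (\<Sum>i\<in>?I. if i = p then i else 0) =
      major_index (n + 1) g + (\<Sum>i\<in>?I. if i + 1 = p then i else 0)"
    unfolding major_index_def sum.distrib[symmetric] by (rule sum.cong[OF refl])
  moreover have "(\<Sum>i\<in>?I. if i = p then i else 0) = (if p \<le> n then p else 0)"
    using p_range by auto
  moreover have "(\<Sum>i\<in>?I. if i + 1 = p then i else 0) = (\<Sum>i\<in>?I. if i = p - 1 then i else 0)"
    using p_range by (intro sum.cong) auto
  moreover have "(\<Sum>i\<in>?I. if i = p - 1 then i else 0) = p - 1"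
    using p_range by (cases "p = 1") auto
  ultimately show ?thesis by simp
qed

lemma major_index_long_cycle_mod:
  assumes g: "g permutes {1..n + 1}"
  shows "(major_index (n + 1) (long_cycle n \<circ> g) + 1) mod (n + 1) =
    major_index (n + 1) g mod (n + 1)"
proof -
  define p where "p = inv' g (n + 1)"
  have p: "g p = n + 1" by (simp add: p_def permutes_inverses[OF g])
  then have "p \<in> {1..n + 1}" using permutes_in_image[OF g, of p] by simp
  then consider "1 \<le> p" "p \<le> n" | "p = n + 1" by fastforce
  then show ?thesis
  proof cases
    case 1
    then have "major_index (n + 1) (long_cycle n \<circ> g) + 1 = major_index (n + 1) g"
      using major_index_long_cycle[OF g p] by simp
    then show ?thesis by (rule arg_cong)
  next
    case 2
    then have "major_index (n + 1) (long_cycle n \<circ> g) + 1 = major_index (n + 1) g + (n + 1)"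
      using major_index_long_cycle[OF g p] by simp
    then show ?thesis by (simp only: mod_add_self2)
  qed
qed

lemma major_weight_in_lie_rep:
  assumes "n \<ge> 1"
  shows "major_weight n \<in> rep_space (lie_rep n)"
  unfolding mem_lie_rep[OF assms]
proof (intro conjI allI impI)
  show "major_weight n g = 0" if "\<not> g permutes {1..n + 1}" for g
    using that by (simp only: major_weight_def if_False)
  fix g assume g: "g permutes {1..n + 1}"
  let ?maj = "major_index (n + 1)" and ?\<omega> = "root_unity n"
  have "?\<omega> ^ (?maj (long_cycle n \<circ> g) + 1) = ?\<omega> ^ ?maj g"
    by (metis major_index_long_cycle_mod[OF g] root_unity_power_mod)
  then have "?\<omega> * ?\<omega> ^ ?maj (long_cycle n \<circ> g) = ?\<omega> ^ ?maj g"
    by (simp only: power_add power_one_right mult.commute)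
  then have "inverse ?\<omega> ^ ?maj (long_cycle n \<circ> g) = ?\<omega> * inverse ?\<omega> ^ ?maj g"
    by (simp add: field_simps)
  then show "major_weight n (long_cycle n \<circ> g) = ?\<omega> * major_weight n g"
    using g permutes_compose[OF g long_cycle_permutes] by (simp add: major_weight_def)
qed


subsection \<open>The equivariant map onto the top degree component\<close>

definition lie_map :: "nat \<Rightarrow> nat \<Rightarrow> ((nat \<Rightarrow> nat) \<Rightarrow> complex) \<Rightarrow> cpoly" where
  "lie_map l n F = (\<Sum>\<sigma>\<in>{\<sigma>. \<sigma> permutes {1..n + 1}}. pscale (F (inv' \<sigma>)) (path_form l n \<sigma>))"

interpretation lie_map: module_hom "\<lambda>c F g. c * F g" pscale "lie_map l n" for l n
proof -
  interpret fun_space: vector_space "\<lambda>c (F :: (nat \<Rightarrow> nat) \<Rightarrow> complex) g. c * F g"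
    by (rule vector_space_fun_mult)
  show "module_hom (\<lambda>c F g. c * F g) pscale (lie_map l n)"
    by unfold_locales
      (simp_all add: lie_map_def cpoly.scale_left_distrib sum.distrib cpoly.scale_sum_right)
qed

lemma subspace_lie_rep: "lie_map.m1.subspace (rep_space (lie_rep n))"
  using is_rep_lie_rep[of n] by (simp add: is_rep_def rep_scale_lie_rep)

text \<open>
  Every permutation is uniquely a power of the cycle times a permutation fixing \<open>n + 1\<close>, so the
  induced space has dimension at most \<open>n!\<close>, which is the number of parking functions of top degree.
\<close>

definition cycle_factor :: "nat \<Rightarrow> (nat \<Rightarrow> nat) \<Rightarrow> nat \<Rightarrow> nat" where
  "cycle_factor n g = inv' (long_cycle n ^^ g (n + 1)) \<circ> g"

lemma long_cycle_funpow_cycle_factor: "(long_cycle n ^^ g (n + 1)) \<circ> cycle_factor n g = g"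
  by (simp add: cycle_factor_def fun_eq_iff permutes_inverses[OF long_cycle_funpow_permutes])

lemma cycle_factor_permutes:
  assumes g: "g permutes {1..n + 1}"
  shows "cycle_factor n g permutes {1..n}"
proof (rule permutes_superset)
  let ?N = "n + 1" and ?c = "long_cycle n"
  show "cycle_factor n g permutes {1..?N}"
    unfolding cycle_factor_def
    by (rule permutes_compose[OF g permutes_inv[OF long_cycle_funpow_permutes]])
  have gN: "g ?N \<in> {1..?N}" using permutes_in_image[OF g, of ?N] by simp
  then have "?N - 1 + g ?N = (g ?N - 1) + ?N" "g ?N - 1 < ?N" by auto
  then have "(?c ^^ g ?N) ?N = g ?N"
    using gN by (subst long_cycle_funpow_apply) (simp_all only: mod_add_self2 mod_less, simp_all)
  then have "cycle_factor n g ?N = ?N"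
    using permutes_inverses(2)[OF long_cycle_funpow_permutes] by (metis comp_apply cycle_factor_def)
  moreover have "x = ?N" if "x \<in> {1..?N} - {1..n}" for x using that by auto
  ultimately show "cycle_factor n g x = x" if "x \<in> {1..?N} - {1..n}" for x using that by metis
qed

lemma lie_rep_cycle_factor:
  assumes "n \<ge> 1" "F \<in> rep_space (lie_rep n)" and g: "g permutes {1..n + 1}"
  shows "F g = root_unity n ^ g (n + 1) * F (cycle_factor n g)"
proof -
  have "F (long_cycle n \<circ> h) = root_unity n * F h" if "h permutes {1..n + 1}" for h
    using assms(2) that by (simp add: mem_lie_rep[OF assms(1)])
  moreover have "cycle_factor n g permutes {1..n + 1}"
    using permutes_Suc_range[OF cycle_factor_permutes[OF g]] .
  ultimately have "F ((long_cycle n ^^ g (n + 1)) \<circ> cycle_factor n g) =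
      root_unity n ^ g (n + 1) * F (cycle_factor n g)"
    by (rule equivariant_funpow[OF _ long_cycle_permutes])
  then show ?thesis unfolding long_cycle_funpow_cycle_factor .
qed

lemma lie_map_expansion:
  assumes "n \<ge> 1"
  obtains u where "\<And>F. F \<in> rep_space (lie_rep n) \<Longrightarrow>
    lie_map l n F = (\<Sum>h\<in>{h. h permutes {1..n}}. pscale (F h) (u h))"
proof
  let ?perms = "{\<sigma>. \<sigma> permutes {1..n + 1}}" and ?H = "{h. h permutes {1..n}}"
  define u where "u h = (\<Sum>\<sigma>\<in>{\<sigma> \<in> ?perms. cycle_factor n (inv' \<sigma>) = h}.
    pscale (root_unity n ^ inv' \<sigma> (n + 1)) (path_form l n \<sigma>))" for h
  fix F assume F: "F \<in> rep_space (lie_rep n)"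
  have "lie_map l n F = (\<Sum>h\<in>?H. \<Sum>\<sigma>\<in>{\<sigma> \<in> ?perms. cycle_factor n (inv' \<sigma>) = h}.
      pscale (F (inv' \<sigma>)) (path_form l n \<sigma>))"
    unfolding lie_map_def
    by (rule sum.group[symmetric])
      (auto intro: finite_permutations cycle_factor_permutes permutes_inv)
  also have "\<dots> = (\<Sum>h\<in>?H. pscale (F h) (u h))"
    unfolding u_def cpoly.scale_sum_right
    by (intro sum.cong refl)
      (auto simp: lie_rep_cycle_factor[OF assms F permutes_inv] mult.commute)
  finally show "lie_map l n F = (\<Sum>h\<in>?H. pscale (F h) (u h))" .
qed

lemma (in vector_space) sum_scale_eq_0D_by_card:
  assumes H: "finite H" and B: "independent B" "B \<subseteq> span (u ` H)" "card H \<le> card B"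
    and zero: "(\<Sum>h\<in>H. scale (c h) (u h)) = 0" and h0: "h0 \<in> H"
  shows "c h0 = 0"
proof (rule ccontr)
  assume c0: "c h0 \<noteq> 0"
  let ?T = "u ` (H - {h0})"
  have "scale (c h0) (u h0) = - (\<Sum>h\<in>H - {h0}. scale (c h) (u h))"
    using zero sum.remove[OF H h0, of "\<lambda>h. scale (c h) (u h)"] by (simp add: eq_neg_iff_add_eq_0)
  also have "\<dots> \<in> span ?T"
    by (intro span_neg span_sum span_scale span_base) auto
  finally have "scale (inverse (c h0)) (scale (c h0) (u h0)) \<in> span ?T" by (rule span_scale)
  then have "u h0 \<in> span ?T" using c0 by simp
  moreover have "u h \<in> span ?T" if "h \<in> H - {h0}" for h using that by (intro span_base imageI)
  ultimately have "u ` H \<subseteq> span ?T" by fast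
  then have "B \<subseteq> span ?T" using B(2) span_minimal[OF _ subspace_span] by blast
  then have "card B \<le> card ?T" using independent_span_bound[OF _ B(1), of ?T] H by simp
  also have "\<dots> \<le> card (H - {h0})" using H by (intro card_image_le) simp
  also have "\<dots> < card H" using H h0 by (rule card_Diff1_less)
  finally show False using B(3) by simp
qed

lemma slim_component_independent:
  assumes T: "finite T" "T \<subseteq> parking_degree l m n k"
  obtains B where "B \<subseteq> slim_component l m n k" "cpoly.independent B" "card B = card T"
proof -
  have "\<exists>p. p \<in> slim_component l m n k \<and>
      (\<forall>f\<in>parking_degree l m n k. lookup p f = (if f = t then 1 else 0))" for t
    using slim_component_prescribed_coeffs[of l m n k "\<lambda>f. if f = t then 1 else 0"] by metis
  then obtain b where b: "\<And>t. b t \<in> slim_component l m n k"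
    and dual: "\<And>t f. f \<in> T \<Longrightarrow> lookup (b t) f = (if f = t then 1 else 0)"
    using T(2) by (metis subsetD)
  have inj: "inj_on b T"
    by (rule inj_onI) (metis dual zero_neq_one)
  have "cpoly.independent (b ` T)"
  proof (rule cpoly.independent_if_scalars_zero)
    fix f x assume sum: "(\<Sum>x\<in>b ` T. pscale (f x) x) = 0" and "x \<in> b ` T"
    then obtain t where t: "t \<in> T" "x = b t" by auto
    have "0 = lookup (\<Sum>t'\<in>T. pscale (f (b t')) (b t')) t"
      using sum by (simp add: sum.reindex[OF inj])
    also have "\<dots> = (\<Sum>t'\<in>T. if t = t' then f (b t') else 0)"
      unfolding lookup_sum lookup_pscale using dual[OF t(1)] by (intro sum.cong) auto
    also have "\<dots> = f (b t)" using T(1) t(1) by simp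
    finally show "f x = 0" by (simp add: t(2))
  qed (simp add: T(1))
  then show ?thesis using that[of "b ` T"] b card_image[OF inj] by blast
qed

context
  fixes l n :: nat
  assumes l: "l \<ge> 1" and n: "n \<ge> 1"
begin

lemma lie_map_in_slim_component: "lie_map l n F \<in> slim_component l l n (top_degree l l n)"
  unfolding lie_map_def
  by (intro cpoly.subspace_sum[OF subspace_slim_component]
      cpoly.subspace_scale[OF subspace_slim_component] path_form_in_slim_component[OF l]) simp

lemma lie_map_act:
  assumes \<tau>: "\<tau> permutes {1..n + 1}"
  shows "pscale (sign_char \<tau> ^ l) (lie_map l n (rep_act (lie_rep n) \<tau> F)) =
    permute_vars \<tau> (lie_map l n F)"
proof -
  let ?perms = "{\<sigma>. \<sigma> permutes {1..n + 1}}" and ?s = "sign_char \<tau> ^ l"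
  have inv: "inv' (\<tau> \<circ> \<sigma>) \<circ> \<tau> = inv' \<sigma>" if "\<sigma> permutes {1..n + 1}" for \<sigma>
  proof -
    have "inv' (\<tau> \<circ> \<sigma>) \<circ> \<tau> = inv' \<sigma> \<circ> (inv' \<tau> \<circ> \<tau>)"
      using that \<tau> by (simp add: o_inv_distrib permutes_bij comp_assoc)
    then show ?thesis by (simp add: permutes_inv_o[OF \<tau>])
  qed
  have "lie_map l n (rep_act (lie_rep n) \<tau> F) =
      (\<Sum>\<sigma>\<in>?perms. pscale (F (inv' \<sigma> \<circ> \<tau>)) (path_form l n \<sigma>))"
    unfolding lie_map_def rep_act_lie_rep by (intro sum.cong) (auto simp: permutes_inv)
  also have "\<dots> = (\<Sum>\<sigma>\<in>?perms. pscale (F (inv' (\<tau> \<circ> \<sigma>) \<circ> \<tau>)) (path_form l n (\<tau> \<circ> \<sigma>)))"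
    by (rule setum_permutations_compose_left[OF \<tau>])
  also have "\<dots> = (\<Sum>\<sigma>\<in>?perms. pscale (F (inv' \<sigma>)) (path_form l n (\<tau> \<circ> \<sigma>)))"
    by (intro sum.cong) (auto simp: inv)
  also have "pscale ?s \<dots> = permute_vars \<tau> (lie_map l n F)"
    unfolding lie_map_def permute_vars.hom_sum cpoly.scale_sum_right
    by (intro sum.cong) (simp_all add: permute_vars.scale permute_path_form[OF l _ \<tau>] mult.commute)
  finally show ?thesis .
qed

lemma lie_map_major_weight:
  "lie_map l n (major_weight n) =
    pscale (\<Prod>i\<in>{1..<n + 1}. 1 - inverse (root_unity n) ^ i) (path_form l n id)"
proof -
  let ?A = "to_fract (vandermonde n ^ l)" and ?q = "inverse (root_unity n)"
  let ?k = "\<lambda>c. to_fract (pconst c)" and ?I = "{1..<n + 1}"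
  let ?perms = "{\<sigma>. \<sigma> permutes {1..n + 1}}" and ?word = "\<lambda>\<sigma>. map \<sigma> [1..<n + 1 + 1]"
  let ?weight = "\<lambda>w. \<Prod>i\<in>?I. if before w i (i + 1) then 1 else ?k (?q ^ i)"
  interpret const: comm_ring_hom ?k
    by unfold_locales (simp_all add: pconst.hom_add pconst.hom_mult)
  have scale: "to_fract (pscale c p) = ?k c * to_fract p" for c p
    by (simp add: pscale_def to_fract_hom.hom_mult)
  have weight: "?k (major_weight n (inv' \<sigma>)) = ?weight (?word \<sigma>)"
    if \<sigma>: "\<sigma> permutes {1..n + 1}" for \<sigma>
  proof -
    have "major_weight n (inv' \<sigma>) = (\<Prod>i\<in>?I. if inv' \<sigma> i < inv' \<sigma> (i + 1) then 1 else ?q ^ i)"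
      by (simp add: major_weight_def permutes_inv[OF \<sigma>] power_major_index)
    also have "\<dots> = (\<Prod>i\<in>?I. if before (?word \<sigma>) i (i + 1) then 1 else ?q ^ i)"
      by (rule prod.cong) (simp_all add: before_map_permutation[OF \<sigma>] del: upt_Suc)
    finally show ?thesis
      by (simp add: const.hom_prod if_distrib[of ?k] del: upt_Suc cong: if_cong)
  qed
  have "to_fract (lie_map l n (major_weight n)) =
      (\<Sum>\<sigma>\<in>?perms. ?k (major_weight n (inv' \<sigma>)) * to_fract (path_form l n \<sigma>))"
    by (simp add: lie_map_def to_fract_hom.hom_sum scale)
  also have "\<dots> = (\<Sum>\<sigma>\<in>?perms. ?A * (?weight (?word \<sigma>) * word_prod xfrac (?word \<sigma>)))"
    by (intro sum.cong refl)
      (simp add: weight to_fract_path_form[OF l] mult.left_commute del: upt_Suc)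
  also have "\<dots> = ?A * (\<Sum>\<sigma>\<in>?perms. ?weight (?word \<sigma>) * word_prod xfrac (?word \<sigma>))"
    by (rule sum_distrib_left[symmetric])
  also have "(\<Sum>\<sigma>\<in>?perms. ?weight (?word \<sigma>) * word_prod xfrac (?word \<sigma>)) =
      (\<Sum>w\<in>permutations_of_set {1..n + 1}. ?weight w * word_prod xfrac w)"
    by (rule sum.reindex_bij_betw[OF bij_betw_permutation_words])
  also have "\<dots> = (\<Prod>i\<in>?I. 1 - ?k (?q ^ i)) * word_prod xfrac [1..<n + 1 + 1]"
    by (rule klyachko_sum[OF inj_xfrac])
  also have "?A * \<dots> = ?k (\<Prod>i\<in>?I. 1 - ?q ^ i) * to_fract (path_form l n id)"
    using to_fract_path_form[OF l permutes_id, of n]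
    by (simp add: const.hom_prod const.hom_minus mult_ac del: upt_Suc)
  finally show ?thesis by (simp flip: scale)
qed

lemma path_form_in_lie_map_image:
  assumes \<tau>: "\<tau> permutes {1..n + 1}"
  shows "path_form l n \<tau> \<in> lie_map l n ` rep_space (lie_rep n)" (is "_ \<in> ?image")
proof -
  let ?\<kappa> = "\<Prod>i\<in>{1..<n + 1}. 1 - inverse (root_unity n) ^ i"
  have image: "cpoly.subspace ?image" by (rule lie_map.subspace_image[OF subspace_lie_rep])
  have "inverse (root_unity n) ^ i \<noteq> 1" if "i \<in> {1..<n + 1}" for i
    using root_unity_power_neq_1[of i n] that by (simp add: power_inverse)
  then have "?\<kappa> \<noteq> 0" by (auto simp: prod_zero_iff)
  moreover have "pscale ?\<kappa> (path_form l n id) \<in> ?image"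
    unfolding lie_map_major_weight[symmetric] by (intro imageI major_weight_in_lie_rep n)
  then have "pscale (inverse ?\<kappa>) (pscale ?\<kappa> (path_form l n id)) \<in> ?image"
    by (rule cpoly.subspace_scale[OF image])
  ultimately have "path_form l n id \<in> ?image" by simp
  then obtain F where F: "F \<in> rep_space (lie_rep n)" "lie_map l n F = path_form l n id" by auto
  let ?s = "sign_char \<tau> ^ l"
  have "rep_act (lie_rep n) \<tau> F \<in> rep_space (lie_rep n)"
    using is_repD(5)[OF is_rep_lie_rep] F(1) \<tau> by (simp add: sym_group_carrier)
  moreover have "pscale ?s (lie_map l n (rep_act (lie_rep n) \<tau> F)) = pscale ?s (path_form l n \<tau>)"
    using lie_map_act[OF \<tau>, of F] permute_path_form[OF l permutes_id \<tau>] by (simp add: F(2))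
  then have "lie_map l n (rep_act (lie_rep n) \<tau> F) = path_form l n \<tau>"
    using sign_char_power_square[of \<tau> l] by (metis cpoly.scale_one cpoly.scale_scale)
  ultimately show ?thesis by (metis imageI)
qed

lemma lie_map_image:
  "lie_map l n ` rep_space (lie_rep n) = slim_component l l n (top_degree l l n)"
proof (rule subset_antisym)
  show "lie_map l n ` rep_space (lie_rep n) \<subseteq> slim_component l l n (top_degree l l n)"
    using lie_map_in_slim_component by blast
  have "cpoly.span (path_form l n ` {\<sigma>. \<sigma> permutes {1..n + 1}}) \<subseteq>
      lie_map l n ` rep_space (lie_rep n)"
    by (rule cpoly.span_minimal[OF _ lie_map.subspace_image[OF subspace_lie_rep]])
      (use path_form_in_lie_map_image in blast)
  then show "slim_component l l n (top_degree l l n) \<subseteq> lie_map l n ` rep_space (lie_rep n)"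
    using slim_component_top_subset_span[OF l] by blast
qed

lemma inj_on_lie_map: "inj_on (lie_map l n) (rep_space (lie_rep n))"
  unfolding lie_map.inj_on_iff_eq_0[OF subspace_lie_rep]
proof (intro ballI impI)
  fix F assume F: "F \<in> rep_space (lie_rep n)" "lie_map l n F = 0"
  let ?H = "{h. h permutes {1..n}}"
  obtain u where u: "\<And>F. F \<in> rep_space (lie_rep n) \<Longrightarrow>
      lie_map l n F = (\<Sum>h\<in>?H. pscale (F h) (u h))"
    using lie_map_expansion[OF n] by metis
  obtain T where T: "T \<subseteq> parking_degree l l n (top_degree l l n)" "finite T" "card T = fact n"
    using top_parking_functions[OF l l] by metis
  then obtain B where B: "B \<subseteq> slim_component l l n (top_degree l l n)"
    "cpoly.independent B" "card B = fact n"
    using slim_component_independent by metis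
  have "F h = 0" if "h \<in> ?H" for h
  proof (rule cpoly.sum_scale_eq_0D_by_card[OF _ B(2) _ _ _ that])
    show "finite ?H" by (simp add: finite_permutations)
    show "card ?H \<le> card B" by (simp add: card_permutations B(3))
    show "(\<Sum>h\<in>?H. pscale (F h) (u h)) = 0" using u[OF F(1)] F(2) by simp
    have "lie_map l n G \<in> cpoly.span (u ` ?H)" if "G \<in> rep_space (lie_rep n)" for G
      unfolding u[OF that] by (intro cpoly.span_sum cpoly.span_scale cpoly.span_base imageI)
    then show "B \<subseteq> cpoly.span (u ` ?H)" using B(1) unfolding lie_map_image[symmetric] by blast
  qed
  then have "F g = 0" if "g permutes {1..n + 1}" for g
    using lie_rep_cycle_factor[OF n F(1) that] cycle_factor_permutes[OF that] by simp
  moreover have "F g = 0" if "\<not> g permutes {1..n + 1}" for g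
    using F(1) that by (simp add: mem_lie_rep[OF n])
  ultimately show "F = 0" by (auto simp: fun_eq_iff)
qed

theorem slim_component_top_lie:
  "rep_iso (sym_group (n + 1)) (slim_rep l l n (top_degree l l n))
    (tensor_char (lie_rep n) (\<lambda>\<sigma>. sign_char \<sigma> ^ l))" (is "rep_iso ?G ?R ?S")
proof (rule rep_iso_sym, rule rep_isoI[where \<phi> = "lie_map l n"])
  show "is_rep ?G ?R" by (rule is_rep_slim_rep) simp
  show "is_rep ?G ?S"
    by (rule is_rep_tensor_char[OF is_rep_lie_rep])
      (auto simp: sym_group_carrier sym_group_mult sym_group_one sign_char_def[of id]
        sign_char_compose[of "{1..n + 1}"] power_mult_distrib)
  show "bij_betw (lie_map l n) (rep_space ?S) (rep_space ?R)"
    using inj_on_lie_map lie_map_image by (simp add: bij_betw_def tensor_char_def slim_rep_def)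
  show "lie_map l n (F + G) = lie_map l n F + lie_map l n G" for F G by (rule lie_map.add)
  show "lie_map l n (rep_scale ?S c F) = rep_scale ?R c (lie_map l n F)" for c F
    by (simp add: tensor_char_def rep_scale_lie_rep slim_rep_def lie_map.scale)
  show "lie_map l n (rep_act ?S \<tau> F) = rep_act ?R \<tau> (lie_map l n F)" if "\<tau> \<in> carrier ?G" for \<tau> F
    using lie_map_act[of \<tau> F] that
    by (simp add: tensor_char_def rep_scale_lie_rep slim_rep_def sym_group_carrier lie_map.scale)
qed

end

theorem theorem3:
  fixes l m n :: nat
  assumes "l \<ge> 1" and "m \<ge> 1" and "n \<ge> 1"
  shows "(\<forall>k. rep_iso (sym_group n) (slim_rep l m n k)
              (direct_sum_rep {D. dyck_path l m n D \<and> area l D = k}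
                 (\<lambda>D. young_module n (vertical_run_partition D)))) \<and>
         (\<forall>k<n. slim_component l m n k =
              cpoly.span {prod_list fs | fs. length fs = k \<and> set fs \<subseteq> slim_component l m n 1}) \<and>
         (l = m \<longrightarrow>
            (\<forall>\<sigma>\<in>carrier (sym_group (n + 1)). permute_vars \<sigma> ` slim_space l m n \<subseteq> slim_space l m n) \<and>
            (\<not> (l = 1 \<and> n = 1) \<longrightarrow>
               rep_iso (sym_group (n + 1)) (slim_rep l m n 1) (reflection_rep (n + 1))) \<and>
            (\<exists>d. slim_component l m n d \<noteq> {0} \<and>
                 (\<forall>k>d. slim_component l m n k = {0}) \<and>
                 rep_iso (sym_group (n + 1)) (slim_rep l m n d)
                   (tensor_char (lie_rep n) (\<lambda>\<sigma>. sign_char \<sigma> ^ l))))"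
proof (intro conjI allI impI ballI)
  show "rep_iso (sym_group n) (slim_rep l m n k)
      (direct_sum_rep {D. dyck_path l m n D \<and> area l D = k}
        (\<lambda>D. young_module n (vertical_run_partition D)))" for k
    by (rule slim_component_dyck[OF assms(1,2)])
  show "slim_component l m n k =
      cpoly.span {prod_list fs | fs. length fs = k \<and> set fs \<subseteq> slim_component l m n 1}"
    if "k < n" for k
    by (rule slim_component_eq_span_products[OF assms(1,2) that])
  assume lm: "l = m"
  show "permute_vars \<sigma> ` slim_space l m n \<subseteq> slim_space l m n"
    if "\<sigma> \<in> carrier (sym_group (n + 1))" for \<sigma>
    using that lm by (intro permute_vars_slim_space) (simp_all add: sym_group_carrier)
  show "rep_iso (sym_group (n + 1)) (slim_rep l m n 1) (reflection_rep (n + 1))"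
    if "\<not> (l = 1 \<and> n = 1)"
    using slim_component_1_reflection[OF assms(1,3) that] lm by simp
  show "\<exists>d. slim_component l m n d \<noteq> {0} \<and> (\<forall>k>d. slim_component l m n k = {0}) \<and>
      rep_iso (sym_group (n + 1)) (slim_rep l m n d)
        (tensor_char (lie_rep n) (\<lambda>\<sigma>. sign_char \<sigma> ^ l))"
    using slim_component_top_nonzero[OF assms(1,2)] slim_component_above_top[OF assms(1)]
      slim_component_top_lie[OF assms(1,3)]
    unfolding lm by blast
qed

end
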